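(* Let $\beta,\lambda$ satisfy the coefficient assumptions (i)–(iii) of the context, let $y\in\mathbb R$, and let $\Xi_T\in L^2(\mathcal F_T)$ satisfy $\Lambda_\Xi:=\int_0^T\frac{d\,\mathbb E[\Xi_t^2]}{T-t}<\infty$. Fix $0<\varepsilon\le T^2/4$. Define $$\bar Q_t^\varepsilon:=\frac1{\sqrt\varepsilon}\int_0^te^{-(t-r)/\sqrt\varepsilon}Q^0_r\,dr,\qquad0\le t<T,$$ and $$Q^\varepsilon_t:=\begin{cases}\bar Q^\varepsilon_t,&0\le t\le T-\sqrt\varepsilon,\\[1ex]\dfrac{T-t}{\sqrt\varepsilon}\,\bar Q^\varepsilon_{T-\sqrt\varepsilon}+(T-t)\displaystyle\int_{T-\sqrt\varepsilon}^t\frac{\Xi_r}{(T-r)^2}\,dr,&T-\sqrt\varepsilon<t<T,\\[1ex]\Xi_T,&t=T.\end{cases}$$ Then $Q^\varepsilon\in\mathcal Q_{\rm ac}$. Its trading rate is given by the feedback rule $$\dot Q^\varepsilon_t=\begin{cases}\dfrac{Q^0_t-Q^\varepsilon_t}{\sqrt\varepsilon},&0\le t<T-\sqrt\varepsilon,\\[1.5ex]\dfrac{\Xi_t-Q^\varepsilon_t}{T-t},&T-\sqrt\varepsilon\le t<T,\end{cases}\qquad\mathbb P\otimes dt\text{-a.e.}$$ Define $$\widetilde C_{\rm tr}:=2\bigl(C_0+2[Q^0]^2_{\rm tr}+8K_0+10\,\mathbb E[\Xi_T^2]\bigr),\qquad C_{\rm tr}:=\widetilde C_{\rm tr}+2T\Lambda_\Xi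 .$$ Then $$\mathbb E\Big[\int_0^T(Q^\varepsilon_t-Q^0_t)^2\,dt+\varepsilon\int_0^T(\dot Q^\varepsilon_t)^2\,dt\Big]\le\widetilde C_{\rm tr}\sqrt\varepsilon+4\Lambda_\Xi\varepsilon\le C_{\rm tr}\sqrt\varepsilon .$$
   Context: Fix $T\in(0,\infty)$ and a filtered probability space $(\Omega,\mathcal F,(\mathcal F_t)_{t\in[0,T]},\mathbb P)$ satisfying the usual conditions; $\mathcal F_{0-}$ is the augmentation of the trivial $\sigma$-field. Let $\Xi_t=\mathbb E[\Xi_T\mid\mathcal F_t]$ (càdlàg). $\Lambda_\Xi$ is a Stieltjes integral with respect to the nondecreasing function $t\mapsto\mathbb E[\Xi_t^2]$ on $[0,T]$, with the convention that an atom at $T$ contributes $+\infty$. Coefficient assumptions on the deterministic functions $\beta,\lambda:[0,T]\to(0,\infty)$: (i) $\beta$ is càdlàg and of finite variation. (ii) $\lambda$ is absolutely continuous and bounded away from zero, and its a.e. derivative admits a càdlàg version $\dot\lambda$ of finite variation; $\lambda_{0-}:=\lambda_0$, $\gamma_t:=\log\lambda_t$, $\dot\gamma_t:=\dot\lambda_t/\lambda_t$. (iii) There is $c>0$ with $2\beta_t+\dot\gamma_t>c$ for all $t\in[0,T]$. Set $\eta_t=\frac{\beta_t+\dot\gamma_t}{2\beta_t+\dot\gamma_t}$, $\dot\theta_t=\frac{(\beta_t+\dot\gamma_t)^2}{\lambda_t(2\beta_t+\dot\gamma_t)}$, $\theta_t=\int_0^t\dot\theta_s\,ds$. $\mathcal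 Q$ is the set of càdlàg semimartingales $Q$ with $\mathbb E[\sup_{t\le T}|Q_t|^2]<\infty$, $Q_{0-}=0$, $Q_T=\Xi_T$. $\mathcal Q_{\rm ac}\subset\mathcal Q$ consists of the $Q_t=\int_0^tu_s\,ds$, $0\le t\le T$, with $u$ progressively measurable, $\mathbb E\int_0^Tu_t^2\,dt<\infty$ and $Q_T=\Xi_T$; then $\dot Q=u$. $Q^0\in\mathcal Q$ is the unique minimizer over $Q\in\mathcal Q$ of the execution cost $\mathbb E[\int_0^TY_{t-}\,dQ_t+\frac12[Y,Q]_T]$, where $Y$ solves $dY_t=-\beta_tY_t\,dt+\lambda_t\,dQ_t$, $Y_{0-}=y$. Explicitly, with the square-integrable martingale $$M_t=\frac{\lambda_T}{1+\lambda_T\theta_T}\Big(\Xi_0+\frac y{\lambda_0}\Big)+\int_{(0,t]}\frac{\lambda_T}{1+\lambda_T(\theta_T-\theta_s)}\,d\Xi_s,\quad t\in[0,T],$$ one has $Q^0_t=\frac{\eta_t}{\lambda_t}M_t-\frac y{\lambda_0}+\int_0^t\dot\theta_sM_s\,ds$ for $0\le t<T$ and $Q^0_T=\Xi_T$, $Q^0_{0-}=0$. Constants: $C_0=2A_\alpha^2m_2+\frac{2y^2}{\lambda_0^2}$, $A_\alpha=\|\eta/\lambda\|_{L^\infty(0,T)}$, $m_2=\mathbb E[M_T^2]$, $K_0=\sup_{t\in[0,T)}\mathbb E|Q^0_t-\Xi_t|^2$, and $[Q^0]^2_{\rm tr}=\sup_{h>0}\frac1h\,\mathbb E\int_0^T|Q^0_t-Q^0_{(t-h)^+}|^2\,dt$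 with $(t-h)^+=\max\{t-h,0\}$. *)

theory Defs
  imports "HOL-Probability.Probability"
begin

section \<open>Real functions on a compact interval\<close>

definition cadlag_on :: "real \<Rightarrow> real \<Rightarrow> (real \<Rightarrow> real) \<Rightarrow> bool" where
  "cadlag_on a b f \<longleftrightarrow>
     (\<forall>t\<in>{a..<b}. (f \<longlongrightarrow> f t) (at_right t)) \<and>
     (\<forall>t\<in>{a<..b}. \<exists>l. (f \<longlongrightarrow> l) (at_left t))"

definition finite_variation_on :: "real \<Rightarrow> real \<Rightarrow> (real \<Rightarrow> real) \<Rightarrow> bool" where
  "finite_variation_on a b f \<longleftrightarrow>
     (\<exists>B. \<forall>D s. D division_of s \<and> s \<subseteq> {a..b} \<longrightarrow> (\<Sum>k\<in>D. \<bar>f (Sup k) - f (Inf k)\<bar>) \<le> B)"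

definition abs_continuous_on :: "real \<Rightarrow> real \<Rightarrow> (real \<Rightarrow> real) \<Rightarrow> bool" where
  "abs_continuous_on a b f \<longleftrightarrow>
     (\<forall>e>0. \<exists>d>0. \<forall>D s. D division_of s \<and> s \<subseteq> {a..b} \<and> (\<Sum>k\<in>D. Sup k - Inf k) < d
        \<longrightarrow> (\<Sum>k\<in>D. \<bar>f (Sup k) - f (Inf k)\<bar>) < e)"


section \<open>Processes on a filtered probability space\<close>

text \<open>
  Processes are functions of time and scenario, of which only the values at times in \<open>{0..T}\<close>
  are used. The value at time \<open>0-\<close> is not part of a process; it is a
  deterministic constant (since the sigma-field at \<open>0-\<close> is trivial) and is supplied separately
  wherever a jump at time 0 matters. By the usual conditions one may, and here does, take
  cadlag processes to have cadlag paths for every scenario.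
\<close>

type_synonym 'a process = "real \<Rightarrow> 'a \<Rightarrow> real"

locale usual_filtered_prob_space = prob_space P + complete_measure P
  for P :: "'a measure" +
  fixes F :: "real \<Rightarrow> 'a measure" and T :: real
  assumes horizon_pos: "0 < T"
    and F_subalgebra: "\<And>t. t \<in> {0..T} \<Longrightarrow> subalgebra P (F t)"
    and F_mono: "\<And>s t. 0 \<le> s \<Longrightarrow> s \<le> t \<Longrightarrow> t \<le> T \<Longrightarrow> sets (F s) \<subseteq> sets (F t)"
    and F_null: "null_sets P \<subseteq> sets (F 0)"
    and F_right_continuous: "\<And>t. t \<in> {0..<T} \<Longrightarrow> sets (F t) = (\<Inter>s\<in>{t<..T}. sets (F s))"

definition adapted :: "(real \<Rightarrow> 'a measure) \<Rightarrow> real \<Rightarrow> 'a process \<Rightarrow> bool" where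
  "adapted F T X \<longleftrightarrow> (\<forall>t\<in>{0..T}. X t \<in> borel_measurable (F t))"

definition cadlag_adapted :: "'a measure \<Rightarrow> (real \<Rightarrow> 'a measure) \<Rightarrow> real \<Rightarrow> 'a process \<Rightarrow> bool" where
  "cadlag_adapted P F T X \<longleftrightarrow>
     adapted F T X \<and> (\<forall>\<omega>\<in>space P. cadlag_on 0 T (\<lambda>t. X t \<omega>))"

definition prog_measurable :: "(real \<Rightarrow> 'a measure) \<Rightarrow> real \<Rightarrow> 'a process \<Rightarrow> bool" where
  "prog_measurable F T u \<longleftrightarrow>
     (\<forall>t\<in>{0..T}. (\<lambda>(s, \<omega>). u s \<omega>) \<in> borel_measurable (restrict_space borel {0..t} \<Otimes>\<^sub>M F t))"

definition cadlag_martingale :: "'a measure \<Rightarrow> (real \<Rightarrow> 'a measure) \<Rightarrow> real \<Rightarrow> 'a process \<Rightarrow> bool" where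
  "cadlag_martingale P F T N \<longleftrightarrow>
     cadlag_adapted P F T N \<and> (\<forall>t\<in>{0..T}. integrable P (N t)) \<and>
     (\<forall>s t. 0 \<le> s \<and> s \<le> t \<and> t \<le> T \<longrightarrow> (AE \<omega> in P. real_cond_exp P (F s) (N t) \<omega> = N s \<omega>))"

text \<open>On the closed interval, a localizing sequence has to reach \<open>T\<close> after finitely many steps.\<close>

definition local_martingale0 :: "'a measure \<Rightarrow> (real \<Rightarrow> 'a measure) \<Rightarrow> real \<Rightarrow> 'a process \<Rightarrow> bool" where
  "local_martingale0 P F T N \<longleftrightarrow>
     cadlag_adapted P F T N \<and> (AE \<omega> in P. N 0 \<omega> = 0) \<and>
     (\<exists>\<tau> :: nat \<Rightarrow> 'a \<Rightarrow> real.
        (\<forall>n. \<forall>\<omega>\<in>space P. 0 \<le> \<tau> n \<omega> \<and> \<tau> n \<omega> \<le> \<tau> (Suc n) \<omega>) \<and>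
        (\<forall>n. \<forall>t\<in>{0..T}. Measurable.pred (F t) (\<lambda>\<omega>. \<tau> n \<omega> \<le> t)) \<and>
        (AE \<omega> in P. \<exists>n. T \<le> \<tau> n \<omega>) \<and>
        (\<forall>n. cadlag_martingale P F T (\<lambda>t \<omega>. N (min t (\<tau> n \<omega>)) \<omega>)))"

definition semimartingale :: "'a measure \<Rightarrow> (real \<Rightarrow> 'a measure) \<Rightarrow> real \<Rightarrow> 'a process \<Rightarrow> bool" where
  "semimartingale P F T X \<longleftrightarrow>
     cadlag_adapted P F T X \<and>
     (\<exists>N A. local_martingale0 P F T N \<and>
        cadlag_adapted P F T A \<and> (AE \<omega> in P. finite_variation_on 0 T (\<lambda>t. A t \<omega>)) \<and>
        (AE \<omega> in P. \<forall>t\<in>{0..T}. X t \<omega> = X 0 \<omega> + N t \<omega> + A t \<omega>))"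

text \<open>
  \<open>is_stoch_integral P F T H X I\<close>: the process \<open>I\<close> is a version of
  the stochastic integral of the left limits \<open>H\<^sub>s\<^sub>-\<close> over \<open>{0<..t}\<close> against the semimartingale
  \<open>X\<close>, for cadlag adapted \<open>H\<close>. It is the limit, uniformly on \<open>{0..T}\<close> in probability, of
  the left-endpoint elementary integrals along partitions whose mesh tends to 0. For continuous
  \<open>H\<close> this is the integral of \<open>H\<close> itself.
\<close>

definition is_stoch_integral ::
  "'a measure \<Rightarrow> (real \<Rightarrow> 'a measure) \<Rightarrow> real \<Rightarrow> 'a process \<Rightarrow> 'a process \<Rightarrow> 'a process \<Rightarrow> bool" where
  "is_stoch_integral P F T H X I \<longleftrightarrow>
     cadlag_adapted P F T I \<and>
     (\<forall>e>0. \<exists>d>0. \<forall>(k::nat) (p :: nat \<Rightarrow> real).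
        p 0 = 0 \<and> p k = T \<and> (\<forall>i<k. p i \<le> p (Suc i) \<and> p (Suc i) - p i < d) \<longrightarrow>
        measure P {\<omega>\<in>space P. \<exists>t\<in>{0..T}.
          \<bar>(\<Sum>i<k. H (p i) \<omega> * (X (min (p (Suc i)) t) \<omega> - X (min (p i) t) \<omega>)) - I t \<omega>\<bar> > e} \<le> e)"


section \<open>Coefficients\<close>

text \<open>\<open>dlam\<close> is the cadlag version of the derivative of \<open>lam\<close>, and \<open>dgam\<close> is the derivative
  of \<open>ln lam\<close>.\<close>

definition dgam :: "(real \<Rightarrow> real) \<Rightarrow> (real \<Rightarrow> real) \<Rightarrow> real \<Rightarrow> real" where
  "dgam lam dlam t = dlam t / lam t"

definition coefficients ::
  "real \<Rightarrow> (real \<Rightarrow> real) \<Rightarrow> (real \<Rightarrow> real) \<Rightarrow> (real \<Rightarrow> real) \<Rightarrow> bool" where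
  "coefficients T \<beta> lam dlam \<longleftrightarrow>
     (\<forall>t\<in>{0..T}. 0 < \<beta> t \<and> 0 < lam t) \<and>
     cadlag_on 0 T \<beta> \<and> finite_variation_on 0 T \<beta> \<and>
     abs_continuous_on 0 T lam \<and> (\<exists>c>0. \<forall>t\<in>{0..T}. c \<le> lam t) \<and>
     (AE t in lborel. t \<in> {0<..<T} \<longrightarrow> (lam has_real_derivative dlam t) (at t)) \<and>
     cadlag_on 0 T dlam \<and> finite_variation_on 0 T dlam \<and>
     (\<exists>c>0. \<forall>t\<in>{0..T}. 2 * \<beta> t + dgam lam dlam t > c)"

definition eta :: "(real \<Rightarrow> real) \<Rightarrow> (real \<Rightarrow> real) \<Rightarrow> (real \<Rightarrow> real) \<Rightarrow> real \<Rightarrow> real" where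
  "eta \<beta> lam dlam t = (\<beta> t + dgam lam dlam t) / (2 * \<beta> t + dgam lam dlam t)"

definition dtheta :: "(real \<Rightarrow> real) \<Rightarrow> (real \<Rightarrow> real) \<Rightarrow> (real \<Rightarrow> real) \<Rightarrow> real \<Rightarrow> real" where
  "dtheta \<beta> lam dlam t =
     (\<beta> t + dgam lam dlam t)\<^sup>2 / (lam t * (2 * \<beta> t + dgam lam dlam t))"

definition theta :: "(real \<Rightarrow> real) \<Rightarrow> (real \<Rightarrow> real) \<Rightarrow> (real \<Rightarrow> real) \<Rightarrow> real \<Rightarrow> real" where
  "theta \<beta> lam dlam t = (LINT s:{0..t}|lborel. dtheta \<beta> lam dlam s)"


section \<open>Terminal target, strategies and execution cost\<close>

text \<open>The square-integrable random variable \<open>\<Xi> T\<close> is the target; \<open>\<Xi>\<close> is the cadlag version of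
  its conditional expectations.\<close>

definition target_process :: "'a measure \<Rightarrow> (real \<Rightarrow> 'a measure) \<Rightarrow> real \<Rightarrow> 'a process \<Rightarrow> bool" where
  "target_process P F T \<Xi> \<longleftrightarrow>
     \<Xi> T \<in> borel_measurable (F T) \<and> integrable P (\<lambda>\<omega>. (\<Xi> T \<omega>)\<^sup>2) \<and>
     cadlag_adapted P F T \<Xi> \<and>
     (\<forall>t\<in>{0..T}. AE \<omega> in P. \<Xi> t \<omega> = real_cond_exp P (F t) (\<Xi> T) \<omega>)"

text \<open>Every strategy starts from the value 0 at time \<open>0-\<close>, so \<open>Q 0\<close> is its initial jump.\<close>

definition strategies :: "'a measure \<Rightarrow> (real \<Rightarrow> 'a measure) \<Rightarrow> real \<Rightarrow> 'a process \<Rightarrow> 'a process set" where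
  "strategies P F T \<Xi> = {Q. semimartingale P F T Q \<and>
     (\<integral>\<^sup>+\<omega>. (SUP t\<in>{0..T}. ennreal ((Q t \<omega>)\<^sup>2)) \<partial>P) < \<infinity> \<and>
     (AE \<omega> in P. Q T \<omega> = \<Xi> T \<omega>)}"

definition trading_rate ::
  "'a measure \<Rightarrow> (real \<Rightarrow> 'a measure) \<Rightarrow> real \<Rightarrow> 'a process \<Rightarrow> 'a process \<Rightarrow> bool" where
  "trading_rate P F T Q u \<longleftrightarrow>
     prog_measurable F T u \<and>
     (\<integral>\<^sup>+\<omega>. (\<integral>\<^sup>+t\<in>{0..T}. ennreal ((u t \<omega>)\<^sup>2) \<partial>lborel) \<partial>P) < \<infinity> \<and>
     (AE \<omega> in P. \<forall>t\<in>{0..T}. Q t \<omega> = (LINT s:{0..t}|lborel. u s \<omega>))"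

definition ac_strategies :: "'a measure \<Rightarrow> (real \<Rightarrow> 'a measure) \<Rightarrow> real \<Rightarrow> 'a process \<Rightarrow> 'a process set" where
  "ac_strategies P F T \<Xi> = {Q \<in> strategies P F T \<Xi>. \<exists>u. trading_rate P F T Q u}"

text \<open>
  The integral over \<open>{0..t}\<close>, with the jump of \<open>X\<close> at time 0, from the integral \<open>I\<close>
  over \<open>{0<..t}\<close>; \<open>h\<close> and \<open>x\<close> are the values of integrand and integrator at time \<open>0-\<close>.
\<close>

definition incl_jump0 :: "real \<Rightarrow> real \<Rightarrow> 'a process \<Rightarrow> 'a process \<Rightarrow> 'a process" where
  "incl_jump0 h x X I t \<omega> = h * (X 0 \<omega> - x) + I t \<omega>"

definition price_deviation ::
  "'a measure \<Rightarrow> (real \<Rightarrow> 'a measure) \<Rightarrow> real \<Rightarrow> (real \<Rightarrow> real) \<Rightarrow> (real \<Rightarrow> real) \<Rightarrow> real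
    \<Rightarrow> 'a process \<Rightarrow> 'a process \<Rightarrow> bool" where
  "price_deviation P F T \<beta> lam y Q Y \<longleftrightarrow>
     cadlag_adapted P F T Y \<and>
     (\<exists>I. is_stoch_integral P F T (\<lambda>t _. lam t) Q I \<and>
        (AE \<omega> in P. \<forall>t\<in>{0..T}.
           Y t \<omega> = y - (LINT s:{0..t}|lborel. \<beta> s * Y s \<omega>) + incl_jump0 (lam 0) 0 Q I t \<omega>))"

text \<open>
  In the next definition \<open>YdQ\<close> and \<open>QdY\<close> are the integrals, over \<open>{0..T}\<close>, of \<open>Y\<^sub>t\<^sub>-\<close> against \<open>Q\<close>
  and of \<open>Q\<^sub>t\<^sub>-\<close> against \<open>Y\<close>. Their sum with the covariation \<open>[Y,Q]\<^sub>T\<close> is \<open>Y\<^sub>T Q\<^sub>T\<close>, since the product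
  vanishes at time \<open>0-\<close>; this defines the covariation, including its jump at time 0.
\<close>

definition has_execution_cost ::
  "'a measure \<Rightarrow> (real \<Rightarrow> 'a measure) \<Rightarrow> real \<Rightarrow> (real \<Rightarrow> real) \<Rightarrow> (real \<Rightarrow> real) \<Rightarrow> real
    \<Rightarrow> 'a process \<Rightarrow> real \<Rightarrow> bool" where
  "has_execution_cost P F T \<beta> lam y Q c \<longleftrightarrow>
     (\<exists>Y I J. price_deviation P F T \<beta> lam y Q Y \<and>
        is_stoch_integral P F T Y Q I \<and> is_stoch_integral P F T Q Y J \<and>
        (let YdQ = incl_jump0 y 0 Q I T;
             QdY = incl_jump0 0 y Y J T;
             cov = (\<lambda>\<omega>. Y T \<omega> * Q T \<omega> - YdQ \<omega> - QdY \<omega>)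
         in integrable P (\<lambda>\<omega>. YdQ \<omega> + cov \<omega> / 2) \<and>
            c = (\<integral>\<omega>. YdQ \<omega> + cov \<omega> / 2 \<partial>P)))"

definition execution_cost ::
  "'a measure \<Rightarrow> (real \<Rightarrow> 'a measure) \<Rightarrow> real \<Rightarrow> (real \<Rightarrow> real) \<Rightarrow> (real \<Rightarrow> real) \<Rightarrow> real
    \<Rightarrow> 'a process \<Rightarrow> real" where
  "execution_cost P F T \<beta> lam y Q = (THE c. has_execution_cost P F T \<beta> lam y Q c)"


section \<open>The optimal strategy and its approximation\<close>

definition opt_integrand ::
  "real \<Rightarrow> (real \<Rightarrow> real) \<Rightarrow> (real \<Rightarrow> real) \<Rightarrow> (real \<Rightarrow> real) \<Rightarrow> real \<Rightarrow> real" where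
  "opt_integrand T \<beta> lam dlam s =
     lam T / (1 + lam T * (theta \<beta> lam dlam T - theta \<beta> lam dlam s))"

text \<open>Here \<open>I\<close> stands for the stochastic integral of \<open>opt_integrand\<close> against \<open>\<Xi>\<close>.\<close>

definition opt_martingale ::
  "real \<Rightarrow> (real \<Rightarrow> real) \<Rightarrow> (real \<Rightarrow> real) \<Rightarrow> (real \<Rightarrow> real) \<Rightarrow> real
    \<Rightarrow> 'a process \<Rightarrow> 'a process \<Rightarrow> 'a process" where
  "opt_martingale T \<beta> lam dlam y \<Xi> I t \<omega> =
     lam T / (1 + lam T * theta \<beta> lam dlam T) * (\<Xi> 0 \<omega> + y / lam 0) + I t \<omega>"

text \<open>\<open>M\<close> stands for the process \<open>opt_martingale\<close>.\<close>

definition optimal_representation ::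
  "'a measure \<Rightarrow> real \<Rightarrow> (real \<Rightarrow> real) \<Rightarrow> (real \<Rightarrow> real) \<Rightarrow> (real \<Rightarrow> real) \<Rightarrow> real
    \<Rightarrow> 'a process \<Rightarrow> 'a process \<Rightarrow> 'a process \<Rightarrow> bool" where
  "optimal_representation P T \<beta> lam dlam y \<Xi> M Q \<longleftrightarrow>
     (AE \<omega> in P.
        (\<forall>t\<in>{0..<T}. Q t \<omega> = eta \<beta> lam dlam t / lam t * M t \<omega> - y / lam 0
            + (LINT s:{0..t}|lborel. dtheta \<beta> lam dlam s * M s \<omega>)) \<and>
        Q T \<omega> = \<Xi> T \<omega>)"

definition Qbar :: "real \<Rightarrow> 'a process \<Rightarrow> 'a process" where
  "Qbar \<epsilon> Q0 t \<omega> =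
     1 / sqrt \<epsilon> * (LINT r:{0..t}|lborel. exp (- (t - r) / sqrt \<epsilon>) * Q0 r \<omega>)"

definition Qeps :: "real \<Rightarrow> 'a process \<Rightarrow> 'a process \<Rightarrow> real \<Rightarrow> 'a process" where
  "Qeps T \<Xi> Q0 \<epsilon> t \<omega> =
     (if t \<le> T - sqrt \<epsilon> then Qbar \<epsilon> Q0 t \<omega>
      else if t < T then
        (T - t) / sqrt \<epsilon> * Qbar \<epsilon> Q0 (T - sqrt \<epsilon>) \<omega>
        + (T - t) * (LINT r:{T - sqrt \<epsilon>..t}|lborel. \<Xi> r \<omega> / (T - r)\<^sup>2)
      else \<Xi> T \<omega>)"

definition feedback_rate :: "real \<Rightarrow> 'a process \<Rightarrow> 'a process \<Rightarrow> real \<Rightarrow> 'a process \<Rightarrow> 'a process" where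
  "feedback_rate T \<Xi> Q0 \<epsilon> Q t \<omega> =
     (if t < T - sqrt \<epsilon> then (Q0 t \<omega> - Q t \<omega>) / sqrt \<epsilon> else (\<Xi> t \<omega> - Q t \<omega>) / (T - t))"


section \<open>Constants\<close>

text \<open>
  The constants take values in \<open>ennreal\<close>, so that suprema and integrals need no prior finiteness.
  The Stieltjes measure of the function \<open>t \<mapsto> E[\<Xi>\<^sub>t\<^sup>2]\<close> on \<open>{0..T}\<close> is carried by \<open>{0<..T}\<close>. The
  integrand is \<open>inverse 0 = \<infinity>\<close> at \<open>T\<close>, so an atom there contributes \<open>\<infinity>\<close> and no
  atom contributes 0.
\<close>

definition Lambda_target :: "'a measure \<Rightarrow> real \<Rightarrow> 'a process \<Rightarrow> ennreal" where
  "Lambda_target P T \<Xi> =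
     (\<integral>\<^sup>+t\<in>{0<..T}. inverse (ennreal (T - t))
        \<partial>interval_measure (\<lambda>t. \<integral>\<omega>. (\<Xi> (max 0 (min T t)) \<omega>)\<^sup>2 \<partial>P))"

definition A_alpha :: "real \<Rightarrow> (real \<Rightarrow> real) \<Rightarrow> (real \<Rightarrow> real) \<Rightarrow> (real \<Rightarrow> real) \<Rightarrow> ennreal" where
  "A_alpha T \<beta> lam dlam =
     esssup (restrict_space lborel {0<..<T}) (\<lambda>t. ennreal \<bar>eta \<beta> lam dlam t / lam t\<bar>)"

definition C0_const ::
  "'a measure \<Rightarrow> real \<Rightarrow> (real \<Rightarrow> real) \<Rightarrow> (real \<Rightarrow> real) \<Rightarrow> (real \<Rightarrow> real) \<Rightarrow> real \<Rightarrow> 'a process \<Rightarrow> ennreal" where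
  "C0_const P T \<beta> lam dlam y M =
     2 * (A_alpha T \<beta> lam dlam)\<^sup>2 * (\<integral>\<^sup>+\<omega>. ennreal ((M T \<omega>)\<^sup>2) \<partial>P) + ennreal (2 * y\<^sup>2 / (lam 0)\<^sup>2)"

definition K0_const :: "'a measure \<Rightarrow> real \<Rightarrow> 'a process \<Rightarrow> 'a process \<Rightarrow> ennreal" where
  "K0_const P T \<Xi> Q0 = (SUP t\<in>{0..<T}. \<integral>\<^sup>+\<omega>. ennreal ((Q0 t \<omega> - \<Xi> t \<omega>)\<^sup>2) \<partial>P)"

definition tr_seminorm_sq :: "'a measure \<Rightarrow> real \<Rightarrow> 'a process \<Rightarrow> ennreal" where
  "tr_seminorm_sq P T Q0 =
     (SUP h\<in>{0<..}. ennreal (1 / h) *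
        (\<integral>\<^sup>+\<omega>. (\<integral>\<^sup>+t\<in>{0..T}. ennreal ((Q0 t \<omega> - Q0 (max (t - h) 0) \<omega>)\<^sup>2) \<partial>lborel) \<partial>P))"

definition Ctr_tilde ::
  "'a measure \<Rightarrow> real \<Rightarrow> (real \<Rightarrow> real) \<Rightarrow> (real \<Rightarrow> real) \<Rightarrow> (real \<Rightarrow> real) \<Rightarrow> real
    \<Rightarrow> 'a process \<Rightarrow> 'a process \<Rightarrow> 'a process \<Rightarrow> ennreal" where
  "Ctr_tilde P T \<beta> lam dlam y \<Xi> M Q0 =
     2 * (C0_const P T \<beta> lam dlam y M + 2 * tr_seminorm_sq P T Q0 + 8 * K0_const P T \<Xi> Q0
          + 10 * (\<integral>\<^sup>+\<omega>. ennreal ((\<Xi> T \<omega>)\<^sup>2) \<partial>P))"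

definition Ctr ::
  "'a measure \<Rightarrow> real \<Rightarrow> (real \<Rightarrow> real) \<Rightarrow> (real \<Rightarrow> real) \<Rightarrow> (real \<Rightarrow> real) \<Rightarrow> real
    \<Rightarrow> 'a process \<Rightarrow> 'a process \<Rightarrow> 'a process \<Rightarrow> ennreal" where
  "Ctr P T \<beta> lam dlam y \<Xi> M Q0 =
     Ctr_tilde P T \<beta> lam dlam y \<Xi> M Q0 + 2 * ennreal T * Lambda_target P T \<Xi>"

end

theory Submission
  imports Defs
begin

text \<open>
  Write \<open>\<delta> = sqrt \<epsilon>\<close> and \<open>S = T - \<delta>\<close>. Up to time \<open>S\<close>, \<open>Qeps\<close> is an average of the past of \<open>Q0\<close> with
  exponential weights, so Jensen's inequality bounds its distance to \<open>Q0\<close> by the translation seminorm,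
  up to a term for the history before time 0, where \<open>Q0\<close> is replaced by 0.

  On \<open>[S, T)\<close> the estimate is pathwise. The quotient \<open>W = (\<Xi> T - Qeps) / (T - t)\<close> has derivative
  \<open>(\<Xi> T - \<Xi>) / (T - t)\<^sup>2\<close>, and differentiating \<open>(T - t) W\<^sup>2\<close> bounds the energy of the trading rate by
  \<open>(\<Xi> T - Qeps S)\<^sup>2 / \<delta>\<close> plus the integral of \<open>((\<Xi> T - \<Xi>) / (T - t))\<^sup>2\<close>. As \<open>\<Xi>\<close> is a square-integrable
  martingale, the expectation of this integral is a double integral against the Stieltjes measure of
  the second moment of \<open>\<Xi>\<close>, which Tonelli's theorem bounds by \<open>Lambda_target\<close>. Finiteness of
  \<open>Lambda_target\<close> also excludes a jump of \<open>\<Xi>\<close> at \<open>T\<close>, so that \<open>Qeps\<close> is continuous there.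
\<close>

section \<open>Primitives of integrable functions\<close>

text \<open>\<open>Q0\<close> and \<open>\<Xi>\<close> may jump, so the rate of \<open>Qeps\<close>
  is not a classical derivative; calculus is done for primitives of integrable functions, whose
  product rule comes from Fubini's theorem. Before \<open>T\<close> the feedback can aim only at
  \<open>\<Xi> t\<close>, as the target is not yet known; the energy estimate nevertheless compares
  with \<open>\<Xi> T\<close>, which is harmless because it is pathwise. \<open>C0_const\<close>
  pays for the missing history before time 0: it dominates the second moment of the initial jump
  \<open>Q0 0\<close>. That jump involves the initial value of the martingale, whereas the constant
  contains the second moment at \<open>T\<close>. The stochastic integral is given only as a limit
  in probability of elementary sums, so the inequality between the two moments is drawn from
  orthogonality to the variables known at time 0, which passes to the limit. All estimates are made
  in \<open>ennreal\<close> with Tonelli and Fatou. Finiteness matters for the square integrability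
  of the rate; there it comes from the maximal second moment of \<open>Q0\<close> and from
  \<open>Lambda_target\<close>.\<close>

lemma integrable_lborel_prod:
  fixes f g :: "real \<Rightarrow> real"
  assumes "integrable lborel f" "integrable lborel g"
  shows "integrable (lborel \<Otimes>\<^sub>M lborel) (\<lambda>(x, y). f x * g y)"
proof -
  have [measurable]: "f \<in> borel_measurable lborel" "g \<in> borel_measurable lborel"
    using assms by auto
  have "integrable lborel (\<lambda>x. \<integral>y. norm (f x * g y) \<partial>lborel)"
    using assms by (simp add: abs_mult)
  then show ?thesis
    using assms by (intro lborel_pair.Fubini_integrable) (auto simp: split_beta')
qed

text \<open>Fubini's theorem for \<open>f x * g y\<close> on the plane, cut along the diagonal. This
  is the product rule for two primitives, obtained without differentiating anything.\<close>

lemma integral_prod_triangles: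
  fixes f g :: "real \<Rightarrow> real"
  assumes f: "integrable lborel f" and g: "integrable lborel g"
  shows "integrable lborel (\<lambda>s. f s * (\<integral>r. g r * indicator {..s} r \<partial>lborel))"
    and "integrable lborel (\<lambda>s. g s * (\<integral>r. f r * indicator {..s} r \<partial>lborel))"
    and "(\<integral>s. f s \<partial>lborel) * (\<integral>s. g s \<partial>lborel) =
       (\<integral>s. f s * (\<integral>r. g r * indicator {..s} r \<partial>lborel) \<partial>lborel)
       + (\<integral>s. g s * (\<integral>r. f r * indicator {..s} r \<partial>lborel) \<partial>lborel)"
proof -
  have [measurable]: "f \<in> borel_measurable lborel" "g \<in> borel_measurable lborel"
    using assms by auto
  let ?K = "\<lambda>(x, y). f x * g y"
  let ?L = "\<lambda>(x, y). indicator {..x} y * (f x * g y)"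
  let ?U = "\<lambda>(x, y). indicator {..y} x * (f x * g y)"
  have K: "integrable (lborel \<Otimes>\<^sub>M lborel) ?K"
    by (rule integrable_lborel_prod[OF f g])
  have L: "integrable (lborel \<Otimes>\<^sub>M lborel) ?L" and U: "integrable (lborel \<Otimes>\<^sub>M lborel) ?U"
    by (rule Bochner_Integration.integrable_bound[OF K]; auto simp: indicator_def split_beta')+
  have Ls: "(\<integral>y. indicator {..x} y * (f x * g y) \<partial>lborel) = f x * (\<integral>r. g r * indicator {..x} r \<partial>lborel)" for x
    by (simp add: mult_ac flip: integral_mult_right_zero)
  have Us: "(\<integral>x. indicator {..y} x * (f x * g y) \<partial>lborel) = g y * (\<integral>r. f r * indicator {..y} r \<partial>lborel)" for y
    by (simp add: mult_ac flip: integral_mult_right_zero)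
  show "integrable lborel (\<lambda>s. f s * (\<integral>r. g r * indicator {..s} r \<partial>lborel))"
    using lborel_pair.integrable_fst[OF L] by (simp add: Ls)
  show "integrable lborel (\<lambda>s. g s * (\<integral>r. f r * indicator {..s} r \<partial>lborel))"
    using lborel_pair.integrable_snd[OF U] by (simp add: Us)
  \<comment> \<open>Both closed triangles contain the diagonal. It is a null set because each of its
    sections is a single point, so the double count does not show.\<close>
  have "AE p in lborel \<Otimes>\<^sub>M lborel. fst p \<noteq> (snd p :: real)"
  proof (rule lborel_pair.AE_pair_measure)
    show "{p \<in> space (lborel \<Otimes>\<^sub>M lborel). fst p \<noteq> (snd p::real)} \<in> sets (lborel \<Otimes>\<^sub>M lborel)"
      by measurable
    show "AE x in lborel. AE y in lborel. fst (x, y) \<noteq> (snd (x, y) :: real)"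
      by (rule AE_I2) (use AE_lborel_singleton in force)
  qed
  then have "AE p in lborel \<Otimes>\<^sub>M lborel. ?K p = ?L p + ?U p"
    by eventually_elim (auto simp: indicator_def)
  then have "integral\<^sup>L (lborel \<Otimes>\<^sub>M lborel) ?K = integral\<^sup>L (lborel \<Otimes>\<^sub>M lborel) (\<lambda>p. ?L p + ?U p)"
    using K L U by (intro integral_cong_AE) auto
  also have "\<dots> = integral\<^sup>L (lborel \<Otimes>\<^sub>M lborel) ?L + integral\<^sup>L (lborel \<Otimes>\<^sub>M lborel) ?U"
    using L U by simp
  also have "integral\<^sup>L (lborel \<Otimes>\<^sub>M lborel) ?L = (\<integral>s. f s * (\<integral>r. g r * indicator {..s} r \<partial>lborel) \<partial>lborel)"
    using lborel_pair.integral_fst[OF L] by (simp add: Ls)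
  also have "integral\<^sup>L (lborel \<Otimes>\<^sub>M lborel) ?U = (\<integral>s. g s * (\<integral>r. f r * indicator {..s} r \<partial>lborel) \<partial>lborel)"
    using lborel_pair.integral_snd[OF U] by (simp add: Us)
  also have "integral\<^sup>L (lborel \<Otimes>\<^sub>M lborel) ?K = (\<integral>s. f s \<partial>lborel) * (\<integral>s. g s \<partial>lborel)"
    using lborel_pair.integral_fst[OF K] by simp
  finally show "(\<integral>s. f s \<partial>lborel) * (\<integral>s. g s \<partial>lborel) =
       (\<integral>s. f s * (\<integral>r. g r * indicator {..s} r \<partial>lborel) \<partial>lborel)
       + (\<integral>s. g s * (\<integral>r. f r * indicator {..s} r \<partial>lborel) \<partial>lborel)" .
qed

text \<open>Absolute continuity with a named density. A pointwise derivative would be too much to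
  ask, as the densities are only integrable. The value at \<open>a\<close> is kept, so that
  primitives can be restricted to subintervals and glued.\<close>

definition primitive_on :: "real \<Rightarrow> real \<Rightarrow> (real \<Rightarrow> real) \<Rightarrow> (real \<Rightarrow> real) \<Rightarrow> bool" where
  "primitive_on a b f F \<longleftrightarrow> set_integrable lborel {a..b} f \<and>
     (\<forall>t\<in>{a..b}. F t = F a + (LINT s:{a..t}|lborel. f s))"

lemma primitive_onI:
  assumes "set_integrable lborel {a..b} f"
    and "\<And>t. a \<le> t \<Longrightarrow> t \<le> b \<Longrightarrow> F t = F a + (LINT s:{a..t}|lborel. f s)"
  shows "primitive_on a b f F"
  unfolding primitive_on_def using assms(1) by (intro conjI ballI assms(2)) (simp_all only: atLeastAtMost_iff)

lemma primitive_on_integrable: "primitive_on a b f F \<Longrightarrow> set_integrable lborel {a..b} f"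
  unfolding primitive_on_def by (rule conjunct1)

lemma primitive_on_eq:
  "primitive_on a b f F \<Longrightarrow> a \<le> t \<Longrightarrow> t \<le> b \<Longrightarrow> F t = F a + (LINT s:{a..t}|lborel. f s)"
  by (drule primitive_on_def[THEN iffD1], erule conjE, erule bspec) simp

text \<open>Cut both densities off outside \<open>{a..t}\<close>: the inner integrals in the
  triangle formula are then the increments of \<open>F\<close> and \<open>G\<close> from
  \<open>a\<close>, and the products with \<open>F a\<close> and \<open>G a\<close> supply the
  remaining terms.\<close>

lemma primitive_on_mult:
  assumes F: "primitive_on a b f F" and G: "primitive_on a b g G"
  shows "primitive_on a b (\<lambda>s. f s * G s + F s * g s) (\<lambda>s. F s * G s)"
proof -
  have main: "set_integrable lborel {a..t} (\<lambda>s. f s * G s + F s * g s) \<and>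
      F t * G t = F a * G a + (LINT s:{a..t}|lborel. f s * G s + F s * g s)" if t: "t \<in> {a..b}" for t
  proof -
    define f' where "f' = (\<lambda>s. indicator {a..t} s * f s)"
    define g' where "g' = (\<lambda>s. indicator {a..t} s * g s)"
    have sub: "{a..t} \<subseteq> {a..b}" using t by auto
    have "set_integrable lborel {a..t} f" "set_integrable lborel {a..t} g"
      using F G by (auto dest!: primitive_on_integrable intro: set_integrable_subset[OF _ _ sub])
    then have fi: "integrable lborel f'" and gi: "integrable lborel g'"
      by (auto simp: f'_def g'_def set_integrable_def)
    have F': "F s = F a + (\<integral>r. f' r * indicator {..s} r \<partial>lborel)" if "s \<in> {a..t}" for s
    proof -
      have "F s = F a + (LINT s:{a..s}|lborel. f s)"
        using that t by (intro primitive_on_eq[OF F]) auto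
      also have "(LINT s:{a..s}|lborel. f s) = (\<integral>r. f' r * indicator {..s} r \<partial>lborel)"
        unfolding set_lebesgue_integral_def f'_def
        by (rule Bochner_Integration.integral_cong) (use that in \<open>auto simp: indicator_def\<close>)
      finally show ?thesis .
    qed
    have G': "G s = G a + (\<integral>r. g' r * indicator {..s} r \<partial>lborel)" if "s \<in> {a..t}" for s
    proof -
      have "G s = G a + (LINT s:{a..s}|lborel. g s)"
        using that t by (intro primitive_on_eq[OF G]) auto
      also have "(LINT s:{a..s}|lborel. g s) = (\<integral>r. g' r * indicator {..s} r \<partial>lborel)"
        unfolding set_lebesgue_integral_def g'_def
        by (rule Bochner_Integration.integral_cong) (use that in \<open>auto simp: indicator_def\<close>)
      finally show ?thesis .
    qed
    note tri = integral_prod_triangles[OF fi gi]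
    have eq: "indicator {a..t} s * (f s * G s + F s * g s) =
        f' s * (\<integral>r. g' r * indicator {..s} r \<partial>lborel) + g' s * (\<integral>r. f' r * indicator {..s} r \<partial>lborel)
        + f' s * G a + g' s * F a" for s
    proof (cases "s \<in> {a..t}")
      case True
      then show ?thesis using F'[OF True] G'[OF True] by (simp add: f'_def g'_def algebra_simps)
    qed (simp add: f'_def g'_def)
    have Ft: "F t = F a + (\<integral>r. f' r \<partial>lborel)" and Gt: "G t = G a + (\<integral>r. g' r \<partial>lborel)"
      using t primitive_on_eq[OF F, of t] primitive_on_eq[OF G, of t]
      by (auto simp: f'_def g'_def set_lebesgue_integral_def)
    have "set_integrable lborel {a..t} (\<lambda>s. f s * G s + F s * g s)"
      unfolding set_integrable_def real_scaleR_def eq using tri(1,2) fi gi by auto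
    moreover have "(LINT s:{a..t}|lborel. f s * G s + F s * g s) =
       (\<integral>r. f' r \<partial>lborel) * (\<integral>r. g' r \<partial>lborel) + (\<integral>r. f' r \<partial>lborel) * G a + (\<integral>r. g' r \<partial>lborel) * F a"
      unfolding set_lebesgue_integral_def real_scaleR_def eq using tri fi gi by simp
    ultimately show ?thesis
      by (simp add: Ft Gt algebra_simps)
  qed
  show ?thesis
  proof (cases "a \<le> b")
    case True
    then have "b \<in> {a..b}" by simp
    then show ?thesis unfolding primitive_on_def using main by blast
  next
    case False
    then show ?thesis by (intro primitive_onI) (auto simp: set_integrable_def)
  qed
qed

lemma primitive_on_continuous:
  assumes "primitive_on a b f F"
  shows "continuous_on {a..b} F"
proof -
  have int: "set_integrable lborel {a..b} f" by (rule primitive_on_integrable) (rule assms)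
  have "F t = F a + integral {a..t} f" if "t \<in> {a..b}" for t
  proof -
    have "set_integrable lborel {a..t} f"
      by (rule set_integrable_subset[OF int]) (use that in auto)
    then show ?thesis
      using primitive_on_eq[OF assms, of t] that by (auto simp: set_borel_integral_eq_integral(2))
  qed
  moreover have "continuous_on {a..b} (\<lambda>t. F a + integral {a..t} f)"
    by (rule continuous_on_add[OF continuous_on_const
          indefinite_integral_continuous_1[OF set_borel_integral_eq_integral(1)[OF int]]])
  ultimately show ?thesis
    by (metis (no_types, lifting) continuous_on_cong)
qed

lemma primitive_on_subinterval:
  assumes "primitive_on a b f F" "a \<le> c" "d \<le> b"
  shows "primitive_on c d f F"
proof -
  have int: "set_integrable lborel {a..b} f" by (rule primitive_on_integrable) (rule assms)
  then have int': "set_integrable lborel {c..d} f"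
    by (rule set_integrable_subset) (use assms in auto)
  have "F t = F c + (LINT s:{c..t}|lborel. f s)" if "t \<in> {c..d}" for t
  proof -
    have i: "set_integrable lborel {x..z} f" if "x \<ge> a" "z \<le> b" for x z
      by (rule set_integrable_subset[OF int]) (use that in auto)
    have "F t = F a + (LINT s:{a..t}|lborel. f s)" "F c = F a + (LINT s:{a..c}|lborel. f s)"
      using that assms(2,3) by (auto intro!: primitive_on_eq[OF assms(1)])
    moreover have "(LINT s:{a..t}|lborel. f s) = (LINT s:{a..c}|lborel. f s) + (LINT s:{c..t}|lborel. f s)"
    proof -
      have "integral {a..t} f = integral {a..c} f + integral {c..t} f"
        using that assms by (intro Henstock_Kurzweil_Integration.integral_combine[symmetric] set_borel_integral_eq_integral(1) i) auto
      then show ?thesis using i that assms by (simp add: set_borel_integral_eq_integral(2))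
    qed
    ultimately show ?thesis by simp
  qed
  with int' show ?thesis unfolding primitive_on_def by blast
qed

lemma primitive_on_combine:
  assumes "primitive_on a b f F" "primitive_on b c f F" "a \<le> b" "b \<le> c"
  shows "primitive_on a c f F"
proof -
  have int: "set_integrable lborel {a..b} f" "set_integrable lborel {b..c} f"
    using assms by (auto dest!: primitive_on_integrable)
  have "set_integrable lborel ({a..b} \<union> {b..c}) f"
    by (rule set_integrable_Un) (use int in auto)
  moreover have "{a..b} \<union> {b..c} = {a..c}" using assms by auto
  ultimately have int': "set_integrable lborel {a..c} f" by simp
  then have i: "set_integrable lborel {x..z} f" if "x \<ge> a" "z \<le> c" for x z
    by (rule set_integrable_subset) (use that in auto)
  have "F t = F a + (LINT s:{a..t}|lborel. f s)" if t: "t \<in> {a..c}" for t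
  proof (cases "t \<le> b")
    case True
    then show ?thesis using t by (intro primitive_on_eq[OF assms(1)]) auto
  next
    case False
    have "integral {a..t} f = integral {a..b} f + integral {b..t} f"
      using False assms t by (intro Henstock_Kurzweil_Integration.integral_combine[symmetric] set_borel_integral_eq_integral(1) i) auto
    then have "(LINT s:{a..t}|lborel. f s) = (LINT s:{a..b}|lborel. f s) + (LINT s:{b..t}|lborel. f s)"
      using i t assms False by (simp add: set_borel_integral_eq_integral(2))
    moreover have "F t = F b + (LINT s:{b..t}|lborel. f s)" "F b = F a + (LINT s:{a..b}|lborel. f s)"
      using False t assms(3) by (auto intro: primitive_on_eq[OF assms(1)] primitive_on_eq[OF assms(2)])
    ultimately show ?thesis by simp
  qed
  with int' show ?thesis unfolding primitive_on_def by blast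
qed

lemma primitive_on_C1:
  assumes "\<And>t. t \<in> {a..b} \<Longrightarrow> (F has_real_derivative f t) (at t within {a..b})"
    and "continuous_on {a..b} f"
  shows "primitive_on a b f F"
proof -
  have int: "set_integrable lborel {a..b} f"
    unfolding set_integrable_def using borel_integrable_atLeastAtMost'[OF assms(2)]
    by (simp add: set_integrable_def)
  have "F t = F a + (LINT s:{a..t}|lborel. f s)" if "t \<in> {a..b}" for t
  proof -
    have i: "set_integrable lborel {a..t} f"
      by (rule set_integrable_subset[OF int]) (use that in auto)
    have "(f has_integral F t - F a) {a..t}"
      using that by (intro fundamental_theorem_of_calculus)
        (auto intro!: has_field_derivative_subset[of _ _ _ "{a..b}"] assms(1) simp flip: has_real_derivative_iff_has_vector_derivative)
    then show ?thesis using set_borel_integral_eq_integral(2)[OF i] by (simp add: integral_unique)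
  qed
  with int show ?thesis unfolding primitive_on_def by blast
qed

text \<open>Increments of \<open>F\<close> over the cells of a division are integrals of the
  density, and the indefinite integral of an absolutely integrable function has bounded
  variation.\<close>

lemma primitive_on_bounded_variation:
  assumes "primitive_on a b f F"
  shows "finite_variation_on a b F"
proof -
  have int: "set_integrable lborel {a..b} f" by (rule primitive_on_integrable) (rule assms)
  define g where "g = (\<lambda>s. indicator {a..b} s * f s)"
  have "integrable lborel g" using int by (simp add: set_integrable_def g_def)
  then have "integrable lebesgue g" using integrable_completion[of g lborel] by auto
  then have "g absolutely_integrable_on UNIV" by (simp add: set_integrable_def)
  from absolutely_integrable_bounded_variation[OF this]
  obtain B where B: "\<And>D. D division_of \<Union>D \<Longrightarrow> (\<Sum>k\<in>D. norm (integral k g)) \<le> B" by blast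
  have "(\<Sum>k\<in>D. \<bar>F (Sup k) - F (Inf k)\<bar>) \<le> B" if D: "D division_of s" and s: "s \<subseteq> {a..b}" for D s
  proof -
    have "\<bar>F (Sup k) - F (Inf k)\<bar> = norm (integral k g)" if k: "k \<in> D" for k
    proof -
      obtain c d where cd: "k = {c..d}" "k \<noteq> {}"
        using division_ofD(3,4)[OF D k] by (metis box_real(2))
      have "k \<subseteq> {a..b}" using division_ofD(2)[OF D k] s by auto
      with cd have le: "c \<le> d" "a \<le> c" "d \<le> b" by auto
      have P: "primitive_on c d f F" by (rule primitive_on_subinterval[OF assms le(2,3)])
      have "F d - F c = (LINT s:{c..d}|lborel. f s)"
        using primitive_on_eq[OF P, of d] le by auto
      also have "\<dots> = integral {c..d} f"
        using P by (intro set_borel_integral_eq_integral(2) primitive_on_integrable)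
      also have "\<dots> = integral {c..d} g"
        by (rule integral_cong) (use le in \<open>auto simp: g_def\<close>)
      finally show ?thesis using cd le by simp
    qed
    then have "(\<Sum>k\<in>D. \<bar>F (Sup k) - F (Inf k)\<bar>) = (\<Sum>k\<in>D. norm (integral k g))" by simp
    also have "\<dots> \<le> B" using D division_ofD(6)[OF D] by (intro B) auto
    finally show ?thesis .
  qed
  then show ?thesis unfolding finite_variation_on_def by blast
qed

text \<open>Half-lines form an intersection-stable generator of the Borel sets, so the integral,
  vanishing over each of them, vanishes over every Borel set; comparison with the density 0
  concludes. This makes trading rates unique up to null sets.\<close>

lemma indefinite_integral_zero_imp_AE_zero:
  fixes f :: "real \<Rightarrow> real"
  assumes int: "set_integrable lborel {a..b} f"
    and z: "\<And>t. t \<in> {a..b} \<Longrightarrow> (LINT s:{a..t}|lborel. f s) = 0"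
  shows "AE s in lborel. s \<in> {a..b} \<longrightarrow> f s = 0"
proof -
  define g where "g = (\<lambda>s. indicator {a..b} s * f s)"
  have g: "integrable lborel g" using int by (simp add: set_integrable_def g_def)
  have atMost: "(LINT s:{..t}|lborel. g s) = 0" for t
  proof (cases "a \<le> t \<and> a \<le> b")
    case True
    have "(LINT s:{..t}|lborel. g s) = (LINT s:{a..min t b}|lborel. f s)"
      unfolding set_lebesgue_integral_def g_def
      by (intro Bochner_Integration.integral_cong) (auto simp: indicator_def)
    also have "\<dots> = 0" using True by (intro z) auto
    finally show ?thesis .
  next
    case False
    then have "(\<lambda>s. indicator {..t} s *\<^sub>R g s) = (\<lambda>s. 0)" by (auto simp: g_def indicator_def)
    then show ?thesis unfolding set_lebesgue_integral_def by (simp only: Bochner_Integration.integral_zero)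
  qed
  \<comment> \<open>The whole line is not a half-line; its integral is what the complement step of
    the induction subtracts from.\<close>
  have UN: "(LINT s:UNIV|lborel. g s) = 0"
  proof -
    have "(LINT s:UNIV|lborel. g s) = (LINT s:{..b}|lborel. g s)"
      unfolding set_lebesgue_integral_def g_def
      by (intro Bochner_Integration.integral_cong) (auto simp: indicator_def)
    then show ?thesis using atMost by simp
  qed
  have si: "set_integrable lborel A g" if "A \<in> sets lborel" for A
    using g that unfolding set_integrable_def by (intro integrable_mult_indicator) auto
  have all: "(LINT s:A|lborel. g s) = 0" if "A \<in> sets borel" for A :: "real set"
  proof -
    have "Int_stable (range atMost :: real set set)"
      by (auto simp: Int_stable_def)
    moreover have "range atMost \<subseteq> Pow (UNIV::real set)" by auto
    moreover have A: "A \<in> sigma_sets UNIV (range atMost)"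
      using that by (subst (asm) borel_eq_atMost) auto
    ultimately show ?thesis
    proof (induction rule: sigma_sets_induct_disjoint)
      case (basic A)
      then show ?case using atMost by auto
    next
      case empty
      then show ?case by (simp add: set_lebesgue_integral_def)
    next
      case (compl A)
      then have [measurable]: "A \<in> sets borel" by (subst borel_eq_atMost) auto
      have "(LINT s:(UNIV - A) \<union> A|lborel. g s) = (LINT s:UNIV-A|lborel. g s) + (LINT s:A|lborel. g s)"
        by (rule set_integral_Un) (auto intro!: si)
      then show ?case using compl UN by simp
    next
      case (union A)
      then have [measurable]: "\<And>i. A i \<in> sets borel" by (subst borel_eq_atMost) auto
      have "(LINT s:(\<Union>i. A i)|lborel. g s) = (\<Sum>i. (LINT s:(A i)|lborel. g s))"
        using union by (intro lebesgue_integral_countable_add si) (auto simp: disjoint_family_on_def)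
      then show ?case using union by simp
    qed
  qed
  have "AE s in lborel. g s = 0"
    using density_unique_real[OF g, of "\<lambda>_. 0"] all by simp
  then show ?thesis by eventually_elim (auto simp: g_def indicator_def)
qed

text \<open>Around each point the right limit and the left limit bound \<open>f\<close> on the two
  sides; compactness of \<open>{a..b}\<close> leaves finitely many such neighbourhoods.\<close>

lemma cadlag_on_bounded:
  assumes "cadlag_on a b f"
  obtains B where "\<And>t. t \<in> {a..b} \<Longrightarrow> \<bar>f t\<bar> \<le> B"
proof -
  have "\<exists>U B. open U \<and> x \<in> U \<and> (\<forall>t\<in>U \<inter> {a..b}. \<bar>f t\<bar> \<le> B)" if x: "x \<in> {a..b}" for x
  proof -
    have R: "\<exists>d>x. \<exists>B. \<forall>t\<in>{x<..<d} \<inter> {a..b}. \<bar>f t\<bar> \<le> B"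
    proof (cases "x < b")
      case True
      then have "(f \<longlongrightarrow> f x) (at_right x)" using assms x by (auto simp: cadlag_on_def)
      then have "eventually (\<lambda>t. dist (f t) (f x) < 1) (at_right x)"
        by (rule tendstoD) simp
      then obtain d where "d > x" "\<forall>t>x. t < d \<longrightarrow> dist (f t) (f x) < 1"
        unfolding eventually_at_right_field by blast
      then show ?thesis by (intro exI[of _ d] conjI exI[of _ "\<bar>f x\<bar> + 1"]) (auto simp: dist_real_def)
    next
      case False
      then show ?thesis by (intro exI[of _ "x + 1"]) auto
    qed
    have L: "\<exists>d<x. \<exists>B. \<forall>t\<in>{d<..<x} \<inter> {a..b}. \<bar>f t\<bar> \<le> B"
    proof (cases "a < x")
      case True
      then obtain l where "(f \<longlongrightarrow> l) (at_left x)"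
        using assms x unfolding cadlag_on_def by (meson atLeastAtMost_iff greaterThanAtMost_iff)
      then have "eventually (\<lambda>t. dist (f t) l < 1) (at_left x)"
        by (rule tendstoD) simp
      then obtain d where "d < x" "\<forall>t>d. t < x \<longrightarrow> dist (f t) l < 1"
        unfolding eventually_at_left_field by blast
      then show ?thesis by (intro exI[of _ d] conjI exI[of _ "\<bar>l\<bar> + 1"]) (auto simp: dist_real_def)
    next
      case False
      then show ?thesis by (intro exI[of _ "x - 1"]) auto
    qed
    obtain d B where d: "d > x" "\<And>t. t\<in>{x<..<d} \<inter> {a..b} \<Longrightarrow> \<bar>f t\<bar> \<le> B" using R by blast
    obtain d' B' where d': "d' < x" "\<And>t. t\<in>{d'<..<x} \<inter> {a..b} \<Longrightarrow> \<bar>f t\<bar> \<le> B'" using L by blast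
    have "\<bar>f t\<bar> \<le> Max {B, B', \<bar>f x\<bar>}" if "t \<in> {d'<..<d} \<inter> {a..b}" for t
    proof (rule linorder_cases[of t x])
      assume "t < x"
      with that have "\<bar>f t\<bar> \<le> B'" by (intro d') auto
      then show ?thesis by (auto simp: le_max_iff_disj)
    next
      assume "t > x"
      with that have "\<bar>f t\<bar> \<le> B" by (intro d) auto
      then show ?thesis by (auto simp: le_max_iff_disj)
    qed (auto simp: le_max_iff_disj)
    then show ?thesis using d(1) d'(1)
      by (intro exI[of _ "{d'<..<d}"] exI[of _ "Max {B, B', \<bar>f x\<bar>}"]) auto
  qed
  then obtain U B where UB: "\<And>x. x \<in> {a..b} \<Longrightarrow> open (U x) \<and> x \<in> U x \<and> (\<forall>t\<in>U x \<inter> {a..b}. \<bar>f t\<bar> \<le> B x)"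
    by metis
  then have "{a..b} \<subseteq> (\<Union>x\<in>{a..b}. U x)" "\<And>x. x \<in> {a..b} \<Longrightarrow> open (U x)" by auto
  then obtain C where C: "C \<subseteq> {a..b}" "finite C" "{a..b} \<subseteq> (\<Union>x\<in>C. U x)"
    using compactE_image[OF compact_Icc] by metis
  have "\<bar>f t\<bar> \<le> (\<Sum>x\<in>C. \<bar>B x\<bar>)" if t: "t \<in> {a..b}" for t
  proof -
    obtain x where x: "x \<in> C" "t \<in> U x" using C t by auto
    then have "\<bar>f t\<bar> \<le> B x" using UB C t by blast
    also have "\<dots> \<le> \<bar>B x\<bar>" by simp
    also have "\<dots> \<le> (\<Sum>x\<in>C. \<bar>B x\<bar>)" using x C by (intro member_le_sum) auto
    finally show ?thesis .
  qed
  then show thesis by (rule that)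
qed


section \<open>Measurability of cadlag processes\<close>

text \<open>\<open>X\<close> is read off at the next point of a grid of mesh 1/(n+1). The grid point
  ranges over a countable set and lies strictly to the right of \<open>s\<close> as long as it is
  below \<open>t\<close>, so right continuity gives convergence. With \<open>M = F t\<close> this is
  progressive measurability; over a one-point space it is Borel measurability of a path.\<close>

lemma right_continuous_jointly_measurable:
  fixes X :: "real \<Rightarrow> 'a \<Rightarrow> real"
  assumes t: "0 \<le> t"
    and X: "\<And>s. s \<in> {0..t} \<Longrightarrow> X s \<in> borel_measurable M"
    and R: "\<And>s \<omega>. s \<in> {0..<t} \<Longrightarrow> \<omega> \<in> space M \<Longrightarrow> ((\<lambda>s. X s \<omega>) \<longlongrightarrow> X s \<omega>) (at_right s)"
  shows "(\<lambda>(s, \<omega>). X s \<omega>) \<in> borel_measurable (restrict_space borel {0..t} \<Otimes>\<^sub>M M)"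
proof (rule borel_measurable_LIMSEQ_real)
  let ?N = "restrict_space borel {0..t} \<Otimes>\<^sub>M M"
  \<comment> \<open>The \<open>+ 1\<close> moves the grid point strictly beyond \<open>s\<close>, as
    \<open>at_right\<close> demands. Clipping keeps it in \<open>{0..t}\<close>, where
    \<open>X\<close> is measurable with respect to \<open>M\<close>, and gives exactly
    \<open>t\<close> at \<open>s = t\<close>.\<close>
  define g where "g n k = min t (max 0 ((of_int k + 1) / real (Suc n)))" for n :: nat and k :: int
  define u where "u n p = X (g n \<lfloor>fst p * real (Suc n)\<rfloor>) (snd p)" for n and p :: "real \<times> 'a"
  have fst_meas: "(\<lambda>p. fst p :: real) \<in> borel_measurable ?N"
    using measurable_fst[of "restrict_space borel {0..t}" M] by (simp add: measurable_restrict_space2_iff)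
  have g01: "g n k \<in> {0..t}" for n k using t by (auto simp: g_def)
  show "u n \<in> borel_measurable ?N" for n
    unfolding u_def
  proof (rule measurable_compose_countable)
    show "(\<lambda>p. X (g n k) (snd p)) \<in> borel_measurable ?N" for k
      by (rule measurable_compose[OF measurable_snd X[OF g01]])
    show "(\<lambda>p. \<lfloor>fst p * real (Suc n)\<rfloor>) \<in> ?N \<rightarrow>\<^sub>M count_space UNIV"
      using fst_meas by measurable
  qed
  show "(\<lambda>n. u n p) \<longlonglongrightarrow> (case p of (s, \<omega>) \<Rightarrow> X s \<omega>)" if p: "p \<in> space ?N" for p
  proof -
    obtain s \<omega> where p_eq: "p = (s, \<omega>)" by (cases p)
    then have s: "0 \<le> s" "s \<le> t" and \<omega>: "\<omega> \<in> space M"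
      using p by (auto simp: space_pair_measure space_restrict_space)
    let ?q = "\<lambda>n. (of_int \<lfloor>s * real (Suc n)\<rfloor> + 1) / real (Suc n)"
    have q_gt: "s < ?q n" for n
    proof -
      have "s * real (Suc n) < of_int \<lfloor>s * real (Suc n)\<rfloor> + 1" by linarith
      then show ?thesis by (simp add: pos_less_divide_eq del: of_nat_Suc)
    qed
    have q_le: "?q n \<le> s + 1 / real (Suc n)" for n
    proof -
      have "of_int \<lfloor>s * real (Suc n)\<rfloor> + 1 \<le> s * real (Suc n) + 1" by linarith
      then have "?q n \<le> (s * real (Suc n) + 1) / real (Suc n)" by (rule divide_right_mono) simp
      then show ?thesis by (simp add: add_divide_distrib del: of_nat_Suc)
    qed
    have q_lim: "?q \<longlonglongrightarrow> s"
    proof (rule tendsto_sandwich[of "\<lambda>_. s" _ _ "\<lambda>n. s + 1 / real (Suc n)"])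
      have "(\<lambda>n. s + 1 / real (Suc n)) \<longlonglongrightarrow> s + 0"
        by (intro tendsto_intros) (use LIMSEQ_inverse_real_of_nat in \<open>simp add: inverse_eq_divide\<close>)
      then show "(\<lambda>n. s + 1 / real (Suc n)) \<longlonglongrightarrow> s" by simp
    qed (use q_gt q_le in \<open>auto intro!: always_eventually less_imp_le simp del: of_nat_Suc\<close>)
    show ?thesis
    proof (cases "s < t")
      case False
      then have "g n \<lfloor>s * real (Suc n)\<rfloor> = t" for n
        using s q_gt[of n] t unfolding g_def by (simp add: min_def max_def del: of_nat_Suc)
      with False s show ?thesis by (simp add: u_def p_eq del: of_nat_Suc)
    next
      case True
      have ev: "eventually (\<lambda>n. ?q n < t) sequentially"
        using q_lim True by (rule order_tendstoD(2))
      have ql: "filterlim ?q (at_right s) sequentially"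
        unfolding filterlim_at using q_lim q_gt less_imp_neq[OF q_gt, symmetric]
        by (auto intro!: always_eventually simp del: of_nat_Suc)
      have "((\<lambda>s. X s \<omega>) \<longlongrightarrow> X s \<omega>) (at_right s)"
        using True s \<omega> by (intro R) auto
      from filterlim_compose[OF this ql] have "(\<lambda>n. X (?q n) \<omega>) \<longlonglongrightarrow> X s \<omega>" .
      moreover have "eventually (\<lambda>n. X (?q n) \<omega> = u n p) sequentially"
        using ev
      proof eventually_elim
        case (elim n)
        have "0 < ?q n" using q_gt[of n] s by linarith
        with elim have "g n \<lfloor>s * real (Suc n)\<rfloor> = ?q n"
          unfolding g_def by (simp add: min_def max_def del: of_nat_Suc)
        then show ?case by (simp add: u_def p_eq del: of_nat_Suc)
      qed
      ultimately have "(\<lambda>n. u n p) \<longlonglongrightarrow> X s \<omega>" by (rule Lim_transform_eventually)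
      then show ?thesis by (simp add: p_eq)
    qed
  qed
qed

text \<open>Clipping the time argument extends the process from \<open>{0..t}\<close> to the whole
  line, so that \<open>restrict_space\<close> disappears and product measures with
  \<open>lborel\<close> become available. \<open>M\<close> may be finer than
  \<open>M'\<close>.\<close>

lemma clip_jointly_measurable:
  fixes t :: real
  assumes "(\<lambda>(s, \<omega>). X s \<omega>) \<in> N \<rightarrow>\<^sub>M borel" "N = restrict_space borel {0..t} \<Otimes>\<^sub>M M'"
    and id: "(\<lambda>\<omega>. \<omega>) \<in> M \<rightarrow>\<^sub>M M'" and t: "0 \<le> t"
  shows "(\<lambda>(s, \<omega>). X (max 0 (min t s)) \<omega>) \<in> borel_measurable (borel \<Otimes>\<^sub>M M)"
proof -
  have "(\<lambda>(s, \<omega>). (max 0 (min t s), \<omega>)) \<in> borel \<Otimes>\<^sub>M M \<rightarrow>\<^sub>M restrict_space borel {0..t} \<Otimes>\<^sub>M M'"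
    unfolding split_beta'
  proof (rule measurable_Pair)
    show "(\<lambda>x. max 0 (min t (fst x))) \<in> borel \<Otimes>\<^sub>M M \<rightarrow>\<^sub>M restrict_space borel {0..t}"
      using t by (intro measurable_restrict_space2) auto
    show "(\<lambda>x. snd x) \<in> borel \<Otimes>\<^sub>M M \<rightarrow>\<^sub>M M'"
      by (rule measurable_compose[OF measurable_snd id])
  qed
  from measurable_compose[OF this assms(1)[unfolded assms(2)]] show ?thesis
    by (simp add: split_beta')
qed

text \<open>Joint measurability over a one-point space, with the deterministic function as the
  process.\<close>

lemma cadlag_on_clip_measurable:
  assumes "cadlag_on 0 t f" "0 \<le> t"
  shows "(\<lambda>s. f (max 0 (min t s))) \<in> borel_measurable borel"
proof -
  let ?U = "count_space (UNIV :: unit set)"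
  have "(\<lambda>(s, \<omega>). (\<lambda>s _. f s) s \<omega>) \<in> borel_measurable (restrict_space borel {0..t} \<Otimes>\<^sub>M ?U)"
    using assms by (intro right_continuous_jointly_measurable) (auto simp: cadlag_on_def)
  from clip_jointly_measurable[OF this refl measurable_ident_sets[OF refl] assms(2)]
  have "(\<lambda>(s, \<omega>). f (max 0 (min t s))) \<in> borel_measurable (borel \<Otimes>\<^sub>M ?U)" .
  moreover have "(\<lambda>s. (s, ())) \<in> borel \<rightarrow>\<^sub>M borel \<Otimes>\<^sub>M ?U" by simp
  ultimately have "(\<lambda>s. case (s, ()) of (s, \<omega>) \<Rightarrow> f (max 0 (min t s))) \<in> borel_measurable borel"
    by (rule measurable_compose[rotated])
  then show ?thesis by simp
qed

context usual_filtered_prob_space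
begin

abbreviation second_moment :: "('a \<Rightarrow> real) \<Rightarrow> ennreal" where
  "second_moment X \<equiv> (\<integral>\<^sup>+\<omega>. ennreal ((X \<omega>)\<^sup>2) \<partial>P)"

abbreviation energy :: "real set \<Rightarrow> 'a process \<Rightarrow> 'a \<Rightarrow> ennreal" where
  "energy A X \<omega> \<equiv> (\<integral>\<^sup>+t\<in>A. ennreal ((X t \<omega>)\<^sup>2) \<partial>lborel)"

lemma space_F: "t \<in> {0..T} \<Longrightarrow> space (F t) = space P"
  using F_subalgebra by (auto simp: subalgebra_def)

lemma F_le: "0 \<le> s \<Longrightarrow> s \<le> t \<Longrightarrow> t \<le> T \<Longrightarrow> f \<in> borel_measurable (F s) \<Longrightarrow> f \<in> borel_measurable (F t)"
  using F_mono[of s t] space_F[of s] space_F[of t] by (intro measurableI) (auto dest: measurable_sets measurable_space)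

lemma F_P: "t \<in> {0..T} \<Longrightarrow> f \<in> borel_measurable (F t) \<Longrightarrow> f \<in> borel_measurable P"
  using F_subalgebra measurable_from_subalg by blast

lemma cadlag_adapted_prog_measurable:
  assumes "cadlag_adapted P F T X"
  shows "prog_measurable F T X"
  unfolding prog_measurable_def
proof
  fix t assume t: "t \<in> {0..T}"
  show "(\<lambda>(s, \<omega>). X s \<omega>) \<in> borel_measurable (restrict_space borel {0..t} \<Otimes>\<^sub>M F t)"
  proof (rule right_continuous_jointly_measurable)
    show "X s \<in> borel_measurable (F t)" if "s \<in> {0..t}" for s
      using assms that t by (intro F_le[of s t]) (auto simp: cadlag_adapted_def adapted_def)
    show "((\<lambda>s. X s \<omega>) \<longlongrightarrow> X s \<omega>) (at_right s)" if "s \<in> {0..<t}" "\<omega> \<in> space (F t)" for s \<omega>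
      using assms that t space_F[OF t] by (auto simp: cadlag_adapted_def cadlag_on_def)
  qed (use t in auto)
qed

lemma prog_measurable_clip:
  assumes "prog_measurable F T X" and t: "t \<in> {0..T}"
  shows "(\<lambda>(s, \<omega>). X (max 0 (min t s)) \<omega>) \<in> borel_measurable (borel \<Otimes>\<^sub>M F t)"
  using assms by (intro clip_jointly_measurable[OF _ refl measurable_ident_sets[OF refl]])
    (auto simp: prog_measurable_def)

lemma prog_measurable_clip_P:
  assumes "prog_measurable F T X"
  shows "(\<lambda>(s, \<omega>). X (max 0 (min T s)) \<omega>) \<in> borel_measurable (borel \<Otimes>\<^sub>M P)"
proof -
  have T: "T \<in> {0..T}" using horizon_pos by simp
  have "(\<lambda>\<omega>. \<omega>) \<in> P \<rightarrow>\<^sub>M F T"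
    using F_subalgebra[OF T] by (intro measurableI) (auto simp: subalgebra_def)
  with assms show ?thesis using horizon_pos
    by (intro clip_jointly_measurable[OF _ refl]) (auto simp: prog_measurable_def)
qed

text \<open>The clip is at \<open>t\<close>, not at \<open>T\<close>: this keeps the integrand
  measurable for \<open>F t\<close> and yields adaptedness of the averages. The weight
  \<open>w\<close> also serves to move the lower limit of integration.\<close>

lemma weighted_integral_measurable:
  fixes w :: "real \<Rightarrow> real"
  assumes "prog_measurable F T X" and t: "t \<in> {0..T}" and [measurable]: "w \<in> borel_measurable borel"
  shows "(\<lambda>\<omega>. LINT s:{0..t}|lborel. w s * X s \<omega>) \<in> borel_measurable (F t)"
proof -
  note [measurable] = prog_measurable_clip[OF assms(1,2)]
  have m: "(\<lambda>x. X (max 0 (min t (snd x))) (fst x)) \<in> borel_measurable (F t \<Otimes>\<^sub>M lborel)"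
  proof -
    have "(\<lambda>x. (snd x, fst x)) \<in> F t \<Otimes>\<^sub>M lborel \<rightarrow>\<^sub>M borel \<Otimes>\<^sub>M F t" by measurable
    from measurable_compose[OF this prog_measurable_clip[OF assms(1,2)]] show ?thesis by simp
  qed
  have "(\<lambda>\<omega>. \<integral>s. indicator {0..t} s * (w s * X (max 0 (min t s)) \<omega>) \<partial>lborel) \<in> borel_measurable (F t)"
    using m by (intro lborel.borel_measurable_lebesgue_integral) (simp add: split_beta')
  moreover have "(LINT s:{0..t}|lborel. w s * X s \<omega>) = (\<integral>s. indicator {0..t} s * (w s * X (max 0 (min t s)) \<omega>) \<partial>lborel)" for \<omega>
    unfolding set_lebesgue_integral_def
    by (intro Bochner_Integration.integral_cong) (auto simp: indicator_def min_absorb2)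
  ultimately show ?thesis by simp
qed

end


section \<open>Second moments of the target martingale\<close>

lemma square_integrable_mult:
  fixes f g :: "'a \<Rightarrow> real"
  assumes [measurable]: "f \<in> borel_measurable M" "g \<in> borel_measurable M"
    and "integrable M (\<lambda>x. (f x)\<^sup>2)" "integrable M (\<lambda>x. (g x)\<^sup>2)"
  shows "integrable M (\<lambda>x. f x * g x)"
proof (rule Bochner_Integration.integrable_bound)
  show "integrable M (\<lambda>x. (f x)\<^sup>2 + (g x)\<^sup>2)" using assms by auto
  show "AE x in M. norm (f x * g x) \<le> norm ((f x)\<^sup>2 + (g x)\<^sup>2)"
  proof (rule AE_I2)
    fix x
    have "2 * \<bar>f x\<bar> * \<bar>g x\<bar> \<le> (f x)\<^sup>2 + (g x)\<^sup>2"
      using sum_squares_bound[of "\<bar>f x\<bar>" "\<bar>g x\<bar>"] by simp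
    moreover have "\<bar>f x\<bar> * \<bar>g x\<bar> \<ge> 0" by simp
    ultimately show "norm (f x * g x) \<le> norm ((f x)\<^sup>2 + (g x)\<^sup>2)"
      by (simp only: real_norm_def abs_mult)
  qed
qed measurable

text \<open>Fatou's lemma for functions whose integrals have a common bound; it takes the place of
  domination in several limits below.\<close>

lemma nn_integral_le_limit:
  fixes u :: "nat \<Rightarrow> 'a \<Rightarrow> ennreal"
  assumes u: "\<And>n. u n \<in> borel_measurable M"
    and lim: "AE x in M. (\<lambda>n. u n x) \<longlonglongrightarrow> v x"
    and le: "eventually (\<lambda>n. (\<integral>\<^sup>+x. u n x \<partial>M) \<le> c) sequentially"
  shows "(\<integral>\<^sup>+x. v x \<partial>M) \<le> c"
proof -
  have "(\<integral>\<^sup>+x. v x \<partial>M) = (\<integral>\<^sup>+x. liminf (\<lambda>n. u n x) \<partial>M)"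
    by (rule nn_integral_cong_AE, use lim in eventually_elim) (simp add: lim_imp_Liminf)
  also have "\<dots> \<le> liminf (\<lambda>n. \<integral>\<^sup>+x. u n x \<partial>M)" by (rule nn_integral_liminf[OF u])
  also have "\<dots> \<le> c"
  proof -
    have "liminf (\<lambda>n. \<integral>\<^sup>+x. u n x \<partial>M) \<le> liminf (\<lambda>n. c)"
      using le by (rule Liminf_mono)
    then show ?thesis by (simp add: Liminf_const)
  qed
  finally show ?thesis .
qed

locale square_integrable_target = usual_filtered_prob_space P F T
  for P :: "'a measure" and F T +
  fixes \<Xi> :: "real \<Rightarrow> 'a \<Rightarrow> real"
  assumes target: "target_process P F T \<Xi>"
begin

lemma T_in: "T \<in> {0..T}" using horizon_pos by simp

lemma Xi_cadlag_adapted: "cadlag_adapted P F T \<Xi>"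
  using target by (simp add: target_process_def)

lemma Xi_F[measurable]: "t \<in> {0..T} \<Longrightarrow> \<Xi> t \<in> borel_measurable (F t)"
  using Xi_cadlag_adapted by (simp add: cadlag_adapted_def adapted_def)

lemma Xi_P[measurable]: "t \<in> {0..T} \<Longrightarrow> \<Xi> t \<in> borel_measurable P"
  using F_P Xi_F by blast

lemma Xi_path: "\<omega> \<in> space P \<Longrightarrow> cadlag_on 0 T (\<lambda>t. \<Xi> t \<omega>)"
  using Xi_cadlag_adapted by (simp add: cadlag_adapted_def)

lemma Xi_AE: "t \<in> {0..T} \<Longrightarrow> AE \<omega> in P. \<Xi> t \<omega> = real_cond_exp P (F t) (\<Xi> T) \<omega>"
  using target by (simp add: target_process_def)

lemma Xi_T_square: "integrable P (\<lambda>\<omega>. (\<Xi> T \<omega>)\<^sup>2)"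
  using target by (simp add: target_process_def)

lemma Xi_T_integrable: "integrable P (\<Xi> T)"
  using square_integrable_imp_integrable[OF Xi_P[OF T_in]] Xi_T_square by simp

lemma subalg_sigma_finite: "t \<in> {0..T} \<Longrightarrow> sigma_finite_subalgebra P (F t)"
  using F_subalgebra by (intro finite_measure_subalgebra_is_sigma_finite)
    (auto simp: finite_measure_subalgebra_def finite_measure_subalgebra_axioms_def finite_measure_axioms)

lemma Xi_square: assumes t: "t \<in> {0..T}" shows "integrable P (\<lambda>\<omega>. (\<Xi> t \<omega>)\<^sup>2)"
proof -
  interpret sigma_finite_subalgebra P "F t" by (rule subalg_sigma_finite[OF t])
  have "integrable P (\<lambda>\<omega>. (real_cond_exp P (F t) (\<Xi> T) \<omega>)\<^sup>2)"
    using convex_power2 Xi_T_square Xi_T_integrable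
    by (intro integrable_convex_cond_exp[where I = UNIV and q = "\<lambda>x. x\<^sup>2"]) auto
  moreover have "AE \<omega> in P. (real_cond_exp P (F t) (\<Xi> T) \<omega>)\<^sup>2 = (\<Xi> t \<omega>)\<^sup>2"
    using Xi_AE[OF t] by eventually_elim simp
  ultimately show ?thesis
    using Xi_P[OF t] by (subst integrable_cong_AE[where g = "\<lambda>\<omega>. (real_cond_exp P (F t) (\<Xi> T) \<omega>)\<^sup>2"]) auto
qed

lemma Xi_orthogonal_T:
  assumes t: "t \<in> {0..T}" and Z: "Z \<in> borel_measurable (F t)" and Z2: "integrable P (\<lambda>\<omega>. (Z \<omega>)\<^sup>2)"
  shows "(\<integral>\<omega>. Z \<omega> * \<Xi> T \<omega> \<partial>P) = (\<integral>\<omega>. Z \<omega> * \<Xi> t \<omega> \<partial>P)"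
proof -
  interpret sigma_finite_subalgebra P "F t" by (rule subalg_sigma_finite[OF t])
  note [measurable] = F_P[OF t Z] Xi_P[OF T_in] Xi_P[OF t]
  have i: "integrable P (\<lambda>\<omega>. Z \<omega> * \<Xi> T \<omega>)"
    using Z2 Xi_T_square by (intro square_integrable_mult) auto
  have "(\<integral>\<omega>. Z \<omega> * \<Xi> T \<omega> \<partial>P) = (\<integral>\<omega>. Z \<omega> * real_cond_exp P (F t) (\<Xi> T) \<omega> \<partial>P)"
    using i Z by (intro real_cond_exp_intg(2)[symmetric]) auto
  also have "\<dots> = (\<integral>\<omega>. Z \<omega> * \<Xi> t \<omega> \<partial>P)"
    using Xi_AE[OF t] by (intro integral_cong_AE) auto
  finally show ?thesis .
qed

text \<open>Both \<open>\<Xi> t\<close> and \<open>\<Xi> s\<close> have the same inner product with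
  \<open>Z\<close> as \<open>\<Xi> T\<close>, because \<open>Z\<close> is measurable at both times.
  This replaces the tower property.\<close>

lemma Xi_orthogonal:
  assumes s: "0 \<le> s" "s \<le> t" "t \<le> T" and Z: "Z \<in> borel_measurable (F s)" and Z2: "integrable P (\<lambda>\<omega>. (Z \<omega>)\<^sup>2)"
  shows "integrable P (\<lambda>\<omega>. Z \<omega> * (\<Xi> t \<omega> - \<Xi> s \<omega>))" "(\<integral>\<omega>. Z \<omega> * (\<Xi> t \<omega> - \<Xi> s \<omega>) \<partial>P) = 0"
proof -
  have st: "s \<in> {0..T}" "t \<in> {0..T}" using s by auto
  note [measurable] = F_P[OF st(1) Z] Xi_P[OF st(1)] Xi_P[OF st(2)]
  have i: "integrable P (\<lambda>\<omega>. Z \<omega> * \<Xi> t \<omega>)" "integrable P (\<lambda>\<omega>. Z \<omega> * \<Xi> s \<omega>)"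
    using Z2 Xi_square st by (auto intro!: square_integrable_mult)
  then show "integrable P (\<lambda>\<omega>. Z \<omega> * (\<Xi> t \<omega> - \<Xi> s \<omega>))" by (simp add: right_diff_distrib)
  have "(\<integral>\<omega>. Z \<omega> * \<Xi> t \<omega> \<partial>P) = (\<integral>\<omega>. Z \<omega> * \<Xi> s \<omega> \<partial>P)"
    using Xi_orthogonal_T[OF st(1) Z Z2] Xi_orthogonal_T[OF st(2) F_le[OF s Z] Z2] by simp
  then show "(\<integral>\<omega>. Z \<omega> * (\<Xi> t \<omega> - \<Xi> s \<omega>) \<partial>P) = 0" using i by (simp add: right_diff_distrib)
qed

text \<open>The distribution function of the Stieltjes measure in \<open>Lambda_target\<close>. By
  orthogonality its increments are squared L2 norms of increments of \<open>\<Xi>\<close>.\<close>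

definition \<phi> :: "real \<Rightarrow> real" where "\<phi> t = (\<integral>\<omega>. (\<Xi> t \<omega>)\<^sup>2 \<partial>P)"

lemma Xi_diff_square_integrable:
  assumes "s \<in> {0..T}" "t \<in> {0..T}"
  shows "integrable P (\<lambda>\<omega>. (\<Xi> t \<omega> - \<Xi> s \<omega>)\<^sup>2)"
proof -
  note [measurable] = Xi_P[OF assms(1)] Xi_P[OF assms(2)]
  have "integrable P (\<lambda>\<omega>. (\<Xi> t \<omega>)\<^sup>2 + (\<Xi> s \<omega>)\<^sup>2 - 2 * (\<Xi> t \<omega> * \<Xi> s \<omega>))"
    using Xi_square assms by (intro Bochner_Integration.integrable_diff Bochner_Integration.integrable_add
      integrable_mult_right square_integrable_mult) auto
  then show ?thesis by (simp add: power2_diff mult.assoc)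
qed

lemma Xi_increment_square:
  assumes s: "0 \<le> s" "s \<le> t" "t \<le> T"
  shows "(\<integral>\<omega>. (\<Xi> t \<omega> - \<Xi> s \<omega>)\<^sup>2 \<partial>P) = \<phi> t - \<phi> s"
proof -
  have st: "s \<in> {0..T}" "t \<in> {0..T}" using s by auto
  have o: "integrable P (\<lambda>\<omega>. \<Xi> s \<omega> * (\<Xi> t \<omega> - \<Xi> s \<omega>))" "(\<integral>\<omega>. \<Xi> s \<omega> * (\<Xi> t \<omega> - \<Xi> s \<omega>) \<partial>P) = 0"
    using Xi_orthogonal[OF s Xi_F[OF st(1)] Xi_square[OF st(1)]] by auto
  have "(\<Xi> t \<omega> - \<Xi> s \<omega>)\<^sup>2 = (\<Xi> t \<omega>)\<^sup>2 - (\<Xi> s \<omega>)\<^sup>2 - 2 * (\<Xi> s \<omega> * (\<Xi> t \<omega> - \<Xi> s \<omega>))" for \<omega>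
    by (simp add: power2_eq_square algebra_simps)
  then have "(\<integral>\<omega>. (\<Xi> t \<omega> - \<Xi> s \<omega>)\<^sup>2 \<partial>P)
      = (\<integral>\<omega>. (\<Xi> t \<omega>)\<^sup>2 - (\<Xi> s \<omega>)\<^sup>2 - 2 * (\<Xi> s \<omega> * (\<Xi> t \<omega> - \<Xi> s \<omega>)) \<partial>P)" by simp
  also have "\<dots> = \<phi> t - \<phi> s"
    using o Xi_square st by (simp add: \<phi>_def)
  finally show ?thesis .
qed

lemma nn_Xi_increment_square:
  assumes s: "0 \<le> s" "s \<le> t" "t \<le> T"
  shows "(\<integral>\<^sup>+\<omega>. ennreal ((\<Xi> t \<omega> - \<Xi> s \<omega>)\<^sup>2) \<partial>P) = ennreal (\<phi> t - \<phi> s)"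
  using Xi_diff_square_integrable[of s t] Xi_increment_square[OF s] s
  by (subst nn_integral_eq_integral) auto

lemma nn_Xi_square: "t \<in> {0..T} \<Longrightarrow> second_moment (\<Xi> t) = ennreal (\<phi> t)"
  using Xi_square by (subst nn_integral_eq_integral) (auto simp: \<phi>_def)

lemma \<phi>_mono: "0 \<le> s \<Longrightarrow> s \<le> t \<Longrightarrow> t \<le> T \<Longrightarrow> \<phi> s \<le> \<phi> t"
  using Xi_increment_square[of s t] Bochner_Integration.integral_nonneg[of P "\<lambda>\<omega>. (\<Xi> t \<omega> - \<Xi> s \<omega>)\<^sup>2"] by simp

lemma \<phi>_nonneg: "0 \<le> \<phi> t" by (simp add: \<phi>_def)

text \<open>Along times decreasing to \<open>t\<close> the martingale is Cauchy in L2, since its increments are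
  orthogonal; by Fatou's lemma the limit is \<open>\<Xi> t\<close>.\<close>

lemma \<phi>_right_continuous:
  assumes t: "0 \<le> t" "t < T" and e: "0 < e"
  obtains s where "t < s" "s \<le> T" "\<phi> s < \<phi> t + e"
proof -
  define s where "s n = t + (T - t) / real (Suc n)" for n
  have s: "t < s n" "s n \<le> T" "0 \<le> s n" for n
  proof -
    define d where "d = (T - t) / real (Suc n)"
    have "d \<le> (T - t) / 1"
      unfolding d_def using t by (intro divide_left_mono) auto
    moreover have "0 < d" using t by (simp add: d_def)
    moreover have "s n = t + d" by (simp add: s_def d_def)
    ultimately show "t < s n" "s n \<le> T" "0 \<le> s n"
      using t by auto
  qed
  have s_lim: "s \<longlonglongrightarrow> t"
  proof -
    have "(\<lambda>n. t + (T - t) * inverse (real (Suc n))) \<longlonglongrightarrow> t + (T - t) * 0"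
      by (intro tendsto_intros LIMSEQ_inverse_real_of_nat)
    then show ?thesis unfolding s_def divide_inverse by (simp del: of_nat_Suc)
  qed
  have s_dec: "s n \<le> s m" if "m \<le> n" for m n
    using that t unfolding s_def by (auto intro!: divide_left_mono)
  define L where "L = (INF n. \<phi> (s n))"
  have bdd: "bdd_below (range (\<lambda>n. \<phi> (s n)))" by (rule bdd_belowI[of _ 0]) (auto simp: \<phi>_nonneg)
  have L: "L \<le> \<phi> (s n)" for n unfolding L_def by (rule cINF_lower[OF bdd]) simp
  \<comment> \<open>For n \<ge> m the squared L2 distance from \<open>\<Xi> (s m)\<close> to
    \<open>\<Xi> (s n)\<close> is at most \<open>\<phi> (s m) - L\<close>; Fatou replaces
    \<open>\<Xi> (s n)\<close> by \<open>\<Xi> t\<close>. Cancelling \<open>\<phi> (s m)\<close>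
    leaves \<open>L \<le> \<phi> t\<close>.\<close>
  have "\<phi> (s m) - \<phi> t \<le> \<phi> (s m) - L" for m
  proof -
    have "(\<integral>\<^sup>+\<omega>. ennreal ((\<Xi> (s m) \<omega> - \<Xi> t \<omega>)\<^sup>2) \<partial>P) \<le> ennreal (\<phi> (s m) - L)"
    proof (rule nn_integral_le_limit)
      show "(\<lambda>\<omega>. ennreal ((\<Xi> (s m) \<omega> - \<Xi> (s n) \<omega>)\<^sup>2)) \<in> borel_measurable P" for n
        using Xi_P[of "s m"] Xi_P[of "s n"] s by simp
      show "AE \<omega> in P. (\<lambda>n. ennreal ((\<Xi> (s m) \<omega> - \<Xi> (s n) \<omega>)\<^sup>2)) \<longlonglongrightarrow> ennreal ((\<Xi> (s m) \<omega> - \<Xi> t \<omega>)\<^sup>2)"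
      proof (rule AE_I2)
        fix \<omega> assume "\<omega> \<in> space P"
        then have "((\<lambda>s. \<Xi> s \<omega>) \<longlongrightarrow> \<Xi> t \<omega>) (at_right t)"
          using Xi_path t by (auto simp: cadlag_on_def)
        moreover have "filterlim s (at_right t) sequentially"
          unfolding filterlim_at using s_lim s(1) less_imp_neq[OF s(1), symmetric] by (auto intro!: always_eventually)
        ultimately have "(\<lambda>n. \<Xi> (s n) \<omega>) \<longlonglongrightarrow> \<Xi> t \<omega>" by (rule filterlim_compose)
        then show "(\<lambda>n. ennreal ((\<Xi> (s m) \<omega> - \<Xi> (s n) \<omega>)\<^sup>2)) \<longlonglongrightarrow> ennreal ((\<Xi> (s m) \<omega> - \<Xi> t \<omega>)\<^sup>2)"
          by (intro tendsto_intros)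
      qed
      show "eventually (\<lambda>n. (\<integral>\<^sup>+\<omega>. ennreal ((\<Xi> (s m) \<omega> - \<Xi> (s n) \<omega>)\<^sup>2) \<partial>P) \<le> ennreal (\<phi> (s m) - L)) sequentially"
        using eventually_ge_at_top[of m]
      proof eventually_elim
        case (elim n)
        then show ?case using L[of n] s s_dec[of m n]
          by (subst nn_Xi_increment_square) (auto intro!: ennreal_leI)
      qed
    qed
    then have "ennreal (\<phi> (s m) - \<phi> t) \<le> ennreal (\<phi> (s m) - L)"
      using s[of m] t by (subst (asm) nn_Xi_increment_square) auto
    then show ?thesis using L[of m] by (subst (asm) ennreal_le_iff) auto
  qed
  from this[of 0] have "L \<le> \<phi> t" by linarith
  then have "(INF n. \<phi> (s n)) < \<phi> t + e" using e by (simp add: L_def)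
  then have "\<exists>n\<in>UNIV. \<phi> (s n) < \<phi> t + e"
    by (rule cINF_less_iff[OF UNIV_not_empty bdd, THEN iffD1])
  then obtain n where "\<phi> (s n) < \<phi> t + e" by (elim bexE) rule
  then show thesis using s(1,2)[of n] by (rule that[rotated 2])
qed

section \<open>The Stieltjes measure of the second moment and the effect of a finite
  \<open>Lambda_target\<close>\<close>

abbreviation clip :: "real \<Rightarrow> real" where "clip t \<equiv> max 0 (min T t)"

lemma clip_in: "clip t \<in> {0..T}" using horizon_pos by auto

lemma clip_id: "t \<in> {0..T} \<Longrightarrow> clip t = t" by auto

lemma \<phi>_clip_mono: "s \<le> t \<Longrightarrow> \<phi> (clip s) \<le> \<phi> (clip t)"
  using horizon_pos by (intro \<phi>_mono) auto

text \<open>\<open>\<phi>\<close> is continued by constants outside \<open>{0..T}\<close>;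
  monotonicity and right continuity on the line identify \<open>interval_measure\<close> on
  half-open intervals.\<close>

lemma \<phi>_clip_right_continuous: "continuous (at_right t) (\<lambda>t. \<phi> (clip t))"
proof -
  have "eventually (\<lambda>x. dist (\<phi> (clip x)) (\<phi> (clip t)) < e) (at_right t)" if e: "e > 0" for e
  proof -
    consider "t < 0" | "T \<le> t" | "0 \<le> t" "t < T" by linarith
    then obtain d where "d > t" "\<And>x. t < x \<Longrightarrow> x < d \<Longrightarrow> \<phi> (clip x) < \<phi> (clip t) + e"
    proof cases
      case 1
      then show ?thesis using e by (intro that[of 0]) (auto simp: min_def)
    next
      case 2
      then show ?thesis using e by (intro that[of "t + 1"]) (auto simp: min_def)
    next
      case 3
      obtain s where s: "t < s" "s \<le> T" "\<phi> s < \<phi> t + e" using \<phi>_right_continuous[OF 3 e] .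
      have "\<phi> (clip x) < \<phi> (clip t) + e" if "t < x" "x < s" for x
        using \<phi>_mono[of x s] s that 3 by (simp add: max_def min_def)
      then show ?thesis using s(1) that by blast
    qed
    then have "dist (\<phi> (clip x)) (\<phi> (clip t)) < e" if "t < x" "x < d" for x
      using \<phi>_clip_mono[of t x] that by (simp add: dist_real_def abs_less_iff) (smt (verit))
    with \<open>d > t\<close> show ?thesis unfolding eventually_at_right_field by blast
  qed
  then show ?thesis by (simp add: continuous_within tendsto_iff)
qed

abbreviation \<nu> :: "real measure" where "\<nu> \<equiv> interval_measure (\<lambda>t. \<phi> (clip t))"

lemma \<nu>_Ioc: assumes "0 \<le> s" "s \<le> t" "t \<le> T" shows "emeasure \<nu> {s<..t} = ennreal (\<phi> t - \<phi> s)"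
proof -
  have "emeasure \<nu> {s<..t} = ennreal (\<phi> (clip t) - \<phi> (clip s))"
    using assms by (intro emeasure_interval_measure_Ioc \<phi>_clip_mono \<phi>_clip_right_continuous) auto
  then show ?thesis using assms by (simp add: max_def min_def)
qed

lemma Lambda_eq: "Lambda_target P T \<Xi> = (\<integral>\<^sup>+t. inverse (ennreal (T - t)) * indicator {0<..T} t \<partial>\<nu>)"
  unfolding Lambda_target_def \<phi>_def by simp

text \<open>On \<open>{t<..T}\<close> the weight \<open>(T - t) / (T - r)\<close> is at least 1, so
  the mass of this interval is bounded as in Markov's inequality.\<close>

lemma \<phi>_increment_le_Lambda:
  assumes t: "0 \<le> t" "t < T"
  shows "ennreal (\<phi> T - \<phi> t) \<le> ennreal (T - t) * Lambda_target P T \<Xi>"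
proof -
  have "ennreal (\<phi> T - \<phi> t) = (\<integral>\<^sup>+r. indicator {t<..T} r \<partial>\<nu>)"
    using \<nu>_Ioc[of t T] t by simp
  also have "\<dots> \<le> (\<integral>\<^sup>+r. ennreal (T - t) * (inverse (ennreal (T - r)) * indicator {0<..T} r) \<partial>\<nu>)"
  proof (rule nn_integral_mono)
    fix r
    show "indicator {t<..T} r \<le> ennreal (T - t) * (inverse (ennreal (T - r)) * indicator {0<..T} r)"
    proof (cases "r \<in> {t<..T}")
      case True
      show ?thesis
      \<comment> \<open>At \<open>r = T\<close> the weight is infinite, which is how an atom at
        \<open>T\<close> is charged.\<close>
      proof (cases "r = T")
        case True
        then show ?thesis using t by (simp add: indicator_def ennreal_mult_top)
      next
        case False
        then have "1 \<le> (T - t) * inverse (T - r)" using True by (simp add: field_simps)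
        then have "ennreal 1 \<le> ennreal ((T - t) * inverse (T - r))" by (rule ennreal_leI)
        then show ?thesis using True False t by (simp add: inverse_ennreal ennreal_mult[symmetric])
      qed
    qed auto
  qed
  also have "\<dots> = ennreal (T - t) * Lambda_target P T \<Xi>"
    unfolding Lambda_eq by (rule nn_integral_cmult) simp
  finally show ?thesis .
qed

lemma \<phi>_T_left_limit:
  assumes "Lambda_target P T \<Xi> < \<infinity>" and e: "0 < e"
  obtains s where "0 \<le> s" "s < T" "\<phi> T - \<phi> s \<le> e"
proof -
  obtain \<Lambda> where \<Lambda>: "Lambda_target P T \<Xi> = ennreal \<Lambda>" "0 \<le> \<Lambda>"
    using assms by (cases "Lambda_target P T \<Xi>") auto
  \<comment> \<open>The \<open>+ 1\<close> covers \<open>\<Lambda> = 0\<close>; the maximum with 0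
    keeps \<open>s\<close> in the interval.\<close>
  define s where "s = max 0 (T - e / (\<Lambda> + 1))"
  have s: "0 \<le> s" "s < T" using horizon_pos e \<Lambda> by (auto simp: s_def)
  have "ennreal (\<phi> T - \<phi> s) \<le> ennreal ((T - s) * \<Lambda>)"
    using \<phi>_increment_le_Lambda[OF s] \<Lambda> s by (simp add: ennreal_mult)
  then have "\<phi> T - \<phi> s \<le> (T - s) * \<Lambda>"
    using \<Lambda> s by (subst (asm) ennreal_le_iff) auto
  also have "\<dots> \<le> e / (\<Lambda> + 1) * \<Lambda>"
    using \<Lambda> by (intro mult_right_mono) (auto simp: s_def)
  also have "\<dots> \<le> e" using \<Lambda> e by (simp add: field_simps)
  finally show thesis using s that by blast
qed

text \<open>The left limit exists on every path. Its squared L2 distance from \<open>\<Xi> T\<close>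
  is, by Fatou, at most every eventual bound for \<open>\<phi> T - \<phi> (s n)\<close>, and these
  can be taken arbitrarily small.\<close>

lemma Xi_no_jump_T:
  assumes "Lambda_target P T \<Xi> < \<infinity>"
  shows "AE \<omega> in P. ((\<lambda>t. \<Xi> t \<omega>) \<longlongrightarrow> \<Xi> T \<omega>) (at_left T)"
proof -
  define s where "s n = T - T / real (Suc (Suc n))" for n
  have s: "0 \<le> s n" "s n < T" for n
    using horizon_pos unfolding s_def by (auto simp: field_simps)
  have s_lim: "s \<longlonglongrightarrow> T"
  proof -
    have "(\<lambda>n. T - T * inverse (real (Suc (Suc n)))) \<longlonglongrightarrow> T - T * 0"
      by (intro tendsto_intros LIMSEQ_Suc[OF LIMSEQ_inverse_real_of_nat])
    then show ?thesis unfolding s_def divide_inverse by (simp del: of_nat_Suc)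
  qed
  have s_at: "filterlim s (at_left T) sequentially"
    unfolding filterlim_at using s_lim s(2) less_imp_neq[OF s(2)] by (auto intro!: always_eventually)
  \<comment> \<open>Defined along one fixed sequence in order to be measurable; it agrees with the
    full left limit since that limit exists.\<close>
  define l where "l \<omega> = lim (\<lambda>n. \<Xi> (s n) \<omega>)" for \<omega>
  have [measurable]: "l \<in> borel_measurable P" unfolding l_def
    by (intro borel_measurable_lim_metric Xi_P) (use s less_imp_le in auto)
  have [measurable]: "\<Xi> T \<in> borel_measurable P" by (rule Xi_P[OF T_in])
  have lim: "((\<lambda>t. \<Xi> t \<omega>) \<longlongrightarrow> l \<omega>) (at_left T)" if \<omega>: "\<omega> \<in> space P" for \<omega>
  proof -
    have "T \<in> {0<..T}" using horizon_pos by simp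
    then obtain k where k: "((\<lambda>t. \<Xi> t \<omega>) \<longlongrightarrow> k) (at_left T)"
      using Xi_path[OF \<omega>] unfolding cadlag_on_def by blast
    from filterlim_compose[OF k s_at] have "l \<omega> = k" unfolding l_def by (rule limI)
    with k show ?thesis by simp
  qed
  have "(\<integral>\<^sup>+\<omega>. ennreal ((\<Xi> T \<omega> - l \<omega>)\<^sup>2) \<partial>P) \<le> ennreal e" if e: "e > 0" for e
  proof (rule nn_integral_le_limit)
    obtain r where r: "0 \<le> r" "r < T" "\<phi> T - \<phi> r \<le> e" using \<phi>_T_left_limit[OF assms e] .
    show "(\<lambda>\<omega>. ennreal ((\<Xi> T \<omega> - \<Xi> (s n) \<omega>)\<^sup>2)) \<in> borel_measurable P" for n
      using Xi_P[of "s n"] s[of n] by simp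
    show "AE \<omega> in P. (\<lambda>n. ennreal ((\<Xi> T \<omega> - \<Xi> (s n) \<omega>)\<^sup>2)) \<longlonglongrightarrow> ennreal ((\<Xi> T \<omega> - l \<omega>)\<^sup>2)"
      by (intro AE_I2 tendsto_intros filterlim_compose[OF lim s_at])
    show "eventually (\<lambda>n. (\<integral>\<^sup>+\<omega>. ennreal ((\<Xi> T \<omega> - \<Xi> (s n) \<omega>)\<^sup>2) \<partial>P) \<le> ennreal e) sequentially"
      using order_tendstoD(1)[OF s_lim r(2)]
    proof eventually_elim
      case (elim n)
      then have "\<phi> T - \<phi> (s n) \<le> e" using \<phi>_mono[of r "s n"] r s[of n] by simp
      then show ?case using s[of n] by (subst nn_Xi_increment_square) (auto intro!: ennreal_leI)
    qed
  qed
  then have "(\<integral>\<^sup>+\<omega>. ennreal ((\<Xi> T \<omega> - l \<omega>)\<^sup>2) \<partial>P) \<le> 0"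
    using ennreal_le_epsilon[of 0] by simp
  then have "AE \<omega> in P. ennreal ((\<Xi> T \<omega> - l \<omega>)\<^sup>2) = 0"
    by (subst (asm) le_zero_eq, subst (asm) nn_integral_0_iff_AE) auto
  then have "AE \<omega> in P. l \<omega> = \<Xi> T \<omega>" by eventually_elim simp
  then show ?thesis using AE_space by eventually_elim (use lim in force)
qed

text \<open>\<open>\<phi> T - \<phi> t\<close> is the \<open>\<nu>\<close>-mass of
  \<open>{t<..T}\<close>. After the integrals are exchanged, the inner one over \<open>t\<close>
  from \<open>S\<close> to \<open>r\<close> is \<open>1 / (T - r) - 1 / (T - S)\<close>; dropping
  the second term leaves the integrand of \<open>Lambda_target\<close>.\<close>

lemma weighted_increments_le_Lambda:
  assumes S: "0 \<le> S" "S < T"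
  shows "(\<integral>\<^sup>+t\<in>{S..<T}. ennreal ((\<phi> T - \<phi> t) / (T - t)\<^sup>2) \<partial>lborel) \<le> Lambda_target P T \<Xi>"
proof -
  interpret N: sigma_finite_measure \<nu>
    by (intro sigma_finite_interval_measure \<phi>_clip_mono \<phi>_clip_right_continuous)
  interpret pair_sigma_finite lborel \<nu> ..
  define h where "h t r = ennreal (1 / (T - t)\<^sup>2) * indicator {S..<T} t * (if t < r \<and> r \<le> T then 1 else 0)" for t r
  have h_meas: "case_prod h \<in> borel_measurable (lborel \<Otimes>\<^sub>M \<nu>)"
    unfolding h_def split_beta' by measurable
  have "(\<integral>\<^sup>+t\<in>{S..<T}. ennreal ((\<phi> T - \<phi> t) / (T - t)\<^sup>2) \<partial>lborel) = (\<integral>\<^sup>+t. \<integral>\<^sup>+r. h t r \<partial>\<nu> \<partial>lborel)"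
  proof (rule nn_integral_cong)
    fix t
    show "ennreal ((\<phi> T - \<phi> t) / (T - t)\<^sup>2) * indicator {S..<T} t = (\<integral>\<^sup>+r. h t r \<partial>\<nu>)"
    proof (cases "t \<in> {S..<T}")
      case True
      have "(\<integral>\<^sup>+r. h t r \<partial>\<nu>) = (\<integral>\<^sup>+r. ennreal (1 / (T - t)\<^sup>2) * indicator {t<..T} r \<partial>\<nu>)"
        using True by (intro nn_integral_cong) (auto simp: h_def indicator_def)
      also have "\<dots> = ennreal (1 / (T - t)\<^sup>2) * ennreal (\<phi> T - \<phi> t)"
        using \<nu>_Ioc[of t T] True S by (subst nn_integral_cmult_indicator) auto
      finally show ?thesis using True by (simp add: ennreal_mult'[symmetric])
    qed (simp add: h_def)
  qed
  also have "\<dots> = (\<integral>\<^sup>+r. \<integral>\<^sup>+t. h t r \<partial>lborel \<partial>\<nu>)"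
    by (rule Fubini'[OF h_meas, symmetric])
  also have "\<dots> \<le> (\<integral>\<^sup>+r. inverse (ennreal (T - r)) * indicator {0<..T} r \<partial>\<nu>)"
  proof (rule nn_integral_mono)
    fix r
    show "(\<integral>\<^sup>+t. h t r \<partial>lborel) \<le> inverse (ennreal (T - r)) * indicator {0<..T} r"
    proof (cases "S < r \<and> r \<le> T")
      case False
      then have "h t r = 0" for t by (auto simp: h_def indicator_def)
      then show ?thesis by simp
    next
      case True
      show ?thesis
      \<comment> \<open>For \<open>r = T\<close> the right-hand side is infinite; the antiderivative
        is used only below \<open>T\<close>.\<close>
      proof (cases "r = T")
        case True
        then show ?thesis using horizon_pos by (simp add: indicator_def)
      next
        case False
        with True have r: "S < r" "r < T" by auto
        have "(\<integral>\<^sup>+t. h t r \<partial>lborel) \<le> (\<integral>\<^sup>+t. ennreal (1 / (T - t)\<^sup>2) * indicator {S..r} t \<partial>lborel)"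
          by (intro nn_integral_mono) (auto simp: h_def indicator_def)
        also have "\<dots> = ennreal (1 / (T - r) - 1 / (T - S))"
        proof (rule nn_integral_FTC_Icc)
          show "((\<lambda>t. 1 / (T - t)) has_real_derivative 1 / (T - x)\<^sup>2) (at x)" if "x \<in> {S..r}" for x
            using that r by (auto intro!: derivative_eq_intros simp: power2_eq_square)
        qed (use r in auto)
        also have "\<dots> \<le> ennreal (1 / (T - r))" using r by (intro ennreal_leI) auto
        also have "\<dots> = inverse (ennreal (T - r)) * indicator {0<..T} r"
          using r S by (simp add: inverse_ennreal inverse_eq_divide)
        finally show ?thesis .
      qed
    qed
  qed
  finally show ?thesis by (simp add: Lambda_eq)
qed

end


section \<open>Deterministic integrands against the target martingale\<close>

lemma tendsto_min_at_right:
  fixes f :: "real \<Rightarrow> real"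
  assumes "\<And>t. a \<le> t \<Longrightarrow> t < b \<Longrightarrow> (f \<longlongrightarrow> f t) (at_right t)" and t: "a \<le> t" and p: "p \<le> b"
  shows "((\<lambda>s. f (min p s)) \<longlongrightarrow> f (min p t)) (at_right t)"
proof (cases "t < p")
  case True
  have "eventually (\<lambda>s. f s = f (min p s)) (at_right t)"
    unfolding eventually_at_right_field using True by (intro exI[of _ p]) auto
  moreover have "(f \<longlongrightarrow> f t) (at_right t)" using assms True by auto
  ultimately show ?thesis using True by (auto intro: Lim_transform_eventually simp: min_def)
next
  case False
  have "eventually (\<lambda>s. f p = f (min p s)) (at_right t)"
    unfolding eventually_at_right_field using False by (intro exI[of _ "t + 1"]) auto
  then show ?thesis using False by (auto intro: Lim_transform_eventually[OF tendsto_const] simp: min_def)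
qed

text \<open>Reduces an uncountable union of events to a countable one. The endpoint \<open>b\<close>
  is added to the rationals because right continuity says nothing there.\<close>

lemma right_continuous_exceeds_rational:
  fixes f :: "real \<Rightarrow> real"
  assumes f: "\<And>t. a \<le> t \<Longrightarrow> t < b \<Longrightarrow> (f \<longlongrightarrow> f t) (at_right t)"
  shows "(\<exists>t\<in>{a..b}. e < \<bar>f t\<bar>) \<longleftrightarrow> (\<exists>t\<in>insert b \<rat> \<inter> {a..b}. e < \<bar>f t\<bar>)"
proof
  assume "\<exists>t\<in>{a..b}. e < \<bar>f t\<bar>"
  then obtain t where t: "a \<le> t" "t \<le> b" "e < \<bar>f t\<bar>" by auto
  show "\<exists>t\<in>insert b \<rat> \<inter> {a..b}. e < \<bar>f t\<bar>"
  proof (cases "t = b")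
    case True
    then show ?thesis using t by auto
  next
    case False
    then have "((\<lambda>t. \<bar>f t\<bar>) \<longlongrightarrow> \<bar>f t\<bar>) (at_right t)" using f[of t] t by (intro tendsto_rabs) auto
    from order_tendstoD(1)[OF this t(3)] obtain d where d: "d > t" "\<And>x. t < x \<Longrightarrow> x < d \<Longrightarrow> e < \<bar>f x\<bar>"
      unfolding eventually_at_right_field by blast
    obtain q where q: "q \<in> \<rat>" "t < q" "q < min d b" using Rats_dense_in_real[of t "min d b"] d False t by auto
    then show ?thesis using d(2)[of q] t by (intro bexI[of _ q]) auto
  qed
qed auto

context square_integrable_target
begin

section \<open>Elementary integrals and their limits in probability\<close>

definition elementary_integral :: "(real \<Rightarrow> real) \<Rightarrow> (nat \<Rightarrow> real) \<Rightarrow> nat \<Rightarrow> 'a \<Rightarrow> real" where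
  "elementary_integral H p k \<omega> = (\<Sum>i<k. H (p i) * (\<Xi> (p (Suc i)) \<omega> - \<Xi> (p i) \<omega>))"

text \<open>All claims go through one induction, since orthogonality of the next increment to the
  sum so far already requires measurability and square integrability of that sum. The second moments
  then add up, starting from the generous bound \<open>B\<^sup>2 * \<phi> (p 0)\<close> for the
  empty sum. The last clause is orthogonality to everything known at time 0.\<close>

lemma elementary_integral_props:
  assumes p: "p 0 = 0" "\<And>i. i < k \<Longrightarrow> p i \<le> p (Suc i)" "p k \<le> T"
    and H: "\<And>t. t \<in> {0..T} \<Longrightarrow> \<bar>H t\<bar> \<le> B"
  shows "0 \<le> p k \<and> elementary_integral H p k \<in> borel_measurable (F (p k)) \<and>
    integrable P (\<lambda>\<omega>. (elementary_integral H p k \<omega>)\<^sup>2) \<and>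
    (\<integral>\<omega>. (elementary_integral H p k \<omega>)\<^sup>2 \<partial>P) \<le> B\<^sup>2 * \<phi> (p k) \<and>
    (\<forall>Z. Z \<in> borel_measurable (F 0) \<longrightarrow> integrable P (\<lambda>\<omega>. (Z \<omega>)\<^sup>2) \<longrightarrow>
       (\<integral>\<omega>. Z \<omega> * elementary_integral H p k \<omega> \<partial>P) = 0)"
  using p(2,3)
proof (induction k)
  case 0
  then show ?case using p(1) by (simp add: elementary_integral_def \<phi>_nonneg)
next
  case (Suc k)
  let ?J = "elementary_integral H p k"
  have pk: "p k \<le> p (Suc k)" "p (Suc k) \<le> T" using Suc.prems by auto
  with Suc have IH: "0 \<le> p k" "?J \<in> borel_measurable (F (p k))" "integrable P (\<lambda>\<omega>. (?J \<omega>)\<^sup>2)"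
     "(\<integral>\<omega>. (?J \<omega>)\<^sup>2 \<partial>P) \<le> B\<^sup>2 * \<phi> (p k)"
     "\<And>Z. Z \<in> borel_measurable (F 0) \<Longrightarrow> integrable P (\<lambda>\<omega>. (Z \<omega>)\<^sup>2) \<Longrightarrow> (\<integral>\<omega>. Z \<omega> * ?J \<omega> \<partial>P) = 0"
    by auto
  define h where "h = H (p k)"
  define D where "D \<omega> = \<Xi> (p (Suc k)) \<omega> - \<Xi> (p k) \<omega>" for \<omega>
  have in_T: "p k \<in> {0..T}" "p (Suc k) \<in> {0..T}" using IH(1) pk by auto
  have h: "h\<^sup>2 \<le> B\<^sup>2" using H[OF in_T(1)] unfolding h_def by (simp add: abs_le_square_iff[symmetric])
  have D2: "integrable P (\<lambda>\<omega>. (D \<omega>)\<^sup>2)" "(\<integral>\<omega>. (D \<omega>)\<^sup>2 \<partial>P) = \<phi> (p (Suc k)) - \<phi> (p k)"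
    using Xi_diff_square_integrable[of "p k" "p (Suc k)"] Xi_increment_square[OF IH(1) pk] in_T by (auto simp: D_def)
  have JD: "integrable P (\<lambda>\<omega>. ?J \<omega> * D \<omega>)" "(\<integral>\<omega>. ?J \<omega> * D \<omega> \<partial>P) = 0"
    using Xi_orthogonal[OF IH(1) pk IH(2,3)] by (auto simp: D_def)
  have step: "elementary_integral H p (Suc k) = (\<lambda>\<omega>. ?J \<omega> + h * D \<omega>)"
    by (auto simp: elementary_integral_def h_def D_def)
  have sq: "(?J \<omega> + h * D \<omega>)\<^sup>2 = (?J \<omega>)\<^sup>2 + 2 * h * (?J \<omega> * D \<omega>) + h\<^sup>2 * (D \<omega>)\<^sup>2" for \<omega>
    by (simp add: power2_eq_square algebra_simps)
  have J_meas: "?J \<in> borel_measurable (F (p (Suc k)))" by (rule F_le[OF IH(1) pk IH(2)])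
  have D_meas: "D \<in> borel_measurable (F (p (Suc k)))"
    unfolding D_def using Xi_F[OF in_T(2)] F_le[OF IH(1) pk Xi_F[OF in_T(1)]] by measurable
  have "(\<integral>\<omega>. (?J \<omega> + h * D \<omega>)\<^sup>2 \<partial>P) = (\<integral>\<omega>. (?J \<omega>)\<^sup>2 \<partial>P) + h\<^sup>2 * (\<phi> (p (Suc k)) - \<phi> (p k))"
    unfolding sq using JD D2 IH(3) by simp
  also have "\<dots> \<le> B\<^sup>2 * \<phi> (p k) + B\<^sup>2 * (\<phi> (p (Suc k)) - \<phi> (p k))"
    using IH(4) h \<phi>_mono[OF IH(1) pk] by (intro add_mono mult_right_mono) auto
  finally have "(\<integral>\<omega>. (?J \<omega> + h * D \<omega>)\<^sup>2 \<partial>P) \<le> B\<^sup>2 * \<phi> (p (Suc k))" by (simp add: algebra_simps)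
  moreover have "(\<integral>\<omega>. Z \<omega> * (?J \<omega> + h * D \<omega>) \<partial>P) = 0"
    if Z: "Z \<in> borel_measurable (F 0)" "integrable P (\<lambda>\<omega>. (Z \<omega>)\<^sup>2)" for Z
  proof -
    have Zk: "Z \<in> borel_measurable (F (p k))" using in_T by (intro F_le[OF _ _ _ Z(1)]) auto
    note ZD = Xi_orthogonal[OF IH(1) pk Zk Z(2)]
    have ZJ: "integrable P (\<lambda>\<omega>. Z \<omega> * ?J \<omega>)"
      by (rule square_integrable_mult[OF F_P[OF in_T(1) Zk] F_P[OF in_T(1) IH(2)] Z(2) IH(3)])
    have "(\<integral>\<omega>. Z \<omega> * (?J \<omega> + h * D \<omega>) \<partial>P) = (\<integral>\<omega>. Z \<omega> * ?J \<omega> + h * (Z \<omega> * D \<omega>) \<partial>P)"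
      by (simp add: algebra_simps)
    also have "\<dots> = 0" using ZJ ZD IH(5)[OF Z] by (simp add: D_def)
    finally show ?thesis .
  qed
  ultimately show ?case
    unfolding step using in_T J_meas D_meas JD D2 IH(3) by (auto simp: sq)
qed

lemma fine_partition:
  assumes "0 < d"
  obtains p :: "nat \<Rightarrow> real" and k where "p 0 = 0" "p k = T" "\<And>i. i < k \<Longrightarrow> p i \<le> p (Suc i) \<and> p (Suc i) - p i < d"
proof -
  obtain k :: nat where k: "T / d < real k" using reals_Archimedean2 by blast
  moreover have "0 < T / d" using horizon_pos assms by simp
  ultimately have k0: "0 < real k" by linarith
  then have "T / real k < d" using k assms by (simp add: field_simps)
  moreover have "real (Suc i) * T / real k - real i * T / real k = T / real k" for i
    by (simp add: algebra_simps add_divide_distrib)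
  moreover have "0 < T / real k" using k0 horizon_pos by simp
  ultimately show thesis
    using k0 by (intro that[of "\<lambda>i. real i * T / real k" k]) (auto simp: divide_right_mono horizon_pos less_imp_le)
qed

text \<open>The definition bounds \<open>measure P\<close> of an event that is an uncountable union
  over times. To descend to a single time \<open>t\<close> by monotonicity, that event must be shown
  measurable, as the measure of any other set is 0 by convention; right continuity and rational
  times provide this.\<close>

lemma stoch_integral_in_probability:
  assumes I: "is_stoch_integral P F T (\<lambda>s _. H s) \<Xi> I" and t: "t \<in> {0..T}" and e: "0 < e"
  obtains p :: "nat \<Rightarrow> real" and k where "p 0 = 0" "p k = T"
    "\<And>i. i < k \<Longrightarrow> p i \<le> p (Suc i)" "\<And>i. i \<le> k \<Longrightarrow> p i \<in> {0..T}"
    "measure P {\<omega>\<in>space P. e < \<bar>(\<Sum>i<k. H (p i) * (\<Xi> (min (p (Suc i)) t) \<omega> - \<Xi> (min (p i) t) \<omega>)) - I t \<omega>\<bar>} \<le> e"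
proof -
  obtain d where d: "0 < d" "\<And>k p. p 0 = 0 \<and> p k = T \<and> (\<forall>i<k. p i \<le> p (Suc i) \<and> p (Suc i) - p i < d) \<longrightarrow>
        measure P {\<omega>\<in>space P. \<exists>t\<in>{0..T}.
          \<bar>(\<Sum>i<k. H (p i) * (\<Xi> (min (p (Suc i)) t) \<omega> - \<Xi> (min (p i) t) \<omega>)) - I t \<omega>\<bar> > e} \<le> e"
    using I e unfolding is_stoch_integral_def by blast
  have IA: "cadlag_adapted P F T I" using I by (simp add: is_stoch_integral_def)
  have I_meas: "I s \<in> borel_measurable P" if "s \<in> {0..T}" for s
    using IA that by (intro F_P[OF that]) (auto simp: cadlag_adapted_def adapted_def)
  obtain p :: "nat \<Rightarrow> real" and k where p: "p 0 = 0" "p k = T" "\<And>i. i < k \<Longrightarrow> p i \<le> p (Suc i) \<and> p (Suc i) - p i < d"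
    using fine_partition[OF d(1)] by blast
    define X where "X t \<omega> = (\<Sum>i<k. H (p i) * (\<Xi> (min (p (Suc i)) t) \<omega> - \<Xi> (min (p i) t) \<omega>)) - I t \<omega>" for t \<omega>
    have p_mono: "p i \<le> p j" if "i \<le> j" "j \<le> k" for i j
      using that
    proof (induction rule: dec_induct)
      case (step n)
      then show ?case using p(3)[of n] by simp
    qed simp
    have p_in: "p i \<in> {0..T}" if "i \<le> k" for i using p_mono[of 0 i] p_mono[of i k] that p by auto
    have X_meas: "X s \<in> borel_measurable P" if s: "s \<in> {0..T}" for s
      unfolding X_def
    proof (intro borel_measurable_diff borel_measurable_sum borel_measurable_times borel_measurable_const I_meas[OF s] Xi_P)
      fix i assume "i \<in> {..<k}"
      then show "min (p (Suc i)) s \<in> {0..T}" "min (p i) s \<in> {0..T}" using p_in[of i] p_in[of "Suc i"] s by auto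
    qed
    have X_right: "((\<lambda>s. X s \<omega>) \<longlongrightarrow> X s \<omega>) (at_right s)" if "\<omega> \<in> space P" "0 \<le> s" "s < T" for s \<omega>
      unfolding X_def
    proof (intro tendsto_diff tendsto_sum tendsto_mult tendsto_const)
      fix i assume i: "i \<in> {..<k}"
      have R: "\<And>t. 0 \<le> t \<Longrightarrow> t < T \<Longrightarrow> ((\<lambda>s. \<Xi> s \<omega>) \<longlongrightarrow> \<Xi> t \<omega>) (at_right t)"
        using Xi_path[OF that(1)] by (auto simp: cadlag_on_def)
      show "((\<lambda>x. \<Xi> (min (p (Suc i)) x) \<omega>) \<longlongrightarrow> \<Xi> (min (p (Suc i)) s) \<omega>) (at_right s)"
        by (rule tendsto_min_at_right[OF R that(2)]) (use i p_in[of "Suc i"] in auto)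
      show "((\<lambda>x. \<Xi> (min (p i) x) \<omega>) \<longlongrightarrow> \<Xi> (min (p i) s) \<omega>) (at_right s)"
        by (rule tendsto_min_at_right[OF R that(2)]) (use i p_in[of i] in auto)
    next
      show "((\<lambda>s. I s \<omega>) \<longlongrightarrow> I s \<omega>) (at_right s)"
        using IA that by (auto simp: cadlag_adapted_def cadlag_on_def)
    qed
    have "{\<omega>\<in>space P. \<exists>t\<in>{0..T}. e < \<bar>X t \<omega>\<bar>} = {\<omega>\<in>space P. \<exists>t\<in>insert T \<rat> \<inter> {0..T}. e < \<bar>X t \<omega>\<bar>}"
    proof (intro Collect_cong conj_cong refl)
      fix \<omega> assume \<omega>: "\<omega> \<in> space P"
      show "(\<exists>t\<in>{0..T}. e < \<bar>X t \<omega>\<bar>) = (\<exists>t\<in>insert T \<rat> \<inter> {0..T}. e < \<bar>X t \<omega>\<bar>)"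
        by (rule right_continuous_exceeds_rational) (rule X_right[OF \<omega>])
    qed
    also have "\<dots> = (\<Union>s\<in>insert T \<rat> \<inter> {0..T}. {\<omega> \<in> space P. e < \<bar>X s \<omega>\<bar>})" by auto
    also have "\<dots> \<in> sets P"
    proof (rule sets.countable_UN'')
      show "countable (insert T \<rat> \<inter> {0..T})" by (intro countable_Int1 countable_insert countable_rat)
      show "{\<omega> \<in> space P. e < \<bar>X s \<omega>\<bar>} \<in> sets P" if "s \<in> insert T \<rat> \<inter> {0..T}" for s
      proof -
        have [measurable]: "X s \<in> borel_measurable P" using X_meas[of s] that by auto
        show ?thesis by measurable
      qed
    qed
    finally have M: "{\<omega>\<in>space P. \<exists>t\<in>{0..T}. e < \<bar>X t \<omega>\<bar>} \<in> sets P" .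
    have "measure P {\<omega>\<in>space P. e < \<bar>X t \<omega>\<bar>} \<le> measure P {\<omega>\<in>space P. \<exists>t\<in>{0..T}. e < \<bar>X t \<omega>\<bar>}"
      using t by (intro finite_measure_mono M) auto
    also have "\<dots> \<le> e" using d(2)[of p k] p unfolding X_def by blast
    finally show thesis using p p_in by (intro that[of p k]) (auto simp: X_def)
qed

text \<open>At time 0 every elementary sum vanishes, so convergence in probability forces the limit
  to vanish there.\<close>

lemma stoch_integral_initial:
  assumes I: "is_stoch_integral P F T (\<lambda>s _. H s) \<Xi> I"
  shows "AE \<omega> in P. I 0 \<omega> = 0"
proof -
  have T0: "0 \<in> {0..T}" using horizon_pos by simp
  have [measurable]: "I 0 \<in> borel_measurable P"
    using I T0 by (intro F_P[OF T0]) (auto simp: is_stoch_integral_def cadlag_adapted_def adapted_def)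
  have small: "measure P {\<omega>\<in>space P. e < \<bar>I 0 \<omega>\<bar>} \<le> e" if e: "0 < e" for e
  proof -
    obtain p k where "p 0 = 0" "p k = T" "\<And>i. i < k \<Longrightarrow> p i \<le> p (Suc i)"
      and p: "\<And>i. i \<le> k \<Longrightarrow> p i \<in> {0..T}" "measure P {\<omega>\<in>space P. e < \<bar>(\<Sum>i<k. H (p i) * (\<Xi> (min (p (Suc i)) 0) \<omega> - \<Xi> (min (p i) 0) \<omega>)) - I 0 \<omega>\<bar>} \<le> e"
      using stoch_integral_in_probability[OF I T0 e] by blast
    have "(\<Sum>i<k. H (p i) * (\<Xi> (min (p (Suc i)) 0) \<omega> - \<Xi> (min (p i) 0) \<omega>)) = 0" for \<omega>
    proof (intro sum.neutral ballI)
      fix i assume "i \<in> {..<k}"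
      then have "min (p (Suc i)) 0 = 0" "min (p i) 0 = 0" using p(1)[of i] p(1)[of "Suc i"] by auto
      then show "H (p i) * (\<Xi> (min (p (Suc i)) 0) \<omega> - \<Xi> (min (p i) 0) \<omega>) = 0" by simp
    qed
    then show ?thesis using p(2) by simp
  qed
  \<comment> \<open>Lowering the threshold to \<open>min e e'\<close> enlarges the event, while its
    probability is still at most \<open>e'\<close>.\<close>
  have zero: "measure P {\<omega>\<in>space P. e < \<bar>I 0 \<omega>\<bar>} \<le> 0" if e: "0 < e" for e
  proof (rule field_le_epsilon)
    fix e' :: real assume "0 < e'"
    have "measure P {\<omega>\<in>space P. e < \<bar>I 0 \<omega>\<bar>} \<le> measure P {\<omega>\<in>space P. min e e' < \<bar>I 0 \<omega>\<bar>}"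
      by (intro finite_measure_mono) auto
    also have "\<dots> \<le> 0 + e'" using small[of "min e e'"] e \<open>0 < e'\<close> by simp
    finally show "measure P {\<omega>\<in>space P. e < \<bar>I 0 \<omega>\<bar>} \<le> 0 + e'" .
  qed
  have "AE \<omega> in P. \<bar>I 0 \<omega>\<bar> \<le> 1 / real (Suc n)" for n
  proof (rule AE_I)
    show "emeasure P {\<omega>\<in>space P. 1 / real (Suc n) < \<bar>I 0 \<omega>\<bar>} = 0"
      using zero[of "1 / real (Suc n)"] by (simp add: emeasure_eq_measure measure_le_0_iff del: of_nat_Suc)
  qed auto
  then have "AE \<omega> in P. \<forall>n. \<bar>I 0 \<omega>\<bar> \<le> 1 / real (Suc n)" by (simp add: AE_all_countable del: of_nat_Suc)
  then show ?thesis
  proof eventually_elim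
    case (elim \<omega>)
    show ?case
    proof (rule ccontr)
      assume "I 0 \<omega> \<noteq> 0"
      then obtain n where "inverse (real (Suc n)) < \<bar>I 0 \<omega>\<bar>" using reals_Archimedean[of "\<bar>I 0 \<omega>\<bar>"] by auto
      with elim show False by (simp add: inverse_eq_divide not_less[symmetric] del: of_nat_Suc)
    qed
  qed
qed

text \<open>Convergence in probability carries orthogonality over from elementary sums once there is
  uniform integrability. That comes from their common second-moment bound
  \<open>B\<^sup>2 * \<phi> T\<close> and the square integrability of \<open>I T\<close>;
  boundedness of \<open>Z\<close> lets the error be measured in L1.\<close>

lemma stoch_integral_mean_zero:
  assumes I: "is_stoch_integral P F T (\<lambda>s _. H s) \<Xi> I"
    and H: "\<And>t. t \<in> {0..T} \<Longrightarrow> \<bar>H t\<bar> \<le> B"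
    and I2: "integrable P (\<lambda>\<omega>. (I T \<omega>)\<^sup>2)"
    and Z: "Z \<in> borel_measurable (F 0)" and ZK: "\<And>\<omega>. \<bar>Z \<omega>\<bar> \<le> K"
  shows "(\<integral>\<omega>. Z \<omega> * I T \<omega> \<partial>P) = 0"
proof -
  have T0: "0 \<in> {0..T}" using horizon_pos by simp
  have [measurable]: "I T \<in> borel_measurable P" "Z \<in> borel_measurable P"
    using I T0 T_in Z by (auto intro!: F_P[OF T0 Z] F_P[OF T_in] simp: is_stoch_integral_def cadlag_adapted_def adapted_def)
  have K: "0 \<le> K" using ZK[of undefined] by linarith
  have Z2: "integrable P (\<lambda>\<omega>. (Z \<omega>)\<^sup>2)"
    by (rule integrable_const_bound[of _ "K\<^sup>2"]) (use ZK K in \<open>auto simp: abs_le_square_iff[symmetric]\<close>)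
  define C where "C = 2 * B\<^sup>2 * \<phi> T + 2 * (\<integral>\<omega>. (I T \<omega>)\<^sup>2 \<partial>P)"
  have bound: "\<bar>\<integral>\<omega>. Z \<omega> * I T \<omega> \<partial>P\<bar> \<le> K * (e\<^sup>2 + e + e * C)" if e: "0 < e" for e
  proof -
    \<comment> \<open>Accuracy \<open>e\<^sup>2\<close> rather than \<open>e\<close>, because the
      probability of the bad event is later divided by \<open>e\<close>.\<close>
    have e2: "0 < e\<^sup>2" using e by simp
    obtain p k where p: "p 0 = 0" "p k = T" "\<And>i. i < k \<Longrightarrow> p i \<le> p (Suc i)"
      "\<And>i. i \<le> k \<Longrightarrow> p i \<in> {0..T}"
      "measure P {\<omega>\<in>space P. e\<^sup>2 < \<bar>(\<Sum>i<k. H (p i) * (\<Xi> (min (p (Suc i)) T) \<omega> - \<Xi> (min (p i) T) \<omega>)) - I T \<omega>\<bar>} \<le> e\<^sup>2"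
      using stoch_integral_in_probability[OF I T_in e2] by blast
    define J where "J = elementary_integral H p k"
    have J: "J \<in> borel_measurable (F T)" "integrable P (\<lambda>\<omega>. (J \<omega>)\<^sup>2)"
      "(\<integral>\<omega>. (J \<omega>)\<^sup>2 \<partial>P) \<le> B\<^sup>2 * \<phi> T" "(\<integral>\<omega>. Z \<omega> * J \<omega> \<partial>P) = 0"
      using elementary_integral_props[of p k H B] p H Z Z2 by (auto simp: J_def)
    have [measurable]: "J \<in> borel_measurable P" by (rule F_P[OF T_in J(1)])
    have "(\<Sum>i<k. H (p i) * (\<Xi> (min (p (Suc i)) T) \<omega> - \<Xi> (min (p i) T) \<omega>)) = J \<omega>" for \<omega>
      unfolding J_def elementary_integral_def
    proof (rule sum.cong)
      fix i assume "i \<in> {..<k}"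
      then have "min (p (Suc i)) T = p (Suc i)" "min (p i) T = p i" using p(4)[of i] p(4)[of "Suc i"] by auto
      then show "H (p i) * (\<Xi> (min (p (Suc i)) T) \<omega> - \<Xi> (min (p i) T) \<omega>) = H (p i) * (\<Xi> (p (Suc i)) \<omega> - \<Xi> (p i) \<omega>)"
        by simp
    qed simp
    then have prob: "measure P {\<omega>\<in>space P. e\<^sup>2 < \<bar>J \<omega> - I T \<omega>\<bar>} \<le> e\<^sup>2" using p(5) by simp
    define A where "A = {\<omega>\<in>space P. e\<^sup>2 < \<bar>J \<omega> - I T \<omega>\<bar>}"
    have [measurable]: "A \<in> sets P" unfolding A_def by measurable
    have iJ: "integrable P (\<lambda>\<omega>. Z \<omega> * J \<omega>)" and iI: "integrable P (\<lambda>\<omega>. Z \<omega> * I T \<omega>)"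
      using square_integrable_mult[of Z P J] square_integrable_mult[of Z P "I T"] Z2 J(2) I2 by auto
    have sq: "integrable P (\<lambda>\<omega>. 2 * (J \<omega>)\<^sup>2 + 2 * (I T \<omega>)\<^sup>2)" using J(2) I2 by auto
    \<comment> \<open>Off \<open>A\<close> the difference is at most \<open>e\<^sup>2\<close>. On
      \<open>A\<close> Young's inequality splits it into \<open>1 / e\<close> and \<open>e\<close>
      times its square; the first part integrates to at most \<open>e\<close>, the second is small
      by the second-moment bounds.\<close>
    have pt: "\<bar>Z \<omega> * (J \<omega> - I T \<omega>)\<bar> \<le> K * (e\<^sup>2 + (indicator A \<omega> / e + e * (2 * (J \<omega>)\<^sup>2 + 2 * (I T \<omega>)\<^sup>2)))"
      if "\<omega> \<in> space P" for \<omega>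
    proof -
      define x where "x = J \<omega> - I T \<omega>"
      have "\<bar>x\<bar> \<le> e\<^sup>2 + (indicator A \<omega> / e + e * x\<^sup>2)"
      proof (cases "e\<^sup>2 < \<bar>x\<bar>")
        case True
        have "0 \<le> (e * \<bar>x\<bar> - 1)\<^sup>2 + e * \<bar>x\<bar>" using e by simp
        then have "e * \<bar>x\<bar> \<le> 1 + e\<^sup>2 * x\<^sup>2" by (simp add: power2_eq_square algebra_simps)
        then have "\<bar>x\<bar> \<le> (1 + e\<^sup>2 * x\<^sup>2) / e" using e by (simp add: field_simps)
        also have "\<dots> = 1 / e + e * x\<^sup>2" using e by (simp add: field_simps power2_eq_square)
        moreover have "indicator A \<omega> = (1::real)" using True that by (simp add: A_def x_def)
        ultimately show ?thesis using e by (smt (verit) zero_le_power2)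
      next
        case False
        then show ?thesis using e by (simp add: add_increasing2)
      qed
      also have "x\<^sup>2 \<le> 2 * (J \<omega>)\<^sup>2 + 2 * (I T \<omega>)\<^sup>2"
        using sum_squares_ge_zero[of "J \<omega> + I T \<omega>" 0] unfolding x_def by (simp add: power2_eq_square algebra_simps)
      finally have "\<bar>x\<bar> \<le> e\<^sup>2 + (indicator A \<omega> / e + e * (2 * (J \<omega>)\<^sup>2 + 2 * (I T \<omega>)\<^sup>2))" using e by simp
      then show ?thesis using ZK[of \<omega>] K unfolding abs_mult x_def[symmetric] by (intro mult_mono) auto
    qed
    have "\<bar>\<integral>\<omega>. Z \<omega> * I T \<omega> \<partial>P\<bar> = \<bar>\<integral>\<omega>. Z \<omega> * (J \<omega> - I T \<omega>) \<partial>P\<bar>"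
      using iJ iI J(4) by (simp add: right_diff_distrib)
    also have "\<dots> \<le> (\<integral>\<omega>. \<bar>Z \<omega> * (J \<omega> - I T \<omega>)\<bar> \<partial>P)" by (rule integral_abs_bound)
    also have "\<dots> \<le> (\<integral>\<omega>. K * (e\<^sup>2 + (indicator A \<omega> / e + e * (2 * (J \<omega>)\<^sup>2 + 2 * (I T \<omega>)\<^sup>2))) \<partial>P)"
      using iJ iI sq pt by (intro integral_mono) (auto simp: right_diff_distrib emeasure_eq_measure intro!: integrable_abs)
    also have "\<dots> = K * (e\<^sup>2 + (measure P A / e + e * (2 * (\<integral>\<omega>. (J \<omega>)\<^sup>2 \<partial>P) + 2 * (\<integral>\<omega>. (I T \<omega>)\<^sup>2 \<partial>P))))"
      using J(2) I2 sq by (simp add: prob_space emeasure_eq_measure)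
    also have "\<dots> \<le> K * (e\<^sup>2 + (e + e * C))"
    proof (intro mult_left_mono add_mono K order_refl)
      show "measure P A / e \<le> e" using prob e by (simp add: A_def field_simps power2_eq_square)
      show "2 * (\<integral>\<omega>. (J \<omega>)\<^sup>2 \<partial>P) + 2 * (\<integral>\<omega>. (I T \<omega>)\<^sup>2 \<partial>P) \<le> C" using J(3) by (simp add: C_def)
    qed (use e in auto)
    finally show ?thesis by (simp add: add.assoc)
  qed
  have "((\<lambda>e. K * (e\<^sup>2 + e + e * C)) \<longlongrightarrow> K * (0\<^sup>2 + 0 + 0 * C)) (at_right 0)"
    by (intro tendsto_intros)
  moreover have "eventually (\<lambda>e. \<bar>\<integral>\<omega>. Z \<omega> * I T \<omega> \<partial>P\<bar> \<le> K * (e\<^sup>2 + e + e * C)) (at_right 0)"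
    using bound by (auto simp: eventually_at_right_field intro!: exI[of _ 1])
  ultimately have "\<bar>\<integral>\<omega>. Z \<omega> * I T \<omega> \<partial>P\<bar> \<le> K * (0\<^sup>2 + 0 + 0 * C)"
    by (rule tendsto_lowerbound) simp
  then show ?thesis by simp
qed

text \<open>Truncating \<open>Z\<close> makes the cross term with the stochastic integral vanish.\<close>

lemma nn_square_le_add_stoch_integral:
  assumes I: "is_stoch_integral P F T (\<lambda>s _. H s) \<Xi> I"
    and H: "\<And>t. t \<in> {0..T} \<Longrightarrow> \<bar>H t\<bar> \<le> B"
    and Z: "Z \<in> borel_measurable (F 0)" and Z2: "integrable P (\<lambda>\<omega>. (Z \<omega>)\<^sup>2)"
  shows "second_moment Z \<le> (\<integral>\<^sup>+\<omega>. ennreal ((Z \<omega> + I T \<omega>)\<^sup>2) \<partial>P)"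
\<comment> \<open>An infinite right-hand side is trivial. A finite one yields the square
  integrability of \<open>I T\<close>, by subtracting \<open>Z\<close>.\<close>
proof (cases "(\<integral>\<^sup>+\<omega>. ennreal ((Z \<omega> + I T \<omega>)\<^sup>2) \<partial>P) = \<infinity>")
  case False
  have T0: "0 \<in> {0..T}" using horizon_pos by simp
  have [measurable]: "I T \<in> borel_measurable P" "Z \<in> borel_measurable P"
    using I T0 T_in Z by (auto intro!: F_P[OF T0 Z] F_P[OF T_in] simp: is_stoch_integral_def cadlag_adapted_def adapted_def)
  define N where "N \<omega> = Z \<omega> + I T \<omega>" for \<omega>
  have [measurable]: "N \<in> borel_measurable P" unfolding N_def by measurable
  have N2: "integrable P (\<lambda>\<omega>. (N \<omega>)\<^sup>2)"
    using False by (intro integrableI_nonneg) (auto simp: N_def top.not_eq_extremum)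
  have "integrable P (\<lambda>\<omega>. (N \<omega>)\<^sup>2 + (Z \<omega>)\<^sup>2 - 2 * (N \<omega> * Z \<omega>))"
    using N2 Z2 by (intro Bochner_Integration.integrable_diff Bochner_Integration.integrable_add
      integrable_mult_right square_integrable_mult) auto
  then have I2: "integrable P (\<lambda>\<omega>. (I T \<omega>)\<^sup>2)"
    by (rule back_subst[of "integrable P"]) (auto simp: N_def power2_eq_square algebra_simps)
  define Zk where "Zk k \<omega> = (if \<bar>Z \<omega>\<bar> \<le> real k then Z \<omega> else 0)" for k :: nat and \<omega>
  have Zk_meas: "Zk k \<in> borel_measurable (F 0)" for k unfolding Zk_def using Z by measurable
  have [measurable]: "Zk k \<in> borel_measurable P" for k by (rule F_P[OF T0 Zk_meas])
  have le: "second_moment (Zk k) \<le> second_moment N" for k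
  proof -
    have Zk2: "integrable P (\<lambda>\<omega>. (Zk k \<omega>)\<^sup>2)"
      by (rule Bochner_Integration.integrable_bound[OF Z2]) (auto simp: Zk_def)
    have zero: "(\<integral>\<omega>. Zk k \<omega> * I T \<omega> \<partial>P) = 0"
      by (rule stoch_integral_mean_zero[OF I H I2 Zk_meas, where K = "real k"]) (auto simp: Zk_def)
    have ZkI: "integrable P (\<lambda>\<omega>. Zk k \<omega> * I T \<omega>)"
      by (rule square_integrable_mult) (use Zk2 I2 in auto)
    have "(\<integral>\<omega>. (Zk k \<omega>)\<^sup>2 \<partial>P) = (\<integral>\<omega>. (Zk k \<omega>)\<^sup>2 + 2 * (Zk k \<omega> * I T \<omega>) \<partial>P)"
      using Zk2 ZkI zero by simp
    also have "\<dots> \<le> (\<integral>\<omega>. (N \<omega>)\<^sup>2 \<partial>P)"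
    proof (rule integral_mono)
      \<comment> \<open>\<open>Zk k\<close> equals \<open>Z\<close> or 0 at each point, so
        \<open>Zk k * (Z - Zk k)\<close> vanishes and completing the square leaves only a
        nonnegative remainder.\<close>
      fix \<omega>
      have "(N \<omega>)\<^sup>2 - ((Zk k \<omega>)\<^sup>2 + 2 * (Zk k \<omega> * I T \<omega>)) = (N \<omega> - Zk k \<omega>)\<^sup>2 + 2 * (Zk k \<omega> * (Z \<omega> - Zk k \<omega>))"
        by (simp add: N_def power2_eq_square algebra_simps)
      moreover have "Zk k \<omega> * (Z \<omega> - Zk k \<omega>) = 0" by (simp add: Zk_def)
      ultimately show "(Zk k \<omega>)\<^sup>2 + 2 * (Zk k \<omega> * I T \<omega>) \<le> (N \<omega>)\<^sup>2"
        using zero_le_power2[of "N \<omega> - Zk k \<omega>"] by linarith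
    qed (use Zk2 ZkI N2 in auto)
    finally show ?thesis using Zk2 N2 by (simp add: nn_integral_eq_integral ennreal_leI)
  qed
  have "second_moment Z \<le> second_moment N"
  proof (rule nn_integral_le_limit)
    show "(\<lambda>\<omega>. ennreal ((Zk k \<omega>)\<^sup>2)) \<in> borel_measurable P" for k by measurable
    show "AE \<omega> in P. (\<lambda>k. ennreal ((Zk k \<omega>)\<^sup>2)) \<longlonglongrightarrow> ennreal ((Z \<omega>)\<^sup>2)"
    proof (rule AE_I2)
      fix \<omega>
      obtain n where n: "\<bar>Z \<omega>\<bar> \<le> real n" using real_arch_simple by blast
      have "eventually (\<lambda>k. ennreal ((Z \<omega>)\<^sup>2) = ennreal ((Zk k \<omega>)\<^sup>2)) sequentially"
        using eventually_ge_at_top[of n] by eventually_elim (use n in \<open>auto simp: Zk_def\<close>)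
      then show "(\<lambda>k. ennreal ((Zk k \<omega>)\<^sup>2)) \<longlonglongrightarrow> ennreal ((Z \<omega>)\<^sup>2)"
        by (rule Lim_transform_eventually[OF tendsto_const])
    qed
  qed (use le in auto)
  then show ?thesis by (simp add: N_def)
qed auto

end


section \<open>Coefficients and the initial value of the optimal strategy\<close>

lemma set_integral_point_zero: "(LINT s:{a::real}|lborel. f s :: real) = 0"
  unfolding set_lebesgue_integral_def
  by (rule integral_eq_zero_AE, use AE_lborel_singleton[of a] in eventually_elim) (simp add: indicator_def)

lemma abs_continuous_on_imp_continuous_on:
  assumes "abs_continuous_on a b f"
  shows "continuous_on {a..b} f"
  unfolding continuous_on_iff
proof (intro ballI allI impI)
  fix x e :: real assume x: "x \<in> {a..b}" and e: "0 < e"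
  obtain d where d: "0 < d" "\<And>D s. D division_of s \<Longrightarrow> s \<subseteq> {a..b} \<Longrightarrow> (\<Sum>k\<in>D. Sup k - Inf k) < d
        \<Longrightarrow> (\<Sum>k\<in>D. \<bar>f (Sup k) - f (Inf k)\<bar>) < e"
    using assms[unfolded abs_continuous_on_def, rule_format, OF e] by blast
  have *: "\<bar>f v - f u\<bar> < e" if "u \<in> {a..b}" "v \<in> {a..b}" "u \<le> v" "v - u < d" for u v
  proof -
    have "{{u..v}} division_of {u..v}"
      using division_of_self[of u v] that by simp
    from d(2)[OF this] show ?thesis using that by auto
  qed
  have "dist (f y) (f x) < e" if "y \<in> {a..b}" "dist y x < d" for y
    using *[of x y] *[of y x] x that by (cases "x \<le> y") (auto simp: dist_real_def abs_minus_commute)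
  with d(1) show "\<exists>d>0. \<forall>x'\<in>{a..b}. dist x' x < d \<longrightarrow> dist (f x') (f x) < e" by blast
qed

lemma continuous_on_imp_cadlag_on:
  fixes f :: "real \<Rightarrow> real"
  assumes "continuous_on {a..b} f"
  shows "cadlag_on a b f"
  unfolding cadlag_on_def
proof (intro conjI ballI)
  fix t assume t: "t \<in> {a..<b}"
  then have "(f \<longlongrightarrow> f t) (at t within {a..b})" using assms by (auto simp: continuous_on_def)
  then have "(f \<longlongrightarrow> f t) (at t within {t..b})" by (rule tendsto_within_subset) (use t in auto)
  then show "(f \<longlongrightarrow> f t) (at_right t)" using t by (simp add: at_within_Icc_at_right)
next
  fix t assume t: "t \<in> {a<..b}"
  then have "(f \<longlongrightarrow> f t) (at t within {a..b})" using assms by (auto simp: continuous_on_def)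
  then have "(f \<longlongrightarrow> f t) (at t within {a..t})" by (rule tendsto_within_subset) (use t in auto)
  then show "\<exists>l. (f \<longlongrightarrow> l) (at_left t)" using t by (auto simp: at_within_Icc_at_left)
qed

locale coefficient_setup =
  fixes T :: real and \<beta> lam dlam :: "real \<Rightarrow> real"
  assumes T_pos: "0 < T" and coeff: "coefficients T \<beta> lam dlam"
begin

lemma cadlag_coefficients: "cadlag_on 0 T \<beta>" "cadlag_on 0 T dlam" "cadlag_on 0 T lam"
  using coeff by (auto simp: coefficients_def intro: continuous_on_imp_cadlag_on abs_continuous_on_imp_continuous_on)

lemma lam_pos: "t \<in> {0..T} \<Longrightarrow> 0 < lam t"
  using coeff by (auto simp: coefficients_def)

lemma denominator_pos: "t \<in> {0..T} \<Longrightarrow> 0 < 2 * \<beta> t + dgam lam dlam t"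
  using coeff unfolding coefficients_def by force

lemma dtheta_nonneg: "t \<in> {0..T} \<Longrightarrow> 0 \<le> dtheta \<beta> lam dlam t"
  using lam_pos[of t] denominator_pos[of t] unfolding dtheta_def by (intro divide_nonneg_pos mult_pos_pos) auto

text \<open>Cadlag functions on a compact interval are bounded, and the denominator is bounded below
  by the constants in the coefficient assumptions. Integrability makes \<open>theta\<close> a
  genuine integral, hence monotone.\<close>

lemma dtheta_integrable: "set_integrable lborel {0..T} (dtheta \<beta> lam dlam)"
proof -
  obtain B1 where B1: "\<And>t. t \<in> {0..T} \<Longrightarrow> \<bar>\<beta> t\<bar> \<le> B1" using cadlag_on_bounded[OF cadlag_coefficients(1)] by blast
  obtain B2 where B2: "\<And>t. t \<in> {0..T} \<Longrightarrow> \<bar>dlam t\<bar> \<le> B2" using cadlag_on_bounded[OF cadlag_coefficients(2)] by blast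
  obtain c1 where c1: "0 < c1" "\<And>t. t \<in> {0..T} \<Longrightarrow> c1 \<le> lam t" using coeff unfolding coefficients_def by blast
  obtain c2 where c2: "0 < c2" "\<And>t. t \<in> {0..T} \<Longrightarrow> c2 < 2 * \<beta> t + dgam lam dlam t"
    using coeff unfolding coefficients_def by blast
  let ?B = "(B1 + B2 / c1)\<^sup>2 / (c1 * c2)"
  have bound: "\<bar>dtheta \<beta> lam dlam t\<bar> \<le> ?B" if t: "t \<in> {0..T}" for t
  proof -
    have "\<bar>dgam lam dlam t\<bar> \<le> B2 / c1"
      using B2[OF t] c1(1) c1(2)[OF t] unfolding dgam_def abs_divide by (intro frac_le) auto
    then have "\<bar>\<beta> t + dgam lam dlam t\<bar> \<le> B1 + B2 / c1" using B1[OF t] by linarith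
    then have "(\<beta> t + dgam lam dlam t)\<^sup>2 \<le> (B1 + B2 / c1)\<^sup>2"
      by (metis abs_ge_zero power2_abs power_mono)
    moreover have "c1 * c2 \<le> lam t * (2 * \<beta> t + dgam lam dlam t)"
      using c1(2)[OF t] c2(2)[OF t] c1(1) c2(1) by (intro mult_mono) auto
    ultimately have "dtheta \<beta> lam dlam t \<le> ?B"
      unfolding dtheta_def using c1(1) c2(1) by (intro frac_le) auto
    then show ?thesis using dtheta_nonneg[OF t] by simp
  qed
  let ?c = "\<lambda>t. max 0 (min T t)"
  note [measurable] = cadlag_coefficients[THEN cadlag_on_clip_measurable, OF less_imp_le[OF T_pos]]
  have "(\<lambda>t. dtheta \<beta> lam dlam (?c t)) \<in> borel_measurable borel"
    unfolding dtheta_def dgam_def by measurable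
  then have "(\<lambda>t. indicator {0..T} t *\<^sub>R dtheta \<beta> lam dlam (?c t)) \<in> borel_measurable lborel" by simp
  then have m: "(\<lambda>t. indicator {0..T} t *\<^sub>R dtheta \<beta> lam dlam t) \<in> borel_measurable lborel"
    by (rule back_subst[of "\<lambda>f. f \<in> borel_measurable lborel"]) (auto simp: indicator_def fun_eq_iff)
  have "integrable lborel (\<lambda>t. indicator {0..T} t *\<^sub>R ?B)"
    by (intro integrable_scaleR_left integrable_real_indicator) (auto simp: emeasure_lborel_Icc_eq)
  then show ?thesis unfolding set_integrable_def
  proof (rule Bochner_Integration.integrable_bound[OF _ m])
    show "AE t in lborel. norm (indicator {0..T} t *\<^sub>R dtheta \<beta> lam dlam t) \<le> norm (indicator {0..T} t *\<^sub>R ?B)"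
    proof (rule AE_I2)
      fix t
      show "norm (indicator {0..T} t *\<^sub>R dtheta \<beta> lam dlam t) \<le> norm (indicator {0..T} t *\<^sub>R ?B)"
        using order_trans[OF bound abs_ge_self, of t] by (cases "t \<in> {0..T}") auto
    qed
  qed
qed

lemma theta_mono: assumes "t \<in> {0..T}" shows "theta \<beta> lam dlam t \<le> theta \<beta> lam dlam T"
  unfolding theta_def set_lebesgue_integral_def
proof (rule integral_mono)
  show "integrable lborel (\<lambda>s. indicator {0..t} s *\<^sub>R dtheta \<beta> lam dlam s)"
    using set_integrable_subset[OF dtheta_integrable, of "{0..t}"] assms by (simp add: set_integrable_def)
  show "integrable lborel (\<lambda>s. indicator {0..T} s *\<^sub>R dtheta \<beta> lam dlam s)"
    using dtheta_integrable by (simp add: set_integrable_def)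
qed (use assms dtheta_nonneg in \<open>auto simp: indicator_def\<close>)

text \<open>\<open>theta\<close> is nondecreasing, so the denominator is at least 1.\<close>

lemma opt_integrand_bounded: assumes "t \<in> {0..T}" shows "\<bar>opt_integrand T \<beta> lam dlam t\<bar> \<le> lam T"
proof -
  have l: "0 < lam T" using lam_pos T_pos by simp
  have "0 \<le> lam T * (theta \<beta> lam dlam T - theta \<beta> lam dlam t)" using theta_mono[OF assms] l by simp
  then show ?thesis using l unfolding opt_integrand_def by (auto simp: divide_le_eq abs_divide mult_le_cancel_left1)
qed

text \<open>An essential supremum ignores the point 0, but right continuity would spread a value
  exceeding it to an interval to the right of 0, which has positive measure.\<close>

lemma eta_div_lam_initial_le_A_alpha:
  "ennreal \<bar>eta \<beta> lam dlam 0 / lam 0\<bar> \<le> A_alpha T \<beta> lam dlam"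
proof (rule ccontr)
  let ?f = "\<lambda>t. \<bar>eta \<beta> lam dlam t / lam t\<bar>"
  assume "\<not> ?thesis"
  then have less: "A_alpha T \<beta> lam dlam < ennreal (?f 0)" by simp
  have z: "0 \<in> {0..<T}" "0 \<in> {0..T}" using T_pos by auto
  have lim: "(\<beta> \<longlongrightarrow> \<beta> 0) (at_right 0)" "(dlam \<longlongrightarrow> dlam 0) (at_right 0)" "(lam \<longlongrightarrow> lam 0) (at_right 0)"
    using cadlag_coefficients z(1) unfolding cadlag_on_def by blast+
  have l0: "lam 0 \<noteq> 0" "2 * \<beta> 0 + dgam lam dlam 0 \<noteq> 0"
    using lam_pos[OF z(2)] denominator_pos[OF z(2)] by auto
  have dg: "(dgam lam dlam \<longlongrightarrow> dgam lam dlam 0) (at_right 0)"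
    using l0 unfolding dgam_def by (intro tendsto_divide lim) 
  have "(?f \<longlongrightarrow> ?f 0) (at_right 0)"
    unfolding eta_def by (intro tendsto_rabs tendsto_divide tendsto_add tendsto_mult tendsto_const lim dg l0)
  then have "((\<lambda>t. ennreal (?f t)) \<longlongrightarrow> ennreal (?f 0)) (at_right 0)" by (rule tendsto_ennrealI)
  from order_tendstoD(1)[OF this less] obtain d where d: "0 < d" "\<And>t. 0 < t \<Longrightarrow> t < d \<Longrightarrow> A_alpha T \<beta> lam dlam < ennreal (?f t)"
    unfolding eventually_at_right_field by blast
  have "AE t in restrict_space lborel {0<..<T}. ennreal (?f t) \<le> A_alpha T \<beta> lam dlam"
    unfolding A_alpha_def by (rule esssup_AE)
  then have "AE t in lborel. t \<in> {0<..<T} \<longrightarrow> ennreal (?f t) \<le> A_alpha T \<beta> lam dlam"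
    by (subst (asm) AE_restrict_space_iff) auto
  then have "AE t in lborel. t \<notin> {0<..<min d T}"
    by eventually_elim (use d(2) in \<open>auto simp: not_less[symmetric]\<close>)
  then have "emeasure lborel {t \<in> space lborel. \<not> t \<notin> {0<..<min d T}} = 0"
    by (subst (asm) AE_iff_measurable[OF _ refl]) auto
  moreover have "{t \<in> space lborel. \<not> t \<notin> {0<..<min d T}} = {0<..<min d T}" by auto
  ultimately have "emeasure lborel {0<..<min d T} = 0" by metis
  then show False using d(1) T_pos by (simp add: min_def split: if_splits)
qed

end

text \<open>At time 0 the drift integral in the representation vanishes and \<open>I 0 = 0\<close>
  almost surely, so \<open>Q0 0\<close> is an affine function of \<open>Z\<close>, the initial value
  of \<open>M\<close>. By orthogonality, the second moment of \<open>Z\<close> is at most that of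
  \<open>M T\<close>. The factors 2 come from squaring a difference.\<close>

lemma (in square_integrable_target) initial_value_le_C0:
  assumes coeff: "coefficients T \<beta> lam dlam"
    and I: "is_stoch_integral P F T (\<lambda>s _. opt_integrand T \<beta> lam dlam s) \<Xi> I"
    and M: "M = opt_martingale T \<beta> lam dlam y \<Xi> I"
    and rep: "optimal_representation P T \<beta> lam dlam y \<Xi> M Q0"
  shows "second_moment (Q0 0) \<le> C0_const P T \<beta> lam dlam y M"
proof -
  interpret coefficient_setup T \<beta> lam dlam by unfold_locales (use coeff horizon_pos in auto)
  have T0: "0 \<in> {0..T}" "0 \<in> {0..<T}" using horizon_pos by auto
  define Z where "Z \<omega> = lam T / (1 + lam T * theta \<beta> lam dlam T) * (\<Xi> 0 \<omega> + y / lam 0)" for \<omega>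
  have Z: "Z \<in> borel_measurable (F 0)" using Xi_F[OF T0(1)] unfolding Z_def by measurable
  have [measurable]: "Z \<in> borel_measurable P" by (rule F_P[OF T0(1) Z])
  have "integrable P (\<Xi> 0)"
    using square_integrable_imp_integrable[OF Xi_P[OF T0(1)] Xi_square[OF T0(1)]] .
  then have Z2: "integrable P (\<lambda>\<omega>. (Z \<omega>)\<^sup>2)"
    using Xi_square[OF T0(1)] by (auto simp: Z_def power_mult_distrib power2_sum power_divide mult.assoc
        intro!: integrable_mult_right Bochner_Integration.integrable_add)
  have M_eq: "M t \<omega> = Z \<omega> + I t \<omega>" for t \<omega> by (simp add: M opt_martingale_def Z_def)
  have ZM: "second_moment Z \<le> second_moment (M T)"
    unfolding M_eq by (rule nn_square_le_add_stoch_integral[OF I opt_integrand_bounded Z Z2])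
  define a where "a = eta \<beta> lam dlam 0 / lam 0"
  define A where "A = A_alpha T \<beta> lam dlam"
  have aA: "ennreal (a\<^sup>2) \<le> A\<^sup>2"
  proof -
    have "ennreal \<bar>a\<bar> ^ 2 \<le> A ^ 2"
      using eta_div_lam_initial_le_A_alpha unfolding a_def A_def by (rule power_mono) simp
    then show ?thesis by (simp add: ennreal_power)
  qed
  have "second_moment (Q0 0) \<le> (\<integral>\<^sup>+\<omega>. 2 * ennreal (a\<^sup>2) * ennreal ((Z \<omega>)\<^sup>2) + ennreal (2 * y\<^sup>2 / (lam 0)\<^sup>2) \<partial>P)"
  proof (rule nn_integral_mono_AE)
    have "AE \<omega> in P. Q0 0 \<omega> = a * M 0 \<omega> - y / lam 0"
      using rep unfolding optimal_representation_def
    proof eventually_elim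
      case (elim \<omega>)
      then have "Q0 0 \<omega> = eta \<beta> lam dlam 0 / lam 0 * M 0 \<omega> - y / lam 0
            + (LINT s:{0..0}|lborel. dtheta \<beta> lam dlam s * M s \<omega>)"
        using T0(2) by blast
      then show ?case by (simp add: a_def set_integral_point_zero)
    qed
    with stoch_integral_initial[OF I]
    show "AE \<omega> in P. ennreal ((Q0 0 \<omega>)\<^sup>2) \<le> 2 * ennreal (a\<^sup>2) * ennreal ((Z \<omega>)\<^sup>2) + ennreal (2 * y\<^sup>2 / (lam 0)\<^sup>2)"
    proof eventually_elim
      case (elim \<omega>)
      have "(a * Z \<omega> - y / lam 0)\<^sup>2 \<le> 2 * (a * Z \<omega>)\<^sup>2 + 2 * (y / lam 0)\<^sup>2"
        using zero_le_power2[of "a * Z \<omega> + y / lam 0"] unfolding power2_diff power2_sum by linarith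
      then have "(Q0 0 \<omega>)\<^sup>2 \<le> 2 * (a\<^sup>2 * (Z \<omega>)\<^sup>2) + 2 * y\<^sup>2 / (lam 0)\<^sup>2"
        using elim by (simp add: M_eq power_mult_distrib power_divide)
      then have "ennreal ((Q0 0 \<omega>)\<^sup>2) \<le> ennreal (2 * (a\<^sup>2 * (Z \<omega>)\<^sup>2) + 2 * y\<^sup>2 / (lam 0)\<^sup>2)" by (rule ennreal_leI)
      then show ?case by (simp add: ennreal_plus ennreal_mult mult.assoc)
    qed
  qed
  also have "\<dots> = 2 * ennreal (a\<^sup>2) * second_moment Z + ennreal (2 * y\<^sup>2 / (lam 0)\<^sup>2)"
    by (subst nn_integral_add) (auto simp: nn_integral_cmult emeasure_space_1)
  also have "\<dots> \<le> 2 * A\<^sup>2 * second_moment (M T) + ennreal (2 * y\<^sup>2 / (lam 0)\<^sup>2)"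
    by (intro add_mono mult_mono aA ZM) auto
  finally show ?thesis by (simp add: C0_const_def A_def)
qed


section \<open>The first phase\<close>

text \<open>The density of the standard exponential law. \<open>Qbar\<close> averages
  \<open>Q0\<close> over the lags \<open>\<delta> * s\<close> with this density: mass 1 allows
  Jensen's inequality, and mean 1 turns a bound linear in the lag into a multiple of
  \<open>\<delta>\<close>.\<close>

abbreviation expw :: "real \<Rightarrow> real" where "expw s \<equiv> indicator {0..} s * exp (- s)"

lemma nn_integral_expw: "(\<integral>\<^sup>+s. ennreal (expw s) \<partial>lborel) = 1"
proof -
  have "(\<integral>\<^sup>+s. ennreal (expw s) \<partial>lborel) = (\<integral>\<^sup>+s. ennreal (s ^ 0 * exp (- s)) * indicator {0..} s \<partial>lborel)"
    by (intro nn_integral_cong) (auto simp: indicator_def)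
  also have "\<dots> = 1" by (subst nn_intergal_power_times_exp_Ici) simp
  finally show ?thesis .
qed

lemma nn_integral_expw_first_moment: "(\<integral>\<^sup>+s. ennreal (expw s) * ennreal s \<partial>lborel) = 1"
proof -
  have "(\<integral>\<^sup>+s. ennreal (expw s) * ennreal s \<partial>lborel) = (\<integral>\<^sup>+s. ennreal (s ^ 1 * exp (- s)) * indicator {0..} s \<partial>lborel)"
    by (intro nn_integral_cong) (auto simp: indicator_def ennreal_mult[symmetric] mult.commute)
  also have "\<dots> = 1" by (subst nn_intergal_power_times_exp_Ici) simp
  finally show ?thesis .
qed

lemma integrable_expw: "integrable lborel expw"
  using nn_integral_expw by (intro integrableI_nonneg) (auto simp: top.not_eq_extremum[symmetric])

lemma integral_expw: "(\<integral>s. expw s \<partial>lborel) = 1"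
  using nn_integral_eq_integral[OF integrable_expw] nn_integral_expw by (simp add: ennreal_eq_1)

text \<open>Memorylessness: shifting the density by \<open>a\<close> multiplies it by
  \<open>exp a\<close>. The half-line is open because it will be the complement of the lags up to
  \<open>t / \<delta>\<close>.\<close>

lemma integral_expw_greaterThan:
  fixes a :: real
  assumes "0 \<le> a"
  shows "(\<integral>s. indicator {a<..} s * exp (- s) \<partial>lborel) = exp (- a)"
proof -
  have "(\<integral>s. expw s \<partial>lborel) = \<bar>1\<bar> *\<^sub>R (\<integral>s. expw (- a + 1 * s) \<partial>lborel)"
    by (rule lborel_integral_real_affine) simp
  also have "\<dots> = (\<integral>s. exp a * (indicator {a..} s * exp (- s)) \<partial>lborel)"
  proof -
    have "expw (- a + 1 * s) = exp a * (indicator {a..} s * exp (- s))" for s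
      by (auto simp: indicator_def exp_add[symmetric])
    then show ?thesis by simp
  qed
  also have "\<dots> = exp a * (\<integral>s. indicator {a..} s * exp (- s) \<partial>lborel)" by simp
  also have "(\<integral>s. indicator {a..} s * exp (- s) \<partial>lborel) = (\<integral>s. indicator {a<..} s * exp (- s) \<partial>lborel)"
    by (rule integral_cong_AE, simp, simp, use AE_lborel_singleton[of a] in eventually_elim) (auto simp: indicator_def)
  finally have X: "1 = exp a * (\<integral>s. indicator {a<..} s * exp (- s) \<partial>lborel)" unfolding integral_expw .
  have "exp (- a) * (exp a * x) = x" for x :: real by (simp add: mult.assoc[symmetric] exp_add[symmetric])
  from this[of "\<integral>s. indicator {a<..} s * exp (- s) \<partial>lborel", folded X] show ?thesis by (simp only: mult_1_right)
qed

text \<open>Cauchy-Schwarz with the weight distributed as \<open>sqrt\<close> times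
  \<open>sqrt\<close>. If the integral on the left does not exist, it is 0 by convention and the
  bound is trivial.\<close>

lemma expw_Jensen:
  fixes g :: "real \<Rightarrow> real"
  assumes [measurable]: "g \<in> borel_measurable borel"
  shows "ennreal ((\<integral>s. expw s * g s \<partial>lborel)\<^sup>2) \<le> (\<integral>\<^sup>+s. ennreal (expw s) * ennreal ((g s)\<^sup>2) \<partial>lborel)"
proof -
  let ?r = "\<lambda>s. ennreal (sqrt (expw s))"
  have sq: "?r s * ?r s = ennreal (expw s)" for s by (simp add: ennreal_mult[symmetric])
  have "ennreal \<bar>\<integral>s. expw s * g s \<partial>lborel\<bar> \<le> (\<integral>\<^sup>+s. ?r s * (?r s * ennreal \<bar>g s\<bar>) \<partial>lborel)"
  proof (cases "integrable lborel (\<lambda>s. expw s * g s)")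
    case True
    have "ennreal \<bar>\<integral>s. expw s * g s \<partial>lborel\<bar> \<le> (\<integral>\<^sup>+s. ennreal (norm (expw s * g s)) \<partial>lborel)"
      using integral_norm_bound_ennreal[OF True] by simp
    also have "\<dots> = (\<integral>\<^sup>+s. ?r s * (?r s * ennreal \<bar>g s\<bar>) \<partial>lborel)"
      by (intro nn_integral_cong) (simp add: mult.assoc[symmetric] sq abs_mult ennreal_mult)
    finally show ?thesis .
  qed (simp add: not_integrable_integral_eq)
  then have "ennreal \<bar>\<integral>s. expw s * g s \<partial>lborel\<bar> ^ 2 \<le> (\<integral>\<^sup>+s. ?r s * (?r s * ennreal \<bar>g s\<bar>) \<partial>lborel) ^ 2"
    by (rule power_mono) simp
  also have "\<dots> \<le> (\<integral>\<^sup>+s. ?r s ^ 2 \<partial>lborel) * (\<integral>\<^sup>+s. (?r s * ennreal \<bar>g s\<bar>) ^ 2 \<partial>lborel)"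
    by (rule Cauchy_Schwarz_nn_integral) measurable
  also have "(\<integral>\<^sup>+s. ?r s ^ 2 \<partial>lborel) = 1" using nn_integral_expw by (simp add: power2_eq_square sq)
  also have "(\<integral>\<^sup>+s. (?r s * ennreal \<bar>g s\<bar>) ^ 2 \<partial>lborel) = (\<integral>\<^sup>+s. ennreal (expw s) * ennreal ((g s)\<^sup>2) \<partial>lborel)"
  proof (rule nn_integral_cong)
    fix s
    have "(?r s * ennreal \<bar>g s\<bar>) ^ 2 = (?r s * ?r s) * (ennreal \<bar>g s\<bar> * ennreal \<bar>g s\<bar>)"
      by (simp add: power2_eq_square mult_ac)
    also have "\<dots> = ennreal (expw s) * ennreal ((g s)\<^sup>2)"
      by (simp add: sq ennreal_mult[symmetric] power2_eq_square)
    finally show "(?r s * ennreal \<bar>g s\<bar>) ^ 2 = ennreal (expw s) * ennreal ((g s)\<^sup>2)" .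
  qed
  finally show ?thesis by (simp add: ennreal_power)
qed

section \<open>Averages of the optimal strategy over its past\<close>

locale relaxation = square_integrable_target P F T \<Xi> for P :: "'a measure" and F T \<Xi> +
  fixes Q0 :: "real \<Rightarrow> 'a \<Rightarrow> real" and \<epsilon> :: real
  assumes Q0_cadlag_adapted: "cadlag_adapted P F T Q0" and eps_pos: "0 < \<epsilon>" and eps_le: "\<epsilon> \<le> T\<^sup>2 / 4"
begin

definition \<delta> :: real where "\<delta> = sqrt \<epsilon>"
definition S :: real where "S = T - \<delta>"

abbreviation first_error :: "'a \<Rightarrow> ennreal" where
  "first_error \<omega> \<equiv> (\<integral>\<^sup>+t\<in>{0..S}. ennreal ((Qbar \<epsilon> Q0 t \<omega> - Q0 t \<omega>)\<^sup>2) \<partial>lborel)"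

abbreviation target_distance :: "'a \<Rightarrow> ennreal" where
  "target_distance \<omega> \<equiv> (\<integral>\<^sup>+t\<in>{S..<T}. ennreal ((Q0 t \<omega> - \<Xi> t \<omega>)\<^sup>2) \<partial>lborel)"

abbreviation target_energy :: "'a \<Rightarrow> ennreal" where
  "target_energy \<omega> \<equiv> (\<integral>\<^sup>+t\<in>{S..<T}. ennreal (((\<Xi> T \<omega> - \<Xi> t \<omega>) / (T - t))\<^sup>2) \<partial>lborel)"

lemma \<delta>_pos: "0 < \<delta>" using eps_pos by (simp add: \<delta>_def)
lemma \<delta>_square: "\<delta>\<^sup>2 = \<epsilon>" using eps_pos by (simp add: \<delta>_def)
lemma \<delta>_le: "\<delta> \<le> T / 2"
  using eps_le horizon_pos unfolding \<delta>_def by (intro real_le_lsqrt) (auto simp: power_divide)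
lemma S_bounds: "0 < S" "S < T" "\<delta> = T - S"
  using \<delta>_pos \<delta>_le horizon_pos by (auto simp: S_def)

lemma Q0_path: "\<omega> \<in> space P \<Longrightarrow> cadlag_on 0 T (\<lambda>t. Q0 t \<omega>)"
  using Q0_cadlag_adapted by (simp add: cadlag_adapted_def)

lemma Q0_P[measurable]: "t \<in> {0..T} \<Longrightarrow> Q0 t \<in> borel_measurable P"
  using Q0_cadlag_adapted by (intro F_P) (auto simp: cadlag_adapted_def adapted_def)

lemma Q0_joint[measurable]: "(\<lambda>(t, \<omega>). Q0 (clip t) \<omega>) \<in> borel_measurable (borel \<Otimes>\<^sub>M P)"
  by (rule prog_measurable_clip_P[OF cadlag_adapted_prog_measurable[OF Q0_cadlag_adapted]])

lemma Q0_path_measurable: "\<omega> \<in> space P \<Longrightarrow> (\<lambda>t. Q0 (clip t) \<omega>) \<in> borel_measurable borel"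
  using Q0_path horizon_pos by (intro cadlag_on_clip_measurable) auto

text \<open>Substitution \<open>r = t - \<delta> * s\<close>. The cutoff
  \<open>s \<le> t / \<delta>\<close> expresses \<open>r \<ge> 0\<close>; \<open>clip\<close> leaves
  such times unchanged and makes the integrand measurable over all lags.\<close>

lemma Qbar_eq_average:
  assumes t: "t \<in> {0..T}"
  shows "Qbar \<epsilon> Q0 t \<omega> = (\<integral>s. expw s * (indicator {..t / \<delta>} s * Q0 (clip (t - \<delta> * s)) \<omega>) \<partial>lborel)"
proof -
  let ?f = "\<lambda>r. indicator {0..t} r *\<^sub>R (exp (- (t - r) / \<delta>) * Q0 r \<omega>)"
  have "(\<integral>r. ?f r \<partial>lborel) = \<bar>- \<delta>\<bar> *\<^sub>R (\<integral>s. ?f (t + - \<delta> * s) \<partial>lborel)"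
    using \<delta>_pos by (intro lborel_integral_real_affine) auto
  also have "(\<integral>s. ?f (t + - \<delta> * s) \<partial>lborel) = (\<integral>s. expw s * (indicator {..t / \<delta>} s * Q0 (clip (t - \<delta> * s)) \<omega>) \<partial>lborel)"
  proof (rule Bochner_Integration.integral_cong)
    fix s
    show "?f (t + - \<delta> * s) = expw s * (indicator {..t / \<delta>} s * Q0 (clip (t - \<delta> * s)) \<omega>)"
    proof (cases "0 \<le> s \<and> s \<le> t / \<delta>")
      case True
      then have "\<delta> * s \<le> t" "0 \<le> \<delta> * s" using \<delta>_pos by (auto simp: field_simps)
      moreover from this have "clip (t - \<delta> * s) = t - \<delta> * s" using t by auto
      ultimately show ?thesis using True t \<delta>_pos by simp
    next
      case False
      have "indicator {0..t} (t + - \<delta> * s) = (0::real)"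
        using False \<delta>_pos by (auto simp: indicator_def field_simps zero_le_mult_iff)
      then show ?thesis using False by (auto simp: indicator_def)
    qed
  qed simp
  finally show ?thesis using \<delta>_pos by (simp add: Qbar_def set_lebesgue_integral_def \<delta>_def[symmetric])
qed

sublocale time_space: pair_sigma_finite lborel P ..

text \<open>Jensen and Tonelli: a lag that stays after time 0 contributes at most \<open>c\<close>,
  any other contributes 0, and the weights have mass 1.\<close>

lemma nn_Qbar_square_le:
  assumes t: "t \<in> {0..T}" and c: "\<And>r. 0 \<le> r \<Longrightarrow> r \<le> t \<Longrightarrow> second_moment (Q0 r) \<le> c"
  shows "(\<integral>\<^sup>+\<omega>. ennreal ((Qbar \<epsilon> Q0 t \<omega>)\<^sup>2) \<partial>P) \<le> c"
proof -
  define h where "h s \<omega> = ennreal (expw s) * ennreal ((indicator {..t / \<delta>} s * Q0 (clip (t - \<delta> * s)) \<omega>)\<^sup>2)" for s \<omega>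
  have m: "(\<lambda>(s, \<omega>). Q0 (clip (t - \<delta> * s)) \<omega>) \<in> borel_measurable (borel \<Otimes>\<^sub>M P)"
  proof -
    have "(\<lambda>(s, \<omega>). (t - \<delta> * s, \<omega>)) \<in> borel \<Otimes>\<^sub>M P \<rightarrow>\<^sub>M borel \<Otimes>\<^sub>M P" by measurable
    from measurable_compose[OF this Q0_joint] show ?thesis by (simp add: split_beta')
  qed
  have h_meas: "case_prod h \<in> borel_measurable (lborel \<Otimes>\<^sub>M P)"
    using m unfolding h_def split_beta' by measurable
  have "(\<integral>\<^sup>+\<omega>. ennreal ((Qbar \<epsilon> Q0 t \<omega>)\<^sup>2) \<partial>P) \<le> (\<integral>\<^sup>+\<omega>. \<integral>\<^sup>+s. h s \<omega> \<partial>lborel \<partial>P)"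
  proof (rule nn_integral_mono)
    fix \<omega> assume \<omega>: "\<omega> \<in> space P"
    note [measurable] = Q0_path_measurable[OF \<omega>]
    have "(\<lambda>s. Q0 (clip (t - \<delta> * s)) \<omega>) \<in> borel_measurable borel" by measurable
    then show "ennreal ((Qbar \<epsilon> Q0 t \<omega>)\<^sup>2) \<le> (\<integral>\<^sup>+s. h s \<omega> \<partial>lborel)"
      unfolding Qbar_eq_average[OF t] h_def by (intro expw_Jensen) measurable
  qed
  also have "\<dots> = (\<integral>\<^sup>+s. \<integral>\<^sup>+\<omega>. h s \<omega> \<partial>P \<partial>lborel)"
    by (rule time_space.Fubini'[OF h_meas])
  also have "\<dots> \<le> (\<integral>\<^sup>+s. ennreal (expw s) * c \<partial>lborel)"
  proof (rule nn_integral_mono)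
    fix s
    show "(\<integral>\<^sup>+\<omega>. h s \<omega> \<partial>P) \<le> ennreal (expw s) * c"
    proof (cases "0 \<le> s \<and> s \<le> t / \<delta>")
      case True
      then have r: "0 \<le> t - \<delta> * s" "t - \<delta> * s \<le> t" using \<delta>_pos by (auto simp: field_simps)
      then have "clip (t - \<delta> * s) = t - \<delta> * s" using t by auto
      with True have "(\<integral>\<^sup>+\<omega>. h s \<omega> \<partial>P) = (\<integral>\<^sup>+\<omega>. ennreal (expw s) * ennreal ((Q0 (t - \<delta> * s) \<omega>)\<^sup>2) \<partial>P)"
        by (simp add: h_def)
      also have "\<dots> = ennreal (expw s) * second_moment (Q0 (t - \<delta> * s))"
        using Q0_P[of "t - \<delta> * s"] r t by (intro nn_integral_cmult) auto
      also have "\<dots> \<le> ennreal (expw s) * c" using c[OF r] by (intro mult_left_mono) auto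
      finally show ?thesis .
    next
      case False
      then have "h s \<omega> = 0" for \<omega> by (auto simp: h_def indicator_def)
      then show ?thesis by simp
    qed
  qed
  also have "\<dots> = c" using nn_integral_expw by (simp add: nn_integral_multc)
  finally show ?thesis .
qed

text \<open>Lags beyond \<open>t / \<delta>\<close> look behind time 0. There \<open>clip\<close>
  reads \<open>Q0 0\<close>, in accordance with \<open>max (t - h) 0\<close> in the seminorm, while
  \<open>Qbar\<close> counts 0; the discrepancy is \<open>Q0 0\<close> times the exponential mass of
  those lags.\<close>

lemma Qbar_lag:
  assumes t: "t \<in> {0..T}" and \<omega>: "\<omega> \<in> space P"
  shows "Qbar \<epsilon> Q0 t \<omega> - Q0 t \<omega> =
    (\<integral>s. expw s * (Q0 (clip (t - \<delta> * s)) \<omega> - Q0 t \<omega>) \<partial>lborel) - exp (- t / \<delta>) * Q0 0 \<omega>"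
proof -
  obtain B where B: "\<And>t. t \<in> {0..T} \<Longrightarrow> \<bar>Q0 t \<omega>\<bar> \<le> B" using cadlag_on_bounded[OF Q0_path[OF \<omega>]] by blast
  have m[measurable]: "(\<lambda>s. Q0 (clip (t - \<delta> * s)) \<omega>) \<in> borel_measurable borel"
    using measurable_compose[OF _ Q0_path_measurable[OF \<omega>], of "\<lambda>s. t - \<delta> * s" borel] by simp
  have i: "integrable lborel (\<lambda>s. expw s * g s)" if "g \<in> borel_measurable borel" "\<And>s. \<bar>g s\<bar> \<le> \<bar>B\<bar>" for g :: "real \<Rightarrow> real"
    by (rule Bochner_Integration.integrable_bound[OF integrable_mult_left[OF integrable_expw, of "\<bar>B\<bar>"]])
      (use that in \<open>auto simp: indicator_def abs_mult\<close>)
  have Bc: "\<bar>Q0 (clip u) \<omega>\<bar> \<le> \<bar>B\<bar>" for u using B[OF clip_in] abs_ge_self[of B] by (rule order_trans)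
  have iQ: "integrable lborel (\<lambda>s. expw s * Q0 (clip (t - \<delta> * s)) \<omega>)" by (rule i[OF m Bc])
  have iA: "integrable lborel (\<lambda>s. expw s * (indicator {..t / \<delta>} s * Q0 (clip (t - \<delta> * s)) \<omega>))"
    using Bc by (intro i) (auto simp: indicator_def)
  have "expw s * Q0 (clip (t - \<delta> * s)) \<omega> =
      expw s * (indicator {..t / \<delta>} s * Q0 (clip (t - \<delta> * s)) \<omega>) + Q0 0 \<omega> * (indicator {t / \<delta><..} s * exp (- s))" for s
  proof (cases "s \<le> t / \<delta>")
    case False
    then have "t < \<delta> * s" using \<delta>_pos by (simp add: field_simps)
    then have "clip (t - \<delta> * s) = 0" using horizon_pos by auto
    moreover have "0 \<le> t / \<delta>" using t \<delta>_pos by simp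
    then have "0 \<le> s" using False by linarith
    ultimately show ?thesis using False by (simp add: indicator_def)
  qed (simp add: indicator_def)
  then have "(\<integral>s. expw s * Q0 (clip (t - \<delta> * s)) \<omega> \<partial>lborel) =
     (\<integral>s. expw s * (indicator {..t / \<delta>} s * Q0 (clip (t - \<delta> * s)) \<omega>) + Q0 0 \<omega> * (indicator {t / \<delta><..} s * exp (- s)) \<partial>lborel)"
    by simp
  also have "\<dots> = Qbar \<epsilon> Q0 t \<omega> + Q0 0 \<omega> * exp (- t / \<delta>)"
  proof -
    have "integrable lborel (\<lambda>s. indicator {t / \<delta><..} s * exp (- s))"
      by (rule Bochner_Integration.integrable_bound[OF integrable_expw])
        (use t \<delta>_pos in \<open>auto simp: indicator_def intro: order_trans[OF divide_nonneg_pos less_imp_le]\<close>)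
    then show ?thesis
      using iA integral_expw_greaterThan[of "t / \<delta>"] t \<delta>_pos by (simp add: Qbar_eq_average[OF t])
  qed
  moreover have "(\<integral>s. expw s * (Q0 (clip (t - \<delta> * s)) \<omega> - Q0 t \<omega>) \<partial>lborel) =
      (\<integral>s. expw s * Q0 (clip (t - \<delta> * s)) \<omega> \<partial>lborel) - Q0 t \<omega>"
    using iQ integrable_expw integral_expw by (simp add: right_diff_distrib)
  ultimately show ?thesis by simp
qed

lemma tr_seminorm_bound:
  assumes "0 \<le> h"
  shows "(\<integral>\<^sup>+\<omega>. (\<integral>\<^sup>+t\<in>{0..T}. ennreal ((Q0 (max (t - h) 0) \<omega> - Q0 t \<omega>)\<^sup>2) \<partial>lborel) \<partial>P)
    \<le> ennreal h * tr_seminorm_sq P T Q0"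
proof (cases "h = 0")
  case True
  have "(\<integral>\<^sup>+t\<in>{0..T}. ennreal ((Q0 (max (t - h) 0) \<omega> - Q0 t \<omega>)\<^sup>2) \<partial>lborel) = (\<integral>\<^sup>+(t::real). 0 \<partial>lborel)" for \<omega>
    by (intro nn_integral_cong) (use True in \<open>auto simp: indicator_def max_def\<close>)
  then show ?thesis by simp
next
  case False
  define X where "X = (\<integral>\<^sup>+\<omega>. (\<integral>\<^sup>+t\<in>{0..T}. ennreal ((Q0 t \<omega> - Q0 (max (t - h) 0) \<omega>)\<^sup>2) \<partial>lborel) \<partial>P)"
  have h: "0 < h" using False assms by simp
  have "ennreal (1 / h) * X \<le> tr_seminorm_sq P T Q0"
    unfolding tr_seminorm_sq_def X_def by (rule SUP_upper) (use h in simp)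
  then have "ennreal h * (ennreal (1 / h) * X) \<le> ennreal h * tr_seminorm_sq P T Q0"
    by (intro mult_left_mono) auto
  moreover have "ennreal h * (ennreal (1 / h) * X) = X"
    using h by (simp add: mult.assoc[symmetric] ennreal_mult[symmetric])
  ultimately show ?thesis by (simp add: X_def power2_commute)
qed

lemma nn_integral_exp_decay: "(\<integral>\<^sup>+t\<in>{0..S}. ennreal ((exp (- t / \<delta>))\<^sup>2) \<partial>lborel) \<le> ennreal (\<delta> / 2)"
proof -
  have "(\<integral>\<^sup>+t\<in>{0..S}. ennreal ((exp (- t / \<delta>))\<^sup>2) \<partial>lborel)
      = ennreal (- (\<delta> / 2) * exp (- (2 * S) / \<delta>) - (- (\<delta> / 2) * exp (- (2 * 0) / \<delta>)))"
  proof (rule nn_integral_FTC_Icc)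
    show "((\<lambda>t. - (\<delta> / 2) * exp (- (2 * t) / \<delta>)) has_real_derivative (exp (- t / \<delta>))\<^sup>2) (at t)" for t
      using \<delta>_pos by (auto intro!: derivative_eq_intros simp: power2_eq_square exp_add[symmetric] field_simps)
  qed (use S_bounds in auto)
  also have "\<dots> \<le> ennreal (\<delta> / 2)" using \<delta>_pos by (intro ennreal_leI) simp
  finally show ?thesis .
qed

text \<open>The square of the formula in \<open>Qbar_lag\<close> is at most twice the squares of its
  two terms. The weight of the boundary term integrates to at most \<open>\<delta> / 2\<close>,
  which absorbs the factor 2. For the average, Jensen and Tonelli freeze the lag: a shift by
  \<open>\<delta> * s\<close> costs \<open>\<delta> * s\<close> times the seminorm, and the mean of
  \<open>s\<close> under \<open>expw\<close> is 1.\<close>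

lemma tracking_error_first_phase:
  "(\<integral>\<^sup>+\<omega>. first_error \<omega> \<partial>P)
    \<le> 2 * ennreal \<delta> * tr_seminorm_sq P T Q0 + ennreal \<delta> * second_moment (Q0 0)"
proof -
  \<comment> \<open>The clips make \<open>g\<close> jointly measurable on the full product; the clip
    of \<open>t\<close> itself acts trivially on \<open>{0..T}\<close>. The time range is
    \<open>{0..T}\<close> instead of \<open>{0..S}\<close> to match the seminorm.\<close>
  define g where "g \<omega> t s = ennreal (expw s) * (ennreal ((Q0 (clip (clip t - \<delta> * s)) \<omega> - Q0 (clip t) \<omega>)\<^sup>2) * indicator {0..T} t)" for \<omega> t s
  have m: "(\<lambda>((\<omega>, t), s). Q0 (clip (clip t - \<delta> * s)) \<omega>) \<in> borel_measurable ((P \<Otimes>\<^sub>M lborel) \<Otimes>\<^sub>M lborel)"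
  proof -
    have "(\<lambda>p. (clip (snd (fst p)) - \<delta> * snd p, fst (fst p))) \<in> (P \<Otimes>\<^sub>M lborel) \<Otimes>\<^sub>M lborel \<rightarrow>\<^sub>M borel \<Otimes>\<^sub>M P" by measurable
    from measurable_compose[OF this Q0_joint] show ?thesis by (simp add: split_beta')
  qed
  have m': "(\<lambda>((\<omega>, t), s). Q0 (clip t) \<omega>) \<in> borel_measurable ((P \<Otimes>\<^sub>M lborel) \<Otimes>\<^sub>M (lborel :: real measure))"
  proof -
    have "(\<lambda>p. (snd (fst p), fst (fst p))) \<in> (P \<Otimes>\<^sub>M lborel) \<Otimes>\<^sub>M (lborel :: real measure) \<rightarrow>\<^sub>M borel \<Otimes>\<^sub>M P" by measurable
    from measurable_compose[OF this Q0_joint] show ?thesis by (simp add: split_beta')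
  qed
  have g_meas[measurable]: "(\<lambda>((\<omega>, t), s). g \<omega> t s) \<in> borel_measurable ((P \<Otimes>\<^sub>M lborel) \<Otimes>\<^sub>M lborel)"
    using m m' unfolding g_def split_beta' by measurable
  have g_meas1: "(\<lambda>(\<omega>, t). \<integral>\<^sup>+s. g \<omega> t s \<partial>lborel) \<in> borel_measurable (P \<Otimes>\<^sub>M lborel)"
    using lborel.borel_measurable_nn_integral_fst[OF g_meas] by (simp add: split_beta')
  have g_meas2: "(\<lambda>\<omega>. \<integral>\<^sup>+t. \<integral>\<^sup>+s. g \<omega> t s \<partial>lborel \<partial>lborel) \<in> borel_measurable P"
    using lborel.borel_measurable_nn_integral_fst[OF g_meas1] by simp
  have Q00[measurable]: "Q0 0 \<in> borel_measurable P" using horizon_pos by (intro Q0_P) auto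
  have path: "first_error \<omega>
      \<le> 2 * (\<integral>\<^sup>+t. \<integral>\<^sup>+s. g \<omega> t s \<partial>lborel \<partial>lborel) + ennreal \<delta> * ennreal ((Q0 0 \<omega>)\<^sup>2)"
    if \<omega>: "\<omega> \<in> space P" for \<omega>
  proof -
    have [measurable]: "(\<lambda>t. \<integral>\<^sup>+s. g \<omega> t s \<partial>lborel) \<in> borel_measurable lborel"
      using measurable_Pair2[OF g_meas1 \<omega>] by simp
    have "first_error \<omega>
       \<le> (\<integral>\<^sup>+t. 2 * (\<integral>\<^sup>+s. g \<omega> t s \<partial>lborel) + (2 * ennreal ((Q0 0 \<omega>)\<^sup>2)) * (ennreal ((exp (- t / \<delta>))\<^sup>2) * indicator {0..S} t) \<partial>lborel)"
    proof (rule nn_integral_mono)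
      fix t
      show "ennreal ((Qbar \<epsilon> Q0 t \<omega> - Q0 t \<omega>)\<^sup>2) * indicator {0..S} t
         \<le> 2 * (\<integral>\<^sup>+s. g \<omega> t s \<partial>lborel) + (2 * ennreal ((Q0 0 \<omega>)\<^sup>2)) * (ennreal ((exp (- t / \<delta>))\<^sup>2) * indicator {0..S} t)"
      proof (cases "t \<in> {0..S}")
        case True
        then have t: "t \<in> {0..T}" using S_bounds by auto
        define a where "a = (\<integral>s. expw s * (Q0 (clip (t - \<delta> * s)) \<omega> - Q0 t \<omega>) \<partial>lborel)"
        define b where "b = exp (- t / \<delta>) * Q0 0 \<omega>"
        have m[measurable]: "(\<lambda>s. Q0 (clip (t - \<delta> * s)) \<omega>) \<in> borel_measurable borel"
          using measurable_compose[OF _ Q0_path_measurable[OF \<omega>], of "\<lambda>s. t - \<delta> * s" borel] by simp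
        have "ennreal (a\<^sup>2) \<le> (\<integral>\<^sup>+s. ennreal (expw s) * ennreal ((Q0 (clip (t - \<delta> * s)) \<omega> - Q0 t \<omega>)\<^sup>2) \<partial>lborel)"
          unfolding a_def by (rule expw_Jensen) measurable
        also have "\<dots> = (\<integral>\<^sup>+s. g \<omega> t s \<partial>lborel)"
          using t by (simp add: g_def clip_id)
        finally have a: "ennreal (a\<^sup>2) \<le> (\<integral>\<^sup>+s. g \<omega> t s \<partial>lborel)" .
        have "(a - b)\<^sup>2 \<le> 2 * a\<^sup>2 + 2 * b\<^sup>2"
          using zero_le_power2[of "a + b"] unfolding power2_diff power2_sum by linarith
        then have "ennreal ((Qbar \<epsilon> Q0 t \<omega> - Q0 t \<omega>)\<^sup>2) \<le> ennreal (2 * a\<^sup>2 + 2 * b\<^sup>2)"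
          unfolding Qbar_lag[OF t \<omega>] a_def b_def by (intro ennreal_leI)
        also have "\<dots> = 2 * ennreal (a\<^sup>2) + 2 * ennreal (b\<^sup>2)" by (simp add: ennreal_plus ennreal_mult)
        also have "\<dots> \<le> 2 * (\<integral>\<^sup>+s. g \<omega> t s \<partial>lborel) + 2 * ennreal (b\<^sup>2)" using a by (intro add_mono mult_left_mono) auto
        also have "2 * ennreal (b\<^sup>2) = (2 * ennreal ((Q0 0 \<omega>)\<^sup>2)) * ennreal ((exp (- t / \<delta>))\<^sup>2)"
          by (simp add: b_def power_mult_distrib ennreal_mult mult_ac)
        finally show ?thesis using True by simp
      qed simp
    qed
    also have "\<dots> = 2 * (\<integral>\<^sup>+t. \<integral>\<^sup>+s. g \<omega> t s \<partial>lborel \<partial>lborel)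
        + (2 * ennreal ((Q0 0 \<omega>)\<^sup>2)) * (\<integral>\<^sup>+t\<in>{0..S}. ennreal ((exp (- t / \<delta>))\<^sup>2) \<partial>lborel)"
      by (subst nn_integral_add) (auto simp: nn_integral_cmult)
    also have "\<dots> \<le> 2 * (\<integral>\<^sup>+t. \<integral>\<^sup>+s. g \<omega> t s \<partial>lborel \<partial>lborel) + (2 * ennreal ((Q0 0 \<omega>)\<^sup>2)) * ennreal (\<delta> / 2)"
      by (intro add_left_mono mult_left_mono nn_integral_exp_decay) auto
    also have "(2 * ennreal ((Q0 0 \<omega>)\<^sup>2)) * ennreal (\<delta> / 2) = ennreal \<delta> * ennreal ((Q0 0 \<omega>)\<^sup>2)"
    proof -
      have "2 * ennreal (\<delta> / 2) = ennreal (2 * (\<delta> / 2))" using \<delta>_pos by (subst ennreal_mult) auto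
      then have "2 * ennreal (\<delta> / 2) = ennreal \<delta>" by simp
      then show ?thesis by (metis mult.assoc mult.commute)
    qed
    finally show ?thesis .
  qed
  have "(\<integral>\<^sup>+\<omega>. first_error \<omega> \<partial>P)
     \<le> (\<integral>\<^sup>+\<omega>. 2 * (\<integral>\<^sup>+t. \<integral>\<^sup>+s. g \<omega> t s \<partial>lborel \<partial>lborel) + ennreal \<delta> * ennreal ((Q0 0 \<omega>)\<^sup>2) \<partial>P)"
    by (rule nn_integral_mono) (rule path)
  also have "\<dots> = 2 * (\<integral>\<^sup>+\<omega>. \<integral>\<^sup>+t. \<integral>\<^sup>+s. g \<omega> t s \<partial>lborel \<partial>lborel \<partial>P) + ennreal \<delta> * second_moment (Q0 0)"
    using g_meas2 by (subst nn_integral_add) (auto simp: nn_integral_cmult)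
  also have "(\<integral>\<^sup>+\<omega>. \<integral>\<^sup>+t. \<integral>\<^sup>+s. g \<omega> t s \<partial>lborel \<partial>lborel \<partial>P) \<le> ennreal \<delta> * tr_seminorm_sq P T Q0"
  proof -
    interpret PL: pair_sigma_finite P "lborel :: real measure" ..
    interpret PLL: pair_sigma_finite "P \<Otimes>\<^sub>M (lborel :: real measure)" "lborel :: real measure" ..
    have "(\<integral>\<^sup>+\<omega>. \<integral>\<^sup>+t. \<integral>\<^sup>+s. g \<omega> t s \<partial>lborel \<partial>lborel \<partial>P) = (\<integral>\<^sup>+p. \<integral>\<^sup>+s. g (fst p) (snd p) s \<partial>lborel \<partial>(P \<Otimes>\<^sub>M lborel))"
      using lborel.nn_integral_fst[OF g_meas1] by (simp add: split_beta')
    also have "\<dots> = (\<integral>\<^sup>+s. \<integral>\<^sup>+p. g (fst p) (snd p) s \<partial>(P \<Otimes>\<^sub>M lborel) \<partial>lborel)"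
      using g_meas by (intro PLL.Fubini'[symmetric]) (simp add: split_beta')
    also have "\<dots> \<le> (\<integral>\<^sup>+s. (ennreal (expw s) * ennreal s) * (ennreal \<delta> * tr_seminorm_sq P T Q0) \<partial>lborel)"
    proof (rule nn_integral_mono)
      fix s :: real
      show "(\<integral>\<^sup>+p. g (fst p) (snd p) s \<partial>(P \<Otimes>\<^sub>M lborel)) \<le> (ennreal (expw s) * ennreal s) * (ennreal \<delta> * tr_seminorm_sq P T Q0)"
      proof (cases "0 \<le> s")
        case True
        define k where "k p = ennreal ((Q0 (clip (clip (snd p) - \<delta> * s)) (fst p) - Q0 (clip (snd p)) (fst p))\<^sup>2) * indicator {0..T} (snd p)" for p
        have k_meas: "k \<in> borel_measurable (P \<Otimes>\<^sub>M lborel)"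
        proof -
          have c: "(\<lambda>p. (p, s)) \<in> P \<Otimes>\<^sub>M lborel \<rightarrow>\<^sub>M (P \<Otimes>\<^sub>M lborel) \<Otimes>\<^sub>M lborel" by simp
          from measurable_compose[OF c m] measurable_compose[OF c m'] show ?thesis
            unfolding k_def by (simp add: split_beta')
        qed
        have "(\<integral>\<^sup>+p. g (fst p) (snd p) s \<partial>(P \<Otimes>\<^sub>M lborel)) = (\<integral>\<^sup>+p. ennreal (expw s) * k p \<partial>(P \<Otimes>\<^sub>M lborel))"
          by (simp add: g_def k_def)
        also have "\<dots> = ennreal (expw s) * (\<integral>\<^sup>+p. k p \<partial>(P \<Otimes>\<^sub>M lborel))"
          by (rule nn_integral_cmult[OF k_meas])
        also have "(\<integral>\<^sup>+p. k p \<partial>(P \<Otimes>\<^sub>M lborel)) = (\<integral>\<^sup>+\<omega>. \<integral>\<^sup>+t. k (\<omega>, t) \<partial>lborel \<partial>P)"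
          by (rule lborel.nn_integral_fst[OF k_meas, symmetric])
        also have "\<dots> = (\<integral>\<^sup>+\<omega>. (\<integral>\<^sup>+t\<in>{0..T}. ennreal ((Q0 (max (t - \<delta> * s) 0) \<omega> - Q0 t \<omega>)\<^sup>2) \<partial>lborel) \<partial>P)"
        proof (intro nn_integral_cong)
          fix \<omega> t
          show "k (\<omega>, t) = ennreal ((Q0 (max (t - \<delta> * s) 0) \<omega> - Q0 t \<omega>)\<^sup>2) * indicator {0..T} t"
          proof (cases "t \<in> {0..T}")
            case t: True
            have "0 \<le> \<delta> * s" using True \<delta>_pos by simp
            then have "clip (t - \<delta> * s) = max (t - \<delta> * s) 0" using t by auto
            then show ?thesis using t by (simp add: k_def clip_id)
          qed (simp add: k_def)
        qed
        also have "\<dots> \<le> ennreal (\<delta> * s) * tr_seminorm_sq P T Q0"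
          using True \<delta>_pos by (intro tr_seminorm_bound) simp
        finally have "(\<integral>\<^sup>+p. g (fst p) (snd p) s \<partial>(P \<Otimes>\<^sub>M lborel)) \<le> ennreal (expw s) * (ennreal (\<delta> * s) * tr_seminorm_sq P T Q0)"
          by (simp add: mult_left_mono)
        then show ?thesis using True \<delta>_pos by (simp add: ennreal_mult mult_ac)
      qed (simp add: g_def)
    qed
    also have "\<dots> = ennreal \<delta> * tr_seminorm_sq P T Q0"
      by (subst nn_integral_multc) (auto simp: nn_integral_expw_first_moment)
    finally show ?thesis .
  qed
  finally show ?thesis by (simp add: mult.assoc mult_left_mono)
qed

end


section \<open>Paths of the relaxed strategy\<close>

lemma primitive_on_cong:
  assumes "primitive_on a b f F" "\<And>t. t \<in> {a..b} \<Longrightarrow> f' t = f t" "\<And>t. t \<in> {a..b} \<Longrightarrow> F' t = F t"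
  shows "primitive_on a b f' F'"
proof (rule primitive_onI)
  have eq: "indicator {a..t} s *\<^sub>R f' s = indicator {a..t} s *\<^sub>R f s" if "t \<le> b" for s t
    using that assms(2)[of s] by (auto simp: indicator_def)
  show "set_integrable lborel {a..b} f'"
    using primitive_on_integrable[OF assms(1)] by (simp only: set_integrable_def eq order_refl)
  fix t assume t: "a \<le> t" "t \<le> b"
  have "(LINT s:{a..t}|lborel. f' s) = (LINT s:{a..t}|lborel. f s)"
    using t by (simp only: set_lebesgue_integral_def eq)
  then show "F' t = F' a + (LINT s:{a..t}|lborel. f' s)"
    using primitive_on_eq[OF assms(1) t] assms(3)[of t] assms(3)[of a] t by simp
qed

text \<open>Changing a density at one point does not matter. This is applied at the switching time
  \<open>S\<close>, where the feedback rate already has its second form.\<close>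

lemma primitive_on_modify_right_endpoint:
  fixes f f' :: "real \<Rightarrow> real"
  assumes P: "primitive_on a b f F" and eq: "\<And>t. a \<le> t \<Longrightarrow> t < b \<Longrightarrow> f' t = f t"
  shows "primitive_on a b f' F"
proof (rule primitive_onI)
  define c where "c = f' b - f b"
  have pt: "indicator {a..t} s *\<^sub>R f' s = indicator {a..t} s *\<^sub>R f s + c * indicator ({b} \<inter> {a..t}) s" if "t \<le> b" for s t
    using that eq[of s] by (auto simp: indicator_def c_def)
  have ic: "integrable lborel (\<lambda>s. c * indicator ({b} \<inter> {a..t}) s)" for t
    by (intro integrable_mult_right integrable_real_indicator)
       (auto intro: le_less_trans[OF emeasure_mono[of _ "{b}"]])
  have "(\<integral>s. c * indicator ({b} \<inter> {a..t}) s \<partial>lborel) = 0" for t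
    by (rule integral_eq_zero_AE, use AE_lborel_singleton[of b] in eventually_elim) (simp add: indicator_def)
  note zero = this
  have i: "integrable lborel (\<lambda>s. indicator {a..t} s *\<^sub>R f s)" if "t \<le> b" for t
    using set_integrable_subset[OF primitive_on_integrable[OF P], of "{a..t}"] that by (simp add: set_integrable_def)
  show "set_integrable lborel {a..b} f'"
    unfolding set_integrable_def pt[OF order_refl] using i[OF order_refl] ic by simp
  fix t assume t: "a \<le> t" "t \<le> b"
  have "(LINT s:{a..t}|lborel. f' s) = (LINT s:{a..t}|lborel. f s)"
    unfolding set_lebesgue_integral_def pt[OF t(2)] using i[OF t(2)] ic zero by simp
  then show "F t = F a + (LINT s:{a..t}|lborel. f' s)"
    using primitive_on_eq[OF P t] by simp
qed

lemma primitive_on_indefinite_integral: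
  fixes f :: "real \<Rightarrow> real"
  assumes "set_integrable lborel {a..b} f"
  shows "primitive_on a b f (\<lambda>t. c + (LINT s:{a..t}|lborel. f s))"
  by (rule primitive_onI[OF assms]) (simp add: set_integral_point_zero)

lemma cadlag_on_compose:
  assumes f: "cadlag_on a b f" and g: "\<And>x. isCont g x"
  shows "cadlag_on a b (\<lambda>t. g (f t))"
  unfolding cadlag_on_def
proof (intro conjI ballI)
  fix t assume "t \<in> {a..<b}"
  then have "(f \<longlongrightarrow> f t) (at_right t)" using f by (simp add: cadlag_on_def)
  then show "((\<lambda>t. g (f t)) \<longlongrightarrow> g (f t)) (at_right t)" by (rule isCont_tendsto_compose[OF g])
next
  fix t assume "t \<in> {a<..b}"
  then obtain l where "(f \<longlongrightarrow> l) (at_left t)" using f unfolding cadlag_on_def by blast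
  then have "((\<lambda>t. g (f t)) \<longlongrightarrow> g l) (at_left t)" by (rule isCont_tendsto_compose[OF g])
  then show "\<exists>l. ((\<lambda>t. g (f t)) \<longlongrightarrow> l) (at_left t)" by blast
qed

text \<open>The product is bounded and measurable on a bounded interval. The weights will be
  exponentials and \<open>1 / (T - s)^2\<close> away from \<open>T\<close>.\<close>

lemma set_integrable_continuous_times_cadlag:
  fixes w f :: "real \<Rightarrow> real"
  assumes f: "cadlag_on 0 T f" and w: "continuous_on {a..b} w" and ab: "0 \<le> a" "b \<le> T"
  shows "set_integrable lborel {a..b} (\<lambda>s. w s * f s)"
proof (cases "a \<le> b")
  case True
  then have T: "0 \<le> T" using ab by simp
  obtain B where B: "\<And>t. t \<in> {0..T} \<Longrightarrow> \<bar>f t\<bar> \<le> B" using cadlag_on_bounded[OF f] by blast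
  have "bounded (w ` {a..b})" by (intro compact_imp_bounded compact_continuous_image w compact_Icc)
  then obtain C where C: "\<And>t. t \<in> {a..b} \<Longrightarrow> \<bar>w t\<bar> \<le> C" unfolding bounded_iff by force
  have [measurable]: "(\<lambda>t. f (max 0 (min T t))) \<in> borel_measurable borel"
    by (rule cadlag_on_clip_measurable[OF f T])
  have "(\<lambda>t. indicator {a..b} t *\<^sub>R w t) \<in> borel_measurable borel"
    by (rule borel_measurable_continuous_on_indicator[OF _ w]) simp
  then have "(\<lambda>t. (indicator {a..b} t *\<^sub>R w t) * f (max 0 (min T t))) \<in> borel_measurable lborel" by simp
  then have m: "(\<lambda>t. indicator {a..b} t *\<^sub>R (w t * f t)) \<in> borel_measurable lborel"
    by (rule back_subst[of "\<lambda>f. f \<in> borel_measurable lborel"]) (use ab in \<open>auto simp: indicator_def fun_eq_iff min_absorb2\<close>)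
  have "integrable lborel (\<lambda>t. indicator {a..b} t *\<^sub>R (C * B))"
    by (intro integrable_scaleR_left integrable_real_indicator) (auto simp: emeasure_lborel_Icc_eq)
  then show ?thesis unfolding set_integrable_def
  proof (rule Bochner_Integration.integrable_bound[OF _ m])
    show "AE t in lborel. norm (indicator {a..b} t *\<^sub>R (w t * f t)) \<le> norm (indicator {a..b} t *\<^sub>R (C * B))"
    proof (rule AE_I2)
      fix t
      show "norm (indicator {a..b} t *\<^sub>R (w t * f t)) \<le> norm (indicator {a..b} t *\<^sub>R (C * B))"
      proof (cases "t \<in> {a..b}")
        case True
        have "\<bar>w t * f t\<bar> \<le> C * B"
          using C[OF True] B[of t] True ab unfolding abs_mult by (intro mult_mono) auto
        then show ?thesis using True order_trans[OF _ abs_ge_self] by simp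
      qed simp
    qed
  qed
qed (simp add: set_integrable_def)

lemma primitive_inverse_distance:
  assumes "b < T"
  shows "primitive_on a b (\<lambda>t. 1 / (T - t)\<^sup>2) (\<lambda>t. 1 / (T - t))"
proof (rule primitive_on_C1)
  show "((\<lambda>t. 1 / (T - t)) has_real_derivative 1 / (T - t)\<^sup>2) (at t within {a..b})" if "t \<in> {a..b}" for t
    using that assms by (auto intro!: derivative_eq_intros simp: power2_eq_square)
  show "continuous_on {a..b} (\<lambda>t. 1 / (T - t)\<^sup>2)"
    using assms by (intro continuous_intros) auto
qed

lemma primitive_distance: "primitive_on a b (\<lambda>t. - 1) (\<lambda>t. T - t)"
  by (rule primitive_on_C1) (auto intro!: derivative_eq_intros continuous_intros)

context relaxation
begin

section \<open>The relaxed strategy as a primitive of its feedback rate\<close>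

abbreviation "Qe \<equiv> Qeps T \<Xi> Q0 \<epsilon>"
abbreviation "U \<equiv> feedback_rate T \<Xi> Q0 \<epsilon> Qe"

lemma Qe_first: "t \<le> S \<Longrightarrow> Qe t \<omega> = Qbar \<epsilon> Q0 t \<omega>"
  by (simp add: Qeps_def S_def \<delta>_def)

lemma Qe_T: "Qe T \<omega> = \<Xi> T \<omega>"
  using \<delta>_pos by (simp add: Qeps_def \<delta>_def)

lemma U_first: "t < S \<Longrightarrow> U t \<omega> = (Q0 t \<omega> - Qbar \<epsilon> Q0 t \<omega>) / \<delta>"
  by (simp add: feedback_rate_def Qe_first S_def[symmetric] \<delta>_def[symmetric])

lemma U_second: "S \<le> t \<Longrightarrow> U t \<omega> = (\<Xi> t \<omega> - Qe t \<omega>) / (T - t)"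
  by (simp add: feedback_rate_def S_def \<delta>_def)

text \<open>\<open>Qbar\<close> solves \<open>\<delta> * Q' = Q0 - Q\<close> with initial value 0.
  With the integrating factor split off, it is \<open>exp (- t / \<delta>)\<close> times a
  primitive, and the product rule applies.\<close>

lemma Qbar_primitive:
  assumes \<omega>: "\<omega> \<in> space P"
  shows "primitive_on 0 T (\<lambda>t. (Q0 t \<omega> - Qbar \<epsilon> Q0 t \<omega>) / \<delta>) (\<lambda>t. Qbar \<epsilon> Q0 t \<omega>)"
proof -
  define g where "g r = 1 / \<delta> * exp (r / \<delta>) * Q0 r \<omega>" for r
  define G where "G t = 0 + (LINT r:{0..t}|lborel. g r)" for t
  have g: "set_integrable lborel {0..T} g"
    unfolding g_def by (intro set_integrable_continuous_times_cadlag[OF Q0_path[OF \<omega>]] continuous_intros) (use \<delta>_pos in auto)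
  have G: "primitive_on 0 T g G"
    unfolding G_def by (rule primitive_on_indefinite_integral[OF g])
  have E: "primitive_on 0 T (\<lambda>t. - (1 / \<delta>) * exp (- t / \<delta>)) (\<lambda>t. exp (- t / \<delta>))"
    by (rule primitive_on_C1) (use \<delta>_pos in \<open>auto intro!: derivative_eq_intros continuous_intros\<close>)
  have Qb: "Qbar \<epsilon> Q0 t \<omega> = exp (- t / \<delta>) * G t" for t
  proof -
    have "exp (- (t - r) / \<delta>) * Q0 r \<omega> = (\<delta> * exp (- t / \<delta>)) * g r" for r
      using \<delta>_pos by (simp add: g_def exp_add[symmetric] diff_divide_distrib)
    then show ?thesis using \<delta>_pos by (simp add: Qbar_def G_def \<delta>_def[symmetric])
  qed
  show ?thesis
  proof (rule primitive_on_cong[OF primitive_on_mult[OF E G]])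
    fix t
    have "exp (- t / \<delta>) * g t = Q0 t \<omega> / \<delta>"
      by (simp add: g_def exp_minus field_simps)
    then show "(Q0 t \<omega> - Qbar \<epsilon> Q0 t \<omega>) / \<delta> = - (1 / \<delta>) * exp (- t / \<delta>) * G t + exp (- t / \<delta>) * g t"
      by (simp add: Qb diff_divide_distrib)
  qed (rule Qb)
qed

text \<open>On \<open>[S, T)\<close> this is the quotient \<open>Qe t / (T - t)\<close>. Dividing by
  the remaining time turns the linear feedback equation into a plain integral.\<close>

definition V :: "real \<Rightarrow> 'a \<Rightarrow> real" where
  "V t \<omega> = Qbar \<epsilon> Q0 S \<omega> / \<delta> + (LINT r:{S..t}|lborel. \<Xi> r \<omega> / (T - r)\<^sup>2)"

lemma Qe_second: "S \<le> t \<Longrightarrow> t < T \<Longrightarrow> Qe t \<omega> = (T - t) * V t \<omega>"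
proof (cases "t = S")
  case True
  then show ?thesis using \<delta>_pos
    by (simp add: Qe_first V_def S_def set_integral_point_zero)
qed (simp add: Qeps_def V_def S_def \<delta>_def distrib_left)

lemma V_primitive:
  assumes \<omega>: "\<omega> \<in> space P" and b: "b < T"
  shows "primitive_on S b (\<lambda>t. \<Xi> t \<omega> / (T - t)\<^sup>2) (\<lambda>t. V t \<omega>)"
proof -
  have "set_integrable lborel {S..b} (\<lambda>t. 1 / (T - t)\<^sup>2 * \<Xi> t \<omega>)"
    using b S_bounds by (intro set_integrable_continuous_times_cadlag[OF Xi_path[OF \<omega>]] continuous_intros) auto
  then show ?thesis unfolding V_def by (intro primitive_on_indefinite_integral) simp
qed

text \<open>The two phases are glued at \<open>S\<close>, where both formulas give the value of
  \<open>Qbar\<close>. The second one stops at \<open>b < T\<close>, since the kernel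
  \<open>1 / (T - t)^2\<close> is not integrable up to \<open>T\<close>.\<close>

lemma Qe_primitive:
  assumes \<omega>: "\<omega> \<in> space P" and b: "S \<le> b" "b < T"
  shows "primitive_on 0 b (\<lambda>t. U t \<omega>) (\<lambda>t. Qe t \<omega>)"
proof (rule primitive_on_combine)
  have "primitive_on 0 S (\<lambda>t. (Q0 t \<omega> - Qbar \<epsilon> Q0 t \<omega>) / \<delta>) (\<lambda>t. Qbar \<epsilon> Q0 t \<omega>)"
    using Qbar_primitive[OF \<omega>] by (rule primitive_on_subinterval) (use S_bounds in auto)
  then have "primitive_on 0 S (\<lambda>t. U t \<omega>) (\<lambda>t. Qbar \<epsilon> Q0 t \<omega>)"
    by (rule primitive_on_modify_right_endpoint) (simp add: U_first)
  then show "primitive_on 0 S (\<lambda>t. U t \<omega>) (\<lambda>t. Qe t \<omega>)"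
    by (rule primitive_on_cong) (auto simp: Qe_first)
  show "primitive_on S b (\<lambda>t. U t \<omega>) (\<lambda>t. Qe t \<omega>)"
  proof (rule primitive_on_cong[OF primitive_on_mult[OF primitive_distance[of S b T] V_primitive[OF \<omega> b(2)]]])
    fix t assume t: "t \<in> {S..b}"
    then show "Qe t \<omega> = (T - t) * V t \<omega>" using b by (auto simp: Qe_second)
    then show "U t \<omega> = - 1 * V t \<omega> + (T - t) * (\<Xi> t \<omega> / (T - t)\<^sup>2)"
      using t b by (simp add: U_second power2_eq_square diff_divide_distrib)
  qed
qed (use S_bounds b in auto)

text \<open>A constant \<open>l\<close> satisfies the equation of \<open>Qe\<close> with
  \<open>\<Xi>\<close> replaced by \<open>l\<close>, because \<open>1 / (T - t)\<close> is a
  primitive of \<open>1 / (T - t)^2\<close>. So the difference consists of a fixed amount times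
  \<open>T - t\<close> and an integral of \<open>\<Xi> - l\<close> with weights
  \<open>(T - t) / (T - s)^2\<close>, whose integral over \<open>[a, t]\<close> is at most
  1.\<close>

lemma Qe_left_limit:
  assumes \<omega>: "\<omega> \<in> space P" and l: "((\<lambda>t. \<Xi> t \<omega>) \<longlongrightarrow> l) (at_left T)"
  shows "((\<lambda>t. Qe t \<omega>) \<longlongrightarrow> l) (at_left T)"
proof (rule tendstoI)
  fix e :: real assume e: "0 < e"
  have "eventually (\<lambda>t. dist (\<Xi> t \<omega>) l < e / 2) (at_left T)" using tendstoD[OF l, of "e / 2"] e by simp
  then obtain a' where a': "a' < T" "\<And>t. a' < t \<Longrightarrow> t < T \<Longrightarrow> \<bar>\<Xi> t \<omega> - l\<bar> < e / 2"
    unfolding eventually_at_left_field dist_real_def by blast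
  \<comment> \<open>Midway between \<open>max a' S\<close> and \<open>T\<close>: strictly beyond
    \<open>a'\<close>, so that \<open>\<Xi>\<close> is near \<open>l\<close> on the whole of
    \<open>{a..t}\<close>, and inside the second phase.\<close>
  define a where "a = (max a' S + T) / 2"
  have a: "a' < a" "S \<le> a" "a < T" using a'(1) S_bounds by (auto simp: a_def)
  define C where "C = \<bar>V a \<omega> - l / (T - a)\<bar>"
  have bound: "\<bar>Qe t \<omega> - l\<bar> \<le> (T - t) * C + e / 2" if t: "a \<le> t" "t < T" for t
  proof -
    have Pl: "primitive_on a t (\<lambda>s. 1 / (T - s)\<^sup>2 * k) (\<lambda>s. 1 / (T - s) * k)" for k
    proof -
      have "primitive_on a t (\<lambda>_. 0) (\<lambda>_. k)" by (rule primitive_on_C1) auto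
      from primitive_on_mult[OF primitive_inverse_distance[OF t(2)] this] show ?thesis by simp
    qed
    have PV: "primitive_on a t (\<lambda>s. \<Xi> s \<omega> / (T - s)\<^sup>2) (\<lambda>s. V s \<omega>)"
      by (rule primitive_on_subinterval[OF V_primitive[OF \<omega> t(2)] a(2) order_refl])
    let ?h = "\<lambda>s. \<Xi> s \<omega> / (T - s)\<^sup>2 - 1 / (T - s)\<^sup>2 * l"
    have i: "set_integrable lborel {a..t} (\<lambda>s. 1 / (T - s)\<^sup>2 * k)" for k by (rule primitive_on_integrable[OF Pl])
    have iX: "set_integrable lborel {a..t} (\<lambda>s. \<Xi> s \<omega> / (T - s)\<^sup>2)" by (rule primitive_on_integrable[OF PV])
    have ih: "set_integrable lborel {a..t} ?h" by (rule set_integral_diff(1)[OF iX i])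
    have "\<bar>LINT s:{a..t}|lborel. ?h s\<bar> \<le> (LINT s:{a..t}|lborel. \<bar>?h s\<bar>)"
      using set_integral_norm_bound[OF ih] by simp
    also have "\<dots> \<le> (LINT s:{a..t}|lborel. 1 / (T - s)\<^sup>2 * (e / 2))"
    proof (rule set_integral_mono)
      show "set_integrable lborel {a..t} (\<lambda>s. \<bar>?h s\<bar>)" by (rule set_integrable_abs[OF ih])
      show "set_integrable lborel {a..t} (\<lambda>s. 1 / (T - s)\<^sup>2 * (e / 2))" by (rule i)
      fix s assume s: "s \<in> {a..t}"
      have "\<bar>?h s\<bar> = 1 / (T - s)\<^sup>2 * \<bar>\<Xi> s \<omega> - l\<bar>"
        by (simp add: diff_divide_distrib[symmetric] abs_divide)
      also have "\<dots> \<le> 1 / (T - s)\<^sup>2 * (e / 2)"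
        using a'(2)[of s] s a t by (intro mult_left_mono) auto
      finally show "\<bar>?h s\<bar> \<le> 1 / (T - s)\<^sup>2 * (e / 2)" .
    qed
    also have "\<dots> = (1 / (T - t) - 1 / (T - a)) * (e / 2)"
      by (simp only: left_diff_distrib primitive_on_eq[OF Pl[of "e / 2"] t(1) order_refl] add_diff_cancel_left')
    also have "\<dots> \<le> 1 / (T - t) * (e / 2)" using a e by (intro mult_right_mono) auto
    finally have h: "\<bar>LINT s:{a..t}|lborel. ?h s\<bar> \<le> 1 / (T - t) * (e / 2)" .
    have "V t \<omega> - 1 / (T - t) * l = V a \<omega> - 1 / (T - a) * l + (LINT s:{a..t}|lborel. ?h s)"
      using primitive_on_eq[OF PV t(1) order_refl] primitive_on_eq[OF Pl[of l] t(1) order_refl] set_integral_diff(2)[OF iX i[of l]]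
      by simp
    moreover have "Qe t \<omega> - l = (T - t) * (V t \<omega> - 1 / (T - t) * l)"
      using Qe_second[of t] a t by (simp add: right_diff_distrib)
    ultimately have "\<bar>Qe t \<omega> - l\<bar> = (T - t) * \<bar>(V a \<omega> - 1 / (T - a) * l) + (LINT s:{a..t}|lborel. ?h s)\<bar>"
      using t by (simp add: abs_mult)
    also have "\<dots> \<le> (T - t) * (C + 1 / (T - t) * (e / 2))"
      using h t unfolding C_def by (intro mult_left_mono) (auto intro!: order_trans[OF abs_triangle_ineq])
    also have "\<dots> = (T - t) * C + e / 2"
    proof -
      have "d * (C + 1 / d * (e / 2)) = d * C + e / 2" if "d \<noteq> 0" for d
        using that by (simp add: field_simps)
      from this[of "T - t"] show ?thesis using t by linarith
    qed
    finally show ?thesis .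
  qed
  have "((\<lambda>t. (T - t) * C) \<longlongrightarrow> (T - T) * C) (at_left T)" by (intro tendsto_intros)
  then have "eventually (\<lambda>t. (T - t) * C < e / 2) (at_left T)"
    using e by (intro order_tendstoD(2)) auto
  moreover have "eventually (\<lambda>t. a < t \<and> t < T) (at_left T)"
    unfolding eventually_at_left_field using a(3) by (intro exI[of _ a]) auto
  ultimately show "eventually (\<lambda>t. dist (Qe t \<omega>) l < e) (at_left T)"
  proof eventually_elim
    case (elim t)
    then show ?case using bound[of t] by (simp add: dist_real_def)
  qed
qed

lemma Qe_continuous: "\<omega> \<in> space P \<Longrightarrow> b < T \<Longrightarrow> continuous_on {0..b} (\<lambda>t. Qe t \<omega>)"
proof -
  assume \<omega>: "\<omega> \<in> space P" and b: "b < T"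
  have "continuous_on {0..max b S} (\<lambda>t. Qe t \<omega>)"
    using b S_bounds by (intro primitive_on_continuous[OF Qe_primitive[OF \<omega>]]) auto
  then show ?thesis by (rule continuous_on_subset) auto
qed

text \<open>Valid for every scenario: at \<open>T\<close> a left limit is enough, and it is
  inherited from \<open>\<Xi>\<close> even where \<open>\<Xi>\<close> jumps.\<close>

lemma Qe_path:
  assumes \<omega>: "\<omega> \<in> space P"
  shows "cadlag_on 0 T (\<lambda>t. Qe t \<omega>)"
  unfolding cadlag_on_def
proof (intro conjI ballI)
  have c: "cadlag_on 0 b (\<lambda>t. Qe t \<omega>)" if "b < T" for b
    by (rule continuous_on_imp_cadlag_on[OF Qe_continuous[OF \<omega> that]])
  show "((\<lambda>t. Qe t \<omega>) \<longlongrightarrow> Qe t \<omega>) (at_right t)" if "t \<in> {0..<T}" for t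
    using c[of "(t + T) / 2"] that unfolding cadlag_on_def by simp
  show "\<exists>l. ((\<lambda>t. Qe t \<omega>) \<longlongrightarrow> l) (at_left t)" if t: "t \<in> {0<..T}" for t
  proof (cases "t = T")
    case False
    then show ?thesis using c[of "(t + T) / 2"] t unfolding cadlag_on_def by simp
  next
    case True
    obtain l where "((\<lambda>t. \<Xi> t \<omega>) \<longlongrightarrow> l) (at_left T)"
      using Xi_path[OF \<omega>] t True unfolding cadlag_on_def by blast
    then show ?thesis using Qe_left_limit[OF \<omega>] True by blast
  qed
qed

lemma Qe_adapted: assumes t: "t \<in> {0..T}" shows "Qe t \<in> borel_measurable (F t)"
proof -
  have pQ: "prog_measurable F T Q0" and pX: "prog_measurable F T \<Xi>"
    by (intro cadlag_adapted_prog_measurable Q0_cadlag_adapted Xi_cadlag_adapted)+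
  have Qb: "(\<lambda>\<omega>. Qbar \<epsilon> Q0 s \<omega>) \<in> borel_measurable (F s)" if "s \<in> {0..T}" for s
    unfolding Qbar_def by (intro borel_measurable_times borel_measurable_const weighted_integral_measurable[OF pQ that]) measurable
  consider "t \<le> S" | "S < t" "t < T" | "t = T" using t by fastforce
  then show ?thesis
  proof cases
    case 1
    then show ?thesis using Qb[OF t] by (simp add: Qe_first cong: measurable_cong)
  next
    case 2
    have QS: "(\<lambda>\<omega>. Qbar \<epsilon> Q0 S \<omega>) \<in> borel_measurable (F t)"
      using 2 S_bounds by (intro F_le[OF _ _ _ Qb]) auto
    \<comment> \<open>The lower limit \<open>S\<close> is absorbed into the weight, so that the
      measurability lemma for integrals from 0 applies.\<close>
    have "(\<lambda>\<omega>. LINT r:{0..t}|lborel. (indicator {S..} r / (T - r)\<^sup>2) * \<Xi> r \<omega>) \<in> borel_measurable (F t)"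
      by (rule weighted_integral_measurable[OF pX t]) measurable
    moreover have "(LINT r:{0..t}|lborel. (indicator {S..} r / (T - r)\<^sup>2) * \<Xi> r \<omega>) = (LINT r:{S..t}|lborel. \<Xi> r \<omega> / (T - r)\<^sup>2)" for \<omega>
      unfolding set_lebesgue_integral_def
      by (intro Bochner_Integration.integral_cong) (use S_bounds in \<open>auto simp: indicator_def\<close>)
    ultimately have "(\<lambda>\<omega>. V t \<omega>) \<in> borel_measurable (F t)" unfolding V_def using QS by simp
    then have "(\<lambda>\<omega>. (T - t) * V t \<omega>) \<in> borel_measurable (F t)" by simp
    then show ?thesis using Qe_second[of t] 2 by (subst measurable_cong[where g = "\<lambda>\<omega>. (T - t) * V t \<omega>"]) auto
  next
    case 3
    show ?thesis unfolding 3 using Xi_F[OF T_in] by (simp add: Qe_T cong: measurable_cong)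
  qed
qed

lemma Qe_cadlag_adapted: "cadlag_adapted P F T Qe"
  using Qe_path Qe_adapted by (simp add: cadlag_adapted_def adapted_def)

text \<open>On the path, \<open>U = W - (T - t) * x\<close>, where \<open>x\<close> is the density
  of \<open>W\<close>. Expanding the square, \<open>(U t \<omega>)\<^sup>2\<close> is the square of
  \<open>(T - t) * x\<close> minus \<open>?z\<close>, the density of \<open>(T - t) * W^2\<close>;
  integration gives an identity with boundary terms. Stopping at \<open>b < T\<close> keeps all
  integrals away from the singularity.\<close>

lemma second_phase_energy:
  assumes \<omega>: "\<omega> \<in> space P" and b: "S \<le> b" "b < T"
  shows "set_integrable lborel {S..b} (\<lambda>t. (U t \<omega>)\<^sup>2)"
    and "set_integrable lborel {S..b} (\<lambda>t. ((\<Xi> T \<omega> - \<Xi> t \<omega>) / (T - t))\<^sup>2)"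
    and "(LINT t:{S..b}|lborel. (U t \<omega>)\<^sup>2) \<le>
      (\<Xi> T \<omega> - Qbar \<epsilon> Q0 S \<omega>)\<^sup>2 / \<delta> + (LINT t:{S..b}|lborel. ((\<Xi> T \<omega> - \<Xi> t \<omega>) / (T - t))\<^sup>2)"
proof -
  define W where "W t = \<Xi> T \<omega> / (T - t) - V t \<omega>" for t
  define x where "x t = (\<Xi> T \<omega> - \<Xi> t \<omega>) / (T - t)\<^sup>2" for t
  have PW: "primitive_on S b x W"
  proof -
    have "primitive_on S b (\<lambda>_. 0) (\<lambda>_. \<Xi> T \<omega>)" by (rule primitive_on_C1) auto
    from primitive_on_mult[OF primitive_inverse_distance[OF b(2)] this]
    have PT: "primitive_on S b (\<lambda>t. 1 / (T - t)\<^sup>2 * \<Xi> T \<omega>) (\<lambda>t. 1 / (T - t) * \<Xi> T \<omega>)" by simp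
    note PV = V_primitive[OF \<omega> b(2)]
    show ?thesis
    proof (rule primitive_onI)
      have "set_integrable lborel {S..b} (\<lambda>t. 1 / (T - t)\<^sup>2 * \<Xi> T \<omega> - \<Xi> t \<omega> / (T - t)\<^sup>2)"
        by (rule set_integral_diff(1)[OF primitive_on_integrable[OF PT] primitive_on_integrable[OF PV]])
      then show xi: "set_integrable lborel {S..b} x" by (simp add: x_def[abs_def] diff_divide_distrib)
      fix t assume t: "S \<le> t" "t \<le> b"
      have "(LINT s:{S..t}|lborel. x s) = (LINT s:{S..t}|lborel. 1 / (T - s)\<^sup>2 * \<Xi> T \<omega> - \<Xi> s \<omega> / (T - s)\<^sup>2)"
        by (simp add: x_def diff_divide_distrib)
      also have "\<dots> = (LINT s:{S..t}|lborel. 1 / (T - s)\<^sup>2 * \<Xi> T \<omega>) - (LINT s:{S..t}|lborel. \<Xi> s \<omega> / (T - s)\<^sup>2)"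
        by (intro set_integral_diff(2) set_integrable_subset[OF primitive_on_integrable[OF PT]]
            set_integrable_subset[OF primitive_on_integrable[OF PV]]) (use t in auto)
      finally show "W t = W S + (LINT s:{S..t}|lborel. x s)"
        using primitive_on_eq[OF PT t] primitive_on_eq[OF PV t] by (simp add: W_def)
    qed
  qed
  note PZ = primitive_on_mult[OF primitive_distance[of S b T] primitive_on_mult[OF PW PW]]
  let ?z = "\<lambda>s. - 1 * (W s * W s) + (T - s) * (x s * W s + W s * x s)"
  have iX: "set_integrable lborel {S..b} (\<lambda>t. ((\<Xi> T \<omega> - \<Xi> t \<omega>) / (T - t))\<^sup>2)"
  proof -
    have cad: "cadlag_on 0 T (\<lambda>t. (\<Xi> T \<omega> - \<Xi> t \<omega>)\<^sup>2)"
      by (rule cadlag_on_compose[OF Xi_path[OF \<omega>], of "\<lambda>x. (\<Xi> T \<omega> - x)\<^sup>2"]) (intro continuous_intros)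
    have "set_integrable lborel {S..b} (\<lambda>t. 1 / (T - t)\<^sup>2 * (\<Xi> T \<omega> - \<Xi> t \<omega>)\<^sup>2)"
      using b S_bounds by (intro set_integrable_continuous_times_cadlag[OF cad] continuous_intros) auto
    then show ?thesis by (simp add: power_divide)
  qed
  then show "set_integrable lborel {S..b} (\<lambda>t. ((\<Xi> T \<omega> - \<Xi> t \<omega>) / (T - t))\<^sup>2)" .
  have U_eq: "(U t \<omega>)\<^sup>2 = ((\<Xi> T \<omega> - \<Xi> t \<omega>) / (T - t))\<^sup>2 - ?z t" if t: "t \<in> {S..b}" for t
  proof -
    have "U t \<omega> = (\<Xi> t \<omega> - (T - t) * V t \<omega>) / (T - t)" using t b by (simp add: U_second Qe_second)
    also have "\<dots> = W t - (T - t) * x t"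
    proof -
      have "(p - d * v) / d = q / d - v - d * ((q - p) / d\<^sup>2)" if "d \<noteq> 0" for d p q v :: real
        using that by (simp add: field_simps power2_eq_square)
      then show ?thesis using t b unfolding W_def x_def by simp
    qed
    finally have U: "U t \<omega> = W t - (T - t) * x t" .
    have "(\<Xi> T \<omega> - \<Xi> t \<omega>) / (T - t) = (T - t) * x t" using t b by (simp add: x_def power2_eq_square)
    then show ?thesis unfolding U by (simp only: power2_eq_square) (simp add: algebra_simps)
  qed
  note iz = primitive_on_integrable[OF PZ]
  have "set_integrable lborel {S..b} (\<lambda>t. ((\<Xi> T \<omega> - \<Xi> t \<omega>) / (T - t))\<^sup>2 - ?z t)"
    by (rule set_integral_diff(1)[OF iX iz])
  moreover have cong: "indicator {S..b} t *\<^sub>R (U t \<omega>)\<^sup>2 = indicator {S..b} t *\<^sub>R (((\<Xi> T \<omega> - \<Xi> t \<omega>) / (T - t))\<^sup>2 - ?z t)" for t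
    using U_eq[of t] by (cases "t \<in> {S..b}") auto
  ultimately show "set_integrable lborel {S..b} (\<lambda>t. (U t \<omega>)\<^sup>2)"
    unfolding set_integrable_def by (simp only: cong)
  have "(LINT t:{S..b}|lborel. (U t \<omega>)\<^sup>2) = (LINT t:{S..b}|lborel. ((\<Xi> T \<omega> - \<Xi> t \<omega>) / (T - t))\<^sup>2 - ?z t)"
    unfolding set_lebesgue_integral_def by (simp only: cong)
  also have "\<dots> = (LINT t:{S..b}|lborel. ((\<Xi> T \<omega> - \<Xi> t \<omega>) / (T - t))\<^sup>2) - (LINT t:{S..b}|lborel. ?z t)"
    by (rule set_integral_diff(2)[OF iX iz])
  \<comment> \<open>The boundary term at \<open>b\<close> enters the energy with a minus sign and is
    dropped at the end; the one at \<open>S\<close> becomes the initial gap, squared and divided by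
    \<open>\<delta>\<close>.\<close>
  also have "(LINT t:{S..b}|lborel. ?z t) = (T - b) * (W b * W b) - (T - S) * (W S * W S)"
    using primitive_on_eq[OF PZ b(1) order_refl] by linarith
  also have "(T - S) * (W S * W S) = (\<Xi> T \<omega> - Qbar \<epsilon> Q0 S \<omega>)\<^sup>2 / \<delta>"
  proof -
    have "W S = (\<Xi> T \<omega> - Qbar \<epsilon> Q0 S \<omega>) / \<delta>"
      by (simp add: W_def V_def set_integral_point_zero S_bounds(3)[symmetric] diff_divide_distrib)
    then show ?thesis using \<delta>_pos by (simp add: S_bounds(3)[symmetric] power2_eq_square)
  qed
  finally show "(LINT t:{S..b}|lborel. (U t \<omega>)\<^sup>2) \<le>
      (\<Xi> T \<omega> - Qbar \<epsilon> Q0 S \<omega>)\<^sup>2 / \<delta> + (LINT t:{S..b}|lborel. ((\<Xi> T \<omega> - \<Xi> t \<omega>) / (T - t))\<^sup>2)"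
    using b mult_nonneg_nonneg[of "T - b" "W b * W b"] by simp
qed

end


section \<open>Trading rates\<close>

text \<open>On an interval of finite length, \<open>\<bar>f t\<bar>\<close> is dominated by
  \<open>1 + (f t)\<^sup>2\<close>.\<close>

lemma square_integrable_imp_set_integrable:
  fixes f :: "real \<Rightarrow> real"
  assumes m: "(\<lambda>t. indicator {a..b} t *\<^sub>R f t) \<in> borel_measurable borel"
    and fin: "(\<integral>\<^sup>+t\<in>{a..b}. ennreal ((f t)\<^sup>2) \<partial>lborel) < \<infinity>"
  shows "set_integrable lborel {a..b} f"
  unfolding set_integrable_def
proof (rule integrableI_bounded)
  show "(\<lambda>t. indicator {a..b} t *\<^sub>R f t) \<in> borel_measurable lborel" using m by simp
  have "(\<integral>\<^sup>+t. ennreal (norm (indicator {a..b} t *\<^sub>R f t)) \<partial>lborel)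
      \<le> (\<integral>\<^sup>+t. indicator {a..b} t + ennreal ((indicator {a..b} t *\<^sub>R f t)\<^sup>2) \<partial>lborel)"
  proof (rule nn_integral_mono)
    fix t
    have "0 \<le> (\<bar>f t\<bar> - 1)\<^sup>2 + \<bar>f t\<bar>" by simp
    then have "\<bar>f t\<bar> \<le> 1 + (f t)\<^sup>2" by (simp add: power2_diff)
    then have "ennreal \<bar>f t\<bar> \<le> ennreal (1 + (f t)\<^sup>2)" by (rule ennreal_leI)
    also have "\<dots> = 1 + ennreal ((f t)\<^sup>2)" by (simp add: ennreal_plus)
    finally show "ennreal (norm (indicator {a..b} t *\<^sub>R f t)) \<le> indicator {a..b} t + ennreal ((indicator {a..b} t *\<^sub>R f t)\<^sup>2)"
      by (auto simp: indicator_def)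
  qed
  also have "\<dots> = (\<integral>\<^sup>+t. indicator {a..b} t \<partial>(lborel :: real measure)) + (\<integral>\<^sup>+t. ennreal ((indicator {a..b} t *\<^sub>R f t)\<^sup>2) \<partial>lborel)"
    using m by (intro nn_integral_add) auto
  also have "(\<integral>\<^sup>+t. ennreal ((indicator {a..b} t *\<^sub>R f t)\<^sup>2) \<partial>lborel) = (\<integral>\<^sup>+t\<in>{a..b}. ennreal ((f t)\<^sup>2) \<partial>lborel)"
    by (intro nn_integral_cong) (auto simp: indicator_def)
  also have "(\<integral>\<^sup>+t. indicator {a..b} t \<partial>(lborel :: real measure)) + (\<integral>\<^sup>+t\<in>{a..b}. ennreal ((f t)\<^sup>2) \<partial>lborel) < \<infinity>"
    using fin by (auto simp: emeasure_lborel_Icc_eq less_top[symmetric])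
  finally show "(\<integral>\<^sup>+t. ennreal (norm (indicator {a..b} t *\<^sub>R f t)) \<partial>lborel) < \<infinity>" .
qed

lemma square_set_integral_le:
  fixes f :: "real \<Rightarrow> real"
  assumes i: "set_integrable lborel {a..b} f" and ab: "a \<le> b"
    and m: "(\<lambda>t. indicator {a..b} t *\<^sub>R f t) \<in> borel_measurable borel"
  shows "ennreal ((LINT t:{a..b}|lborel. f t)\<^sup>2) \<le> ennreal (b - a) * (\<integral>\<^sup>+t\<in>{a..b}. ennreal ((f t)\<^sup>2) \<partial>lborel)"
proof -
  let ?f = "\<lambda>t. indicator {a..b} t *\<^sub>R f t"
  have [measurable]: "(\<lambda>t. ennreal \<bar>?f t\<bar>) \<in> borel_measurable lborel"
    using borel_measurable_abs[OF m] by simp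
  have "ennreal \<bar>LINT t:{a..b}|lborel. f t\<bar> \<le> (\<integral>\<^sup>+t. ennreal (norm (?f t)) \<partial>lborel)"
    unfolding set_lebesgue_integral_def
    using integral_norm_bound_ennreal[of lborel ?f] i by (simp add: set_integrable_def)
  also have "\<dots> = (\<integral>\<^sup>+t. indicator {a..b} t * ennreal \<bar>?f t\<bar> \<partial>lborel)"
    by (intro nn_integral_cong) (auto simp: indicator_def)
  finally have "ennreal \<bar>LINT t:{a..b}|lborel. f t\<bar> ^ 2 \<le> (\<integral>\<^sup>+t. indicator {a..b} t * ennreal \<bar>?f t\<bar> \<partial>lborel) ^ 2"
    by (rule power_mono) simp
  also have "\<dots> \<le> (\<integral>\<^sup>+t. indicator {a..b} t ^ 2 \<partial>lborel) * (\<integral>\<^sup>+t. ennreal \<bar>?f t\<bar> ^ 2 \<partial>lborel)"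
    by (rule Cauchy_Schwarz_nn_integral) measurable
  also have "(\<integral>\<^sup>+t. (indicator {a..b} t :: ennreal) ^ 2 \<partial>lborel) = ennreal (b - a)"
  proof -
    have "(\<integral>\<^sup>+t. (indicator {a..b} t :: ennreal) ^ 2 \<partial>lborel) = (\<integral>\<^sup>+t. indicator {a..b} t \<partial>lborel)"
      by (intro nn_integral_cong) (auto simp: indicator_def)
    then show ?thesis using ab by simp
  qed
  also have "(\<integral>\<^sup>+t. ennreal \<bar>?f t\<bar> ^ 2 \<partial>lborel) = (\<integral>\<^sup>+t\<in>{a..b}. ennreal ((f t)\<^sup>2) \<partial>lborel)"
    by (intro nn_integral_cong) (auto simp: indicator_def ennreal_power)
  finally show ?thesis by (simp add: ennreal_power)
qed

lemma ennreal_square_diff_le: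
  fixes a b :: real
  shows "ennreal ((a - b)\<^sup>2) \<le> 2 * ennreal (a\<^sup>2) + 2 * ennreal (b\<^sup>2)"
proof -
  have "(a - b)\<^sup>2 \<le> 2 * a\<^sup>2 + 2 * b\<^sup>2"
    using zero_le_power2[of "a + b"] unfolding power2_diff power2_sum by linarith
  then have "ennreal ((a - b)\<^sup>2) \<le> ennreal (2 * a\<^sup>2 + 2 * b\<^sup>2)" by (rule ennreal_leI)
  then show ?thesis by (simp add: ennreal_plus ennreal_mult)
qed

context usual_filtered_prob_space
begin

lemma prog_measurable_joint:
  assumes "prog_measurable F T X"
  shows "(\<lambda>p. X (max 0 (min T (snd p))) (fst p)) \<in> borel_measurable (P \<Otimes>\<^sub>M lborel)"
proof -
  have "(\<lambda>p. (snd p, fst p)) \<in> P \<Otimes>\<^sub>M lborel \<rightarrow>\<^sub>M borel \<Otimes>\<^sub>M P" by measurable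
  from measurable_compose[OF this prog_measurable_clip_P[OF assms]] show ?thesis by simp
qed

lemma prog_measurable_path:
  assumes "prog_measurable F T X" "\<omega> \<in> space P"
  shows "(\<lambda>t. X (max 0 (min T t)) \<omega>) \<in> borel_measurable borel"
  using measurable_Pair2[OF prog_measurable_joint[OF assms(1)] assms(2)] by simp

lemma prog_measurable_path_indicator:
  assumes "prog_measurable F T X" "\<omega> \<in> space P"
  shows "(\<lambda>t. indicator {0..T} t *\<^sub>R X t \<omega>) \<in> borel_measurable borel"
proof -
  note [measurable] = prog_measurable_path[OF assms]
  have "(\<lambda>t. indicator {0..T} t *\<^sub>R X (max 0 (min T t)) \<omega>) \<in> borel_measurable borel" by measurable
  then show ?thesis
    by (rule back_subst[of "\<lambda>f. f \<in> borel_measurable borel"]) (auto simp: indicator_def fun_eq_iff)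
qed

lemma prog_measurable_square_energy:
  assumes "prog_measurable F T X"
  shows "(\<lambda>\<omega>. energy {0..T} X \<omega>) \<in> borel_measurable P"
proof -
  note [measurable] = prog_measurable_joint[OF assms]
  have "(\<lambda>p. ennreal ((X (max 0 (min T (snd p))) (fst p))\<^sup>2) * indicator {0..T} (snd p)) \<in> borel_measurable (P \<Otimes>\<^sub>M lborel)"
    by measurable
  from lborel.borel_measurable_nn_integral_fst[OF this]
  have "(\<lambda>\<omega>. \<integral>\<^sup>+t. ennreal ((X (max 0 (min T t)) \<omega>)\<^sup>2) * indicator {0..T} t \<partial>lborel) \<in> borel_measurable P" by simp
  moreover have "(\<integral>\<^sup>+t. ennreal ((X (max 0 (min T t)) \<omega>)\<^sup>2) * indicator {0..T} t \<partial>lborel) = energy {0..T} X \<omega>" for \<omega>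
    by (intro nn_integral_cong) (auto simp: indicator_def)
  ultimately show ?thesis by simp
qed

lemma trading_rate_AE_set_integrable:
  assumes "trading_rate P F T Q u"
  shows "AE \<omega> in P. set_integrable lborel {0..T} (\<lambda>t. u t \<omega>)"
proof -
  have pu: "prog_measurable F T u"
    and fin: "(\<integral>\<^sup>+\<omega>. energy {0..T} u \<omega> \<partial>P) < \<infinity>"
    using assms by (auto simp: trading_rate_def)
  have "AE \<omega> in P. energy {0..T} u \<omega> \<noteq> \<infinity>"
    using fin by (intro nn_integral_PInf_AE prog_measurable_square_energy[OF pu]) auto
  then show ?thesis using AE_space
  proof eventually_elim
    case (elim \<omega>)
    then show ?case
      by (intro square_integrable_imp_set_integrable prog_measurable_path_indicator[OF pu]) (auto simp: top.not_eq_extremum)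
  qed
qed

lemma trading_rate_AE_primitive:
  assumes "trading_rate P F T Q u"
  shows "AE \<omega> in P. primitive_on 0 T (\<lambda>t. u t \<omega>) (\<lambda>t. Q t \<omega>) \<and> Q 0 \<omega> = 0"
proof -
  have "AE \<omega> in P. \<forall>t\<in>{0..T}. Q t \<omega> = (LINT s:{0..t}|lborel. u s \<omega>)"
    using assms by (simp add: trading_rate_def)
  with trading_rate_AE_set_integrable[OF assms] show ?thesis
  proof eventually_elim
    case (elim \<omega>)
    have eq: "Q t \<omega> = (LINT s:{0..t}|lborel. u s \<omega>)" if "0 \<le> t" "t \<le> T" for t
      using elim(2) that by auto
    have "Q 0 \<omega> = (LINT s:{0..0}|lborel. u s \<omega>)" using eq[of 0] horizon_pos by simp
    also have "\<dots> = 0" by (simp add: set_integral_point_zero)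
    finally have "Q 0 \<omega> = 0" .
    moreover from this have "primitive_on 0 T (\<lambda>t. u t \<omega>) (\<lambda>t. Q t \<omega>)"
      by (intro primitive_onI elim(1)) (simp only: eq)
    ultimately show ?case by simp
  qed
qed

text \<open>The difference of two rates has a vanishing indefinite integral. This allows statements
  about an arbitrary rate of a strategy to be proved for one particular rate.\<close>

lemma trading_rate_unique:
  assumes u: "trading_rate P F T Q u" and v: "trading_rate P F T Q v"
  shows "AE \<omega> in P. AE t in lborel. t \<in> {0..T} \<longrightarrow> u t \<omega> = v t \<omega>"
  using trading_rate_AE_primitive[OF u] trading_rate_AE_primitive[OF v]
proof eventually_elim
  case (elim \<omega>)
  note Pu = conjunct1[OF elim(1)] and Pv = conjunct1[OF elim(2)]
  have "AE t in lborel. t \<in> {0..T} \<longrightarrow> u t \<omega> - v t \<omega> = 0"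
  proof (rule indefinite_integral_zero_imp_AE_zero)
    show "set_integrable lborel {0..T} (\<lambda>t. u t \<omega> - v t \<omega>)"
      by (rule set_integral_diff(1)[OF primitive_on_integrable[OF Pu] primitive_on_integrable[OF Pv]])
    fix t assume t: "t \<in> {0..T}"
    have "(LINT s:{0..t}|lborel. u s \<omega> - v s \<omega>) = (LINT s:{0..t}|lborel. u s \<omega>) - (LINT s:{0..t}|lborel. v s \<omega>)"
      by (intro set_integral_diff(2) set_integrable_subset[OF primitive_on_integrable[OF Pu]]
          set_integrable_subset[OF primitive_on_integrable[OF Pv]]) (use t in auto)
    also have "\<dots> = 0"
      using primitive_on_eq[OF Pu, of t] primitive_on_eq[OF Pv, of t] t by simp
    finally show "(LINT s:{0..t}|lborel. u s \<omega> - v s \<omega>) = 0" .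
  qed
  then show ?case by eventually_elim simp
qed

text \<open>Passing from almost every section to the product measure requires a measurable
  exceptional set, which the clipped rates provide.\<close>

lemma trading_rate_unique_joint:
  assumes u: "trading_rate P F T Q u" and v: "trading_rate P F T Q v"
  shows "AE (\<omega>, t) in P \<Otimes>\<^sub>M lborel. t \<in> {0..T} \<longrightarrow> u t \<omega> = v t \<omega>"
proof -
  interpret PL: pair_sigma_finite P "lborel :: real measure" ..
  have pu: "prog_measurable F T u" and pv: "prog_measurable F T v"
    using u v by (auto simp: trading_rate_def)
  note [measurable] = prog_measurable_joint[OF pu] prog_measurable_joint[OF pv]
  have "AE p in P \<Otimes>\<^sub>M lborel. snd p \<in> {0..T} \<longrightarrow>
      u (max 0 (min T (snd p))) (fst p) = v (max 0 (min T (snd p))) (fst p)"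
  proof (rule PL.AE_pair_measure)
    show "{p \<in> space (P \<Otimes>\<^sub>M lborel). snd p \<in> {0..T} \<longrightarrow>
      u (max 0 (min T (snd p))) (fst p) = v (max 0 (min T (snd p))) (fst p)} \<in> sets (P \<Otimes>\<^sub>M lborel)"
      by measurable
    show "AE \<omega> in P. AE t in lborel. snd (\<omega>, t) \<in> {0..T} \<longrightarrow>
      u (max 0 (min T (snd (\<omega>, t)))) (fst (\<omega>, t)) = v (max 0 (min T (snd (\<omega>, t)))) (fst (\<omega>, t))"
      using trading_rate_unique[OF u v]
    proof eventually_elim
      case (elim \<omega>)
      then show ?case by eventually_elim (auto simp: max_def min_def)
    qed
  qed
  moreover have "max 0 (min T t) = t" if "t \<in> {0..T}" for t using that by auto
  ultimately show ?thesis by (auto simp: split_beta' elim!: eventually_mono)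
qed

text \<open>The martingale part is 0, localized by the constant \<open>T\<close>, and
  \<open>A\<close> is its own finite-variation part. The decomposition lists the initial value
  separately, so \<open>A 0\<close> must vanish in order not to be counted twice.\<close>

lemma finite_variation_semimartingale:
  assumes A: "cadlag_adapted P F T A" and fv: "AE \<omega> in P. finite_variation_on 0 T (\<lambda>t. A t \<omega>)"
    and A0: "AE \<omega> in P. A 0 \<omega> = 0"
  shows "semimartingale P F T A"
proof -
  let ?N = "\<lambda>t \<omega>. 0 :: real"
  have c: "cadlag_adapted P F T ?N"
    by (auto simp: cadlag_adapted_def adapted_def cadlag_on_def intro: tendsto_const)
  have "AE \<omega> in P. real_cond_exp P (F s) (\<lambda>\<omega>. 0) \<omega> = 0" if s: "s \<in> {0..T}" for s
  proof -
    interpret finite_measure_subalgebra P "F s"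
      using F_subalgebra[OF s] by unfold_locales
    show ?thesis by (rule real_cond_exp_F_meas) auto
  qed
  then have "cadlag_martingale P F T ?N"
    using c by (auto simp: cadlag_martingale_def)
  then have "local_martingale0 P F T ?N"
    using c horizon_pos unfolding local_martingale0_def by (intro conjI exI[of _ "\<lambda>n \<omega>. T"]) auto
  moreover have "AE \<omega> in P. \<forall>t\<in>{0..T}. A t \<omega> = A 0 \<omega> + 0 + A t \<omega>"
    using A0 by eventually_elim simp
  ultimately show ?thesis
    unfolding semimartingale_def using A fv by (intro conjI exI[of _ ?N] exI[of _ A]) auto
qed

text \<open>By Cauchy-Schwarz every squared position is at most \<open>T\<close> times the energy of
  the rate, uniformly in time; this makes the supremum integrable. Being a primitive of the rate,
  the path has finite variation, whence the semimartingale property.\<close>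

lemma trading_rate_imp_ac_strategy:
  assumes Q: "cadlag_adapted P F T Q" and u: "trading_rate P F T Q u" and QT: "AE \<omega> in P. Q T \<omega> = \<Xi> T \<omega>"
  shows "Q \<in> ac_strategies P F T \<Xi>"
proof -
  have pu: "prog_measurable F T u"
    and fin: "(\<integral>\<^sup>+\<omega>. energy {0..T} u \<omega> \<partial>P) < \<infinity>"
    using u by (auto simp: trading_rate_def)
  note prim = trading_rate_AE_primitive[OF u]
  have "semimartingale P F T Q"
  proof (rule finite_variation_semimartingale[OF Q])
    show "AE \<omega> in P. finite_variation_on 0 T (\<lambda>t. Q t \<omega>)"
      using prim by eventually_elim (auto intro: primitive_on_bounded_variation)
    show "AE \<omega> in P. Q 0 \<omega> = 0" using prim by eventually_elim simp
  qed
  moreover have "(\<integral>\<^sup>+\<omega>. (SUP t\<in>{0..T}. ennreal ((Q t \<omega>)\<^sup>2)) \<partial>P) < \<infinity>"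
  proof -
    have "(\<integral>\<^sup>+\<omega>. (SUP t\<in>{0..T}. ennreal ((Q t \<omega>)\<^sup>2)) \<partial>P)
       \<le> (\<integral>\<^sup>+\<omega>. ennreal T * energy {0..T} u \<omega> \<partial>P)"
    proof (rule nn_integral_mono_AE)
      show "AE \<omega> in P. (SUP t\<in>{0..T}. ennreal ((Q t \<omega>)\<^sup>2)) \<le> ennreal T * energy {0..T} u \<omega>"
        using prim AE_space
      proof eventually_elim
        case (elim \<omega>)
        note Pu = conjunct1[OF elim(1)]
        show ?case
        proof (rule SUP_least)
          fix t assume t: "t \<in> {0..T}"
          have i: "set_integrable lborel {0..t} (\<lambda>s. u s \<omega>)"
            by (rule set_integrable_subset[OF primitive_on_integrable[OF Pu]]) (use t in auto)
          have "(\<lambda>s. indicator {0..t} s *\<^sub>R (indicator {0..T} s *\<^sub>R u s \<omega>)) \<in> borel_measurable borel"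
            using prog_measurable_path_indicator[OF pu elim(2)] by measurable
          then have m: "(\<lambda>s. indicator {0..t} s *\<^sub>R u s \<omega>) \<in> borel_measurable borel"
            by (rule back_subst[of "\<lambda>f. f \<in> borel_measurable borel"]) (use t in \<open>auto simp: indicator_def fun_eq_iff\<close>)
          have "Q t \<omega> = (LINT s:{0..t}|lborel. u s \<omega>)" using primitive_on_eq[OF Pu, of t] elim t by simp
          then have "ennreal ((Q t \<omega>)\<^sup>2) \<le> ennreal (t - 0) * energy {0..t} u \<omega>"
            using square_set_integral_le[OF i _ m] t by simp
          also have "\<dots> \<le> ennreal T * energy {0..T} u \<omega>"
            using t by (intro mult_mono ennreal_leI nn_integral_mono) (auto simp: indicator_def)
          finally show "ennreal ((Q t \<omega>)\<^sup>2) \<le> ennreal T * energy {0..T} u \<omega>" .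
        qed
      qed
    qed
    also have "\<dots> = ennreal T * (\<integral>\<^sup>+\<omega>. energy {0..T} u \<omega> \<partial>P)"
      by (rule nn_integral_cmult[OF prog_measurable_square_energy[OF pu]])
    also have "\<dots> < \<infinity>" using fin by (simp add: ennreal_mult_less_top)
    finally show ?thesis .
  qed
  ultimately show ?thesis using u QT by (auto simp: ac_strategies_def strategies_def)
qed

end


section \<open>Energy of the feedback rate\<close>

context relaxation
begin

lemma prog_Q0: "prog_measurable F T Q0" and prog_Xi: "prog_measurable F T \<Xi>" and prog_Qe: "prog_measurable F T Qe"
  by (intro cadlag_adapted_prog_measurable Q0_cadlag_adapted Xi_cadlag_adapted Qe_cadlag_adapted)+

lemma prog_U: "prog_measurable F T U"
  unfolding prog_measurable_def
proof
  fix t assume t: "t \<in> {0..T}"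
  let ?N = "restrict_space borel {0..t} \<Otimes>\<^sub>M F t"
  have m: "(\<lambda>p. X (fst p) (snd p)) \<in> borel_measurable ?N" if "prog_measurable F T X" for X :: "real \<Rightarrow> 'a \<Rightarrow> real"
    using that t by (auto simp: prog_measurable_def split_beta')
  have [measurable]: "(\<lambda>p. fst p :: real) \<in> borel_measurable ?N"
    using measurable_fst[of "restrict_space borel {0..t}" "F t"] by (simp add: measurable_restrict_space2_iff)
  note [measurable] = m[OF prog_Q0] m[OF prog_Xi] m[OF prog_Qe]
  show "(\<lambda>(s, \<omega>). U s \<omega>) \<in> borel_measurable ?N"
    unfolding feedback_rate_def split_beta' by measurable
qed

text \<open>The endpoint \<open>b\<close> tends to \<open>T\<close> in the pathwise estimate. The
  right-hand side is first enlarged to the integral over all of \<open>{S..<T}\<close>, which may be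
  infinite, so that only the left-hand side has to pass to the limit.\<close>

lemma second_phase_energy_nn:
  assumes \<omega>: "\<omega> \<in> space P"
  shows "energy {S..<T} U \<omega> \<le>
    ennreal (1 / \<delta>) * ennreal ((\<Xi> T \<omega> - Qbar \<epsilon> Q0 S \<omega>)\<^sup>2)
    + target_energy \<omega>" (is "_ \<le> ?R")
proof -
  define b where "b n = T - \<delta> / real (Suc n)" for n
  have b: "S \<le> b n" "b n < T" for n
  proof -
    have "\<delta> / real (Suc n) \<le> \<delta> / 1" using \<delta>_pos by (intro divide_left_mono) auto
    moreover have "0 < \<delta> / real (Suc n)" using \<delta>_pos by simp
    ultimately show "S \<le> b n" "b n < T" by (simp_all add: b_def S_def del: of_nat_Suc)
  qed
  have b_lim: "b \<longlonglongrightarrow> T"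
  proof -
    have "(\<lambda>n. T - \<delta> * inverse (real (Suc n))) \<longlonglongrightarrow> T - \<delta> * 0"
      by (intro tendsto_intros LIMSEQ_inverse_real_of_nat)
    then show ?thesis unfolding b_def divide_inverse by (simp del: of_nat_Suc)
  qed
  show ?thesis
  proof (rule nn_integral_le_limit)
    fix n
    let ?I = "{S..b n}"
    note E = second_phase_energy[OF \<omega> b]
    have "(\<lambda>t. indicator ?I t *\<^sub>R (U t \<omega>)\<^sup>2) \<in> borel_measurable lborel"
      using E(1)[of n] by (simp add: set_integrable_def borel_measurable_integrable)
    then have "(\<lambda>t. ennreal (indicator ?I t *\<^sub>R (U t \<omega>)\<^sup>2)) \<in> borel_measurable lborel" by simp
    then show "(\<lambda>t. ennreal ((U t \<omega>)\<^sup>2) * indicator ?I t) \<in> borel_measurable lborel"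
      by (rule back_subst[of "\<lambda>f. f \<in> borel_measurable lborel"]) (auto simp: indicator_def fun_eq_iff)
  next
    show "AE t in lborel. (\<lambda>n. ennreal ((U t \<omega>)\<^sup>2) * indicator {S..b n} t) \<longlonglongrightarrow> ennreal ((U t \<omega>)\<^sup>2) * indicator {S..<T} t"
    proof (rule AE_I2)
      fix t
      have "eventually (\<lambda>n. ennreal ((U t \<omega>)\<^sup>2) * indicator {S..<T} t = ennreal ((U t \<omega>)\<^sup>2) * indicator {S..b n} t) sequentially"
      proof (cases "t < T")
        case True
        from order_tendstoD(1)[OF b_lim True] show ?thesis
          by eventually_elim (use True in \<open>auto simp: indicator_def\<close>)
      next
        case False
        then show ?thesis using b(2) by (auto simp: indicator_def intro!: always_eventually dest: le_less_trans)
      qed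
      then show "(\<lambda>n. ennreal ((U t \<omega>)\<^sup>2) * indicator {S..b n} t) \<longlonglongrightarrow> ennreal ((U t \<omega>)\<^sup>2) * indicator {S..<T} t"
        by (rule Lim_transform_eventually[OF tendsto_const])
    qed
  next
    have "energy {S..b n} U \<omega> \<le> ?R" for n
    proof -
      note E = second_phase_energy[OF \<omega> b]
      have nn: "(\<integral>\<^sup>+t\<in>{S..b n}. ennreal ((f t)\<^sup>2) \<partial>lborel) = ennreal (LINT t:{S..b n}|lborel. (f t)\<^sup>2)"
        if "set_integrable lborel {S..b n} (\<lambda>t. (f t)\<^sup>2)" for f :: "real \<Rightarrow> real"
      proof -
        have "(\<integral>\<^sup>+t\<in>{S..b n}. ennreal ((f t)\<^sup>2) \<partial>lborel) = (\<integral>\<^sup>+t. ennreal (indicator {S..b n} t *\<^sub>R (f t)\<^sup>2) \<partial>lborel)"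
          by (intro nn_integral_cong) (auto simp: indicator_def)
        also have "\<dots> = ennreal (LINT t:{S..b n}|lborel. (f t)\<^sup>2)"
          unfolding set_lebesgue_integral_def using that by (intro nn_integral_eq_integral) (auto simp: set_integrable_def)
        finally show ?thesis .
      qed
      have "energy {S..b n} U \<omega> = ennreal (LINT t:{S..b n}|lborel. (U t \<omega>)\<^sup>2)"
        by (rule nn[OF E(1)])
      also have "\<dots> \<le> ennreal ((\<Xi> T \<omega> - Qbar \<epsilon> Q0 S \<omega>)\<^sup>2 / \<delta> + (LINT t:{S..b n}|lborel. ((\<Xi> T \<omega> - \<Xi> t \<omega>) / (T - t))\<^sup>2))"
        by (rule ennreal_leI[OF E(3)])
      also have "\<dots> = ennreal ((\<Xi> T \<omega> - Qbar \<epsilon> Q0 S \<omega>)\<^sup>2 / \<delta>) + ennreal (LINT t:{S..b n}|lborel. ((\<Xi> T \<omega> - \<Xi> t \<omega>) / (T - t))\<^sup>2)"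
        using \<delta>_pos by (intro ennreal_plus) (auto simp: set_lebesgue_integral_def intro!: Bochner_Integration.integral_nonneg)
      also have "ennreal ((\<Xi> T \<omega> - Qbar \<epsilon> Q0 S \<omega>)\<^sup>2 / \<delta>) = ennreal (1 / \<delta>) * ennreal ((\<Xi> T \<omega> - Qbar \<epsilon> Q0 S \<omega>)\<^sup>2)"
        using \<delta>_pos by (simp add: ennreal_mult[symmetric])
      also have "ennreal (LINT t:{S..b n}|lborel. ((\<Xi> T \<omega> - \<Xi> t \<omega>) / (T - t))\<^sup>2)
          = (\<integral>\<^sup>+t\<in>{S..b n}. ennreal (((\<Xi> T \<omega> - \<Xi> t \<omega>) / (T - t))\<^sup>2) \<partial>lborel)"
        by (rule nn[OF E(2), symmetric])
      also have "\<dots> \<le> target_energy \<omega>"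
        using b[of n] by (intro nn_integral_mono) (auto simp: indicator_def)
      finally show ?thesis by (simp add: add_left_mono)
    qed
    then show "eventually (\<lambda>n. (\<integral>\<^sup>+t. ennreal ((U t \<omega>)\<^sup>2) * indicator {S..b n} t \<partial>lborel) \<le> ?R) sequentially" by simp
  qed
qed

lemma Qbar_P: "t \<in> {0..S} \<Longrightarrow> (\<lambda>\<omega>. Qbar \<epsilon> Q0 t \<omega>) \<in> borel_measurable P"
  using F_P[OF _ Qe_adapted, of t] S_bounds by (simp add: Qe_first cong: measurable_cong)

sublocale space_time: pair_sigma_finite P "lborel :: real measure" ..

lemma joint_measurable[measurable]:
  "(\<lambda>p. Q0 (clip (snd p)) (fst p)) \<in> borel_measurable (P \<Otimes>\<^sub>M lborel)"
  "(\<lambda>p. \<Xi> (clip (snd p)) (fst p)) \<in> borel_measurable (P \<Otimes>\<^sub>M lborel)"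
  "(\<lambda>p. Qe (clip (snd p)) (fst p)) \<in> borel_measurable (P \<Otimes>\<^sub>M lborel)"
  "(\<lambda>p. U (clip (snd p)) (fst p)) \<in> borel_measurable (P \<Otimes>\<^sub>M lborel)"
  by (rule prog_measurable_joint, rule prog_Q0 prog_Xi prog_Qe prog_U)+

text \<open>Joint measurability is at hand only with the time clipped; on a set \<open>A\<close>
  inside \<open>{0..T}\<close> clipping changes nothing.\<close>

lemma Fubini_time:
  assumes "(\<lambda>p. h (clip (snd p)) (fst p)) \<in> borel_measurable (P \<Otimes>\<^sub>M lborel)" and [measurable]: "A \<in> sets borel" and A: "A \<subseteq> {0..T}"
  shows "(\<integral>\<^sup>+\<omega>. (\<integral>\<^sup>+t\<in>A. (h t \<omega> :: ennreal) \<partial>lborel) \<partial>P) = (\<integral>\<^sup>+t\<in>A. (\<integral>\<^sup>+\<omega>. h t \<omega> \<partial>P) \<partial>lborel)"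
    and "(\<lambda>\<omega>. \<integral>\<^sup>+t\<in>A. h t \<omega> \<partial>lborel) \<in> borel_measurable P"
proof -
  note [measurable] = assms(1)
  have m: "(\<lambda>p. h (clip (snd p)) (fst p) * indicator A (snd p)) \<in> borel_measurable (P \<Otimes>\<^sub>M lborel)" by measurable
  have eq: "h (clip t) \<omega> * indicator A t = h t \<omega> * indicator A t" for t \<omega>
    using A by (auto simp: indicator_def clip_id)
  from lborel.borel_measurable_nn_integral_fst[OF m] show "(\<lambda>\<omega>. \<integral>\<^sup>+t\<in>A. h t \<omega> \<partial>lborel) \<in> borel_measurable P"
    by (simp add: eq)
  have "(\<integral>\<^sup>+t. (\<integral>\<^sup>+\<omega>. h t \<omega> * indicator A t \<partial>P) \<partial>lborel) = (\<integral>\<^sup>+\<omega>. (\<integral>\<^sup>+t. h t \<omega> * indicator A t \<partial>lborel) \<partial>P)"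
    using space_time.Fubini[OF m] by (simp add: eq)
  also have "(\<integral>\<^sup>+t. (\<integral>\<^sup>+\<omega>. h t \<omega> * indicator A t \<partial>P) \<partial>lborel) = (\<integral>\<^sup>+t\<in>A. (\<integral>\<^sup>+\<omega>. h t \<omega> \<partial>P) \<partial>lborel)"
    by (intro nn_integral_cong) (auto simp: indicator_def)
  finally show "(\<integral>\<^sup>+\<omega>. (\<integral>\<^sup>+t\<in>A. (h t \<omega> :: ennreal) \<partial>lborel) \<partial>P) = (\<integral>\<^sup>+t\<in>A. (\<integral>\<^sup>+\<omega>. h t \<omega> \<partial>P) \<partial>lborel)" by simp
qed

lemma terminal_increments_le_Lambda:
  "(\<integral>\<^sup>+\<omega>. target_energy \<omega> \<partial>P) \<le> Lambda_target P T \<Xi>"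
    (is "?L \<le> _")
  and terminal_increments_measurable:
  "(\<lambda>\<omega>. target_energy \<omega>) \<in> borel_measurable P"
proof -
  note [measurable] = Xi_P[OF T_in]
  have A: "{S..<T} \<subseteq> {0..T}" using S_bounds by auto
  have m: "(\<lambda>p. ennreal (((\<Xi> T (fst p) - \<Xi> (clip (snd p)) (fst p)) / (T - clip (snd p)))\<^sup>2)) \<in> borel_measurable (P \<Otimes>\<^sub>M lborel)"
    by measurable
  note Fub = Fubini_time[of "\<lambda>t \<omega>. ennreal (((\<Xi> T \<omega> - \<Xi> t \<omega>) / (T - t))\<^sup>2)", OF m _ A]
  show "(\<lambda>\<omega>. target_energy \<omega>) \<in> borel_measurable P"
    by (rule Fub(2)) simp
  have "?L = (\<integral>\<^sup>+t\<in>{S..<T}. (\<integral>\<^sup>+\<omega>. ennreal (((\<Xi> T \<omega> - \<Xi> t \<omega>) / (T - t))\<^sup>2) \<partial>P) \<partial>lborel)"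
    by (rule Fub(1)) simp
  also have "\<dots> = (\<integral>\<^sup>+t\<in>{S..<T}. ennreal ((\<phi> T - \<phi> t) / (T - t)\<^sup>2) \<partial>lborel)"
  proof (rule nn_integral_cong)
    fix t
    show "(\<integral>\<^sup>+\<omega>. ennreal (((\<Xi> T \<omega> - \<Xi> t \<omega>) / (T - t))\<^sup>2) \<partial>P) * indicator {S..<T} t = ennreal ((\<phi> T - \<phi> t) / (T - t)\<^sup>2) * indicator {S..<T} t"
    proof (cases "t \<in> {S..<T}")
      case True
      then have t: "0 \<le> t" "t \<le> T" using A by auto
      have [measurable]: "\<Xi> t \<in> borel_measurable P" by (rule Xi_P) (use t in auto)
      have "(\<integral>\<^sup>+\<omega>. ennreal (((\<Xi> T \<omega> - \<Xi> t \<omega>) / (T - t))\<^sup>2) \<partial>P) = (\<integral>\<^sup>+\<omega>. ennreal (1 / (T - t)\<^sup>2) * ennreal ((\<Xi> T \<omega> - \<Xi> t \<omega>)\<^sup>2) \<partial>P)"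
        by (simp add: ennreal_mult[symmetric] power_divide)
      also have "\<dots> = ennreal (1 / (T - t)\<^sup>2) * ennreal (\<phi> T - \<phi> t)"
        by (subst nn_integral_cmult) (simp_all add: nn_Xi_increment_square[OF t order_refl])
      also have "\<dots> = ennreal ((\<phi> T - \<phi> t) / (T - t)\<^sup>2)"
        by (simp add: ennreal_mult'[symmetric])
      finally show ?thesis by simp
    qed simp
  qed
  also have "\<dots> \<le> Lambda_target P T \<Xi>" using S_bounds by (intro weighted_increments_le_Lambda) auto
  finally show "?L \<le> Lambda_target P T \<Xi>" .
qed

lemma U_square_measurable: "(\<lambda>\<omega>. energy {S..<T} U \<omega>) \<in> borel_measurable P"
  using S_bounds by (intro Fubini_time(2)) auto

text \<open>The parameter \<open>c\<close> will take two values: the maximal second moment of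
  \<open>Q0\<close> when finiteness is at stake, and \<open>2 * K0 + 2 * ennreal (\<phi> T)\<close>
  when the constant matters.\<close>

lemma second_phase_rate:
  assumes c: "\<And>r. 0 \<le> r \<Longrightarrow> r < T \<Longrightarrow> second_moment (Q0 r) \<le> c"
  shows "(\<integral>\<^sup>+\<omega>. energy {S..<T} U \<omega> \<partial>P)
    \<le> ennreal (1 / \<delta>) * (2 * ennreal (\<phi> T) + 2 * c) + Lambda_target P T \<Xi>"
proof -
  note [measurable] = Xi_P[OF T_in] terminal_increments_measurable
  have SS: "S \<in> {0..S}" "S \<in> {0..T}" using S_bounds by auto
  note [measurable] = Qbar_P[OF SS(1)]
  have "(\<integral>\<^sup>+\<omega>. ennreal ((\<Xi> T \<omega> - Qbar \<epsilon> Q0 S \<omega>)\<^sup>2) \<partial>P) \<le> (\<integral>\<^sup>+\<omega>. 2 * ennreal ((\<Xi> T \<omega>)\<^sup>2) + 2 * ennreal ((Qbar \<epsilon> Q0 S \<omega>)\<^sup>2) \<partial>P)"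
    by (intro nn_integral_mono ennreal_square_diff_le)
  also have "\<dots> = 2 * second_moment (\<Xi> T) + 2 * (\<integral>\<^sup>+\<omega>. ennreal ((Qbar \<epsilon> Q0 S \<omega>)\<^sup>2) \<partial>P)"
    by (subst nn_integral_add) (auto simp: nn_integral_cmult)
  also have "\<dots> \<le> 2 * ennreal (\<phi> T) + 2 * c"
    unfolding nn_Xi_square[OF T_in] by (intro add_left_mono mult_left_mono nn_Qbar_square_le[OF SS(2)] c) (use S_bounds in auto)
  finally have q: "(\<integral>\<^sup>+\<omega>. ennreal ((\<Xi> T \<omega> - Qbar \<epsilon> Q0 S \<omega>)\<^sup>2) \<partial>P) \<le> 2 * ennreal (\<phi> T) + 2 * c" .
  have "(\<integral>\<^sup>+\<omega>. energy {S..<T} U \<omega> \<partial>P)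
     \<le> (\<integral>\<^sup>+\<omega>. ennreal (1 / \<delta>) * ennreal ((\<Xi> T \<omega> - Qbar \<epsilon> Q0 S \<omega>)\<^sup>2)
    + target_energy \<omega> \<partial>P)"
    by (intro nn_integral_mono second_phase_energy_nn)
  also have "\<dots> = ennreal (1 / \<delta>) * (\<integral>\<^sup>+\<omega>. ennreal ((\<Xi> T \<omega> - Qbar \<epsilon> Q0 S \<omega>)\<^sup>2) \<partial>P)
    + (\<integral>\<^sup>+\<omega>. target_energy \<omega> \<partial>P)"
    by (subst nn_integral_add) (auto simp: nn_integral_cmult)
  also have "\<dots> \<le> ennreal (1 / \<delta>) * (2 * ennreal (\<phi> T) + 2 * c) + Lambda_target P T \<Xi>"
    by (intro add_mono mult_left_mono q terminal_increments_le_Lambda) auto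
  finally show ?thesis .
qed

lemma first_phase_error_measurable:
  "(\<lambda>\<omega>. first_error \<omega>) \<in> borel_measurable P"
proof -
  have "(\<lambda>\<omega>. \<integral>\<^sup>+t\<in>{0..S}. ennreal ((Qe t \<omega> - Q0 t \<omega>)\<^sup>2) \<partial>lborel) \<in> borel_measurable P"
    using S_bounds by (intro Fubini_time(2)) auto
  moreover have "(\<integral>\<^sup>+t\<in>{0..S}. ennreal ((Qe t \<omega> - Q0 t \<omega>)\<^sup>2) \<partial>lborel) = first_error \<omega>" for \<omega>
    by (intro nn_integral_cong) (auto simp: indicator_def Qe_first)
  ultimately show ?thesis by simp
qed

text \<open>A crude bound whose merit is finiteness; the sharper estimate by the translation
  seminorm lives in \<open>ennreal\<close> and does not by itself exclude an infinite value.\<close>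

lemma first_phase_error_finite:
  assumes c: "\<And>r. 0 \<le> r \<Longrightarrow> r < T \<Longrightarrow> second_moment (Q0 r) \<le> c" and fin: "c < \<infinity>"
  shows "(\<integral>\<^sup>+\<omega>. first_error \<omega> \<partial>P) < \<infinity>"
proof -
  have "(\<integral>\<^sup>+\<omega>. first_error \<omega> \<partial>P)
      = (\<integral>\<^sup>+\<omega>. (\<integral>\<^sup>+t\<in>{0..S}. ennreal ((Qe t \<omega> - Q0 t \<omega>)\<^sup>2) \<partial>lborel) \<partial>P)"
    by (intro nn_integral_cong) (auto simp: indicator_def Qe_first)
  also have "\<dots> = (\<integral>\<^sup>+t\<in>{0..S}. (\<integral>\<^sup>+\<omega>. ennreal ((Qe t \<omega> - Q0 t \<omega>)\<^sup>2) \<partial>P) \<partial>lborel)"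
    using S_bounds by (intro Fubini_time(1)) auto
  also have "\<dots> \<le> (\<integral>\<^sup>+t\<in>{0..S}. (2 * c + 2 * c) \<partial>lborel)"
  proof (rule nn_integral_mono)
    fix t
    show "(\<integral>\<^sup>+\<omega>. ennreal ((Qe t \<omega> - Q0 t \<omega>)\<^sup>2) \<partial>P) * indicator {0..S} t \<le> (2 * c + 2 * c) * indicator {0..S} t"
    proof (cases "t \<in> {0..S}")
      case True
      then have t: "t \<in> {0..T}" "0 \<le> t" "t < T" using S_bounds by auto
      note [measurable] = Qbar_P[OF True] Q0_P[OF t(1)]
      have "(\<integral>\<^sup>+\<omega>. ennreal ((Qe t \<omega> - Q0 t \<omega>)\<^sup>2) \<partial>P) \<le> (\<integral>\<^sup>+\<omega>. 2 * ennreal ((Qbar \<epsilon> Q0 t \<omega>)\<^sup>2) + 2 * ennreal ((Q0 t \<omega>)\<^sup>2) \<partial>P)"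
        using True by (intro nn_integral_mono) (simp add: Qe_first ennreal_square_diff_le)
      also have "\<dots> = 2 * (\<integral>\<^sup>+\<omega>. ennreal ((Qbar \<epsilon> Q0 t \<omega>)\<^sup>2) \<partial>P) + 2 * second_moment (Q0 t)"
        by (subst nn_integral_add) (auto simp: nn_integral_cmult)
      also have "\<dots> \<le> 2 * c + 2 * c"
        using t by (intro add_mono mult_left_mono nn_Qbar_square_le c) auto
      finally show ?thesis using True by simp
    qed simp
  qed
  also have "\<dots> = (2 * c + 2 * c) * ennreal S"
    using S_bounds by (subst nn_integral_cmult_indicator) auto
  also have "\<dots> < \<infinity>" using fin by (simp add: ennreal_mult_less_top)
  finally show ?thesis .
qed

text \<open>In the first phase the rate is the tracking error divided by \<open>\<delta>\<close>,
  and \<open>\<epsilon>\<close> is the square of \<open>\<delta>\<close>: there the two costs are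
  the same quantity.\<close>

lemma rate_energy_split:
  "ennreal \<epsilon> * energy {0..T} U \<omega> \<le>
    first_error \<omega>
    + ennreal \<epsilon> * energy {S..<T} U \<omega>" if \<omega>: "\<omega> \<in> space P"
proof -
  note [measurable] = prog_measurable_path[OF prog_U \<omega>] prog_measurable_path[OF prog_Qe \<omega>] prog_measurable_path[OF prog_Q0 \<omega>]
  let ?a = "\<lambda>t. ennreal ((Qe (clip t) \<omega> - Q0 (clip t) \<omega>)\<^sup>2) * indicator {0..S} t"
  let ?b = "\<lambda>t. ennreal ((U (clip t) \<omega>)\<^sup>2) * indicator {S..<T} t"
  let ?u = "\<lambda>t. ennreal ((U (clip t) \<omega>)\<^sup>2) * indicator {0..T} t"
  have "energy {0..T} U \<omega> = (\<integral>\<^sup>+t. ?u t \<partial>lborel)"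
    by (intro nn_integral_cong) (auto simp: indicator_def clip_id)
  then have "ennreal \<epsilon> * energy {0..T} U \<omega> = ennreal \<epsilon> * (\<integral>\<^sup>+t. ?u t \<partial>lborel)"
    by simp
  also have "\<dots> = (\<integral>\<^sup>+t. ennreal \<epsilon> * ?u t \<partial>lborel)" by (intro nn_integral_cmult[symmetric]) measurable
  also have "\<dots> \<le> (\<integral>\<^sup>+t. ?a t + ennreal \<epsilon> * ?b t \<partial>lborel)"
  proof (rule nn_integral_mono)
    fix t
    consider "t \<notin> {0..T}" | "0 \<le> t" "t < S" | "S \<le> t" "t < T" | "t = T" by fastforce
    then show "ennreal \<epsilon> * ?u t \<le> ?a t + ennreal \<epsilon> * ?b t"
    proof cases
      case 2
      then have c: "clip t = t" using S_bounds by auto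
      have "\<epsilon> * (U t \<omega>)\<^sup>2 = (Qe t \<omega> - Q0 t \<omega>)\<^sup>2"
        using 2 eps_pos by (simp add: U_first Qe_first power_divide \<delta>_square power2_commute[of "Q0 t \<omega>"])
      then have "ennreal \<epsilon> * ennreal ((U t \<omega>)\<^sup>2) = ennreal ((Qe t \<omega> - Q0 t \<omega>)\<^sup>2)"
        using eps_pos by (simp add: ennreal_mult[symmetric])
      then show ?thesis unfolding c using 2 S_bounds by simp
    next
      case 3
      then have "clip t = t" using S_bounds by auto
      then show ?thesis using 3 S_bounds by simp
    next
      \<comment> \<open>At \<open>T\<close> the feedback formula divides by zero, hence gives the
        rate 0.\<close>
      case 4
      then have "U (clip t) \<omega> = 0" using S_bounds horizon_pos by (simp add: U_second)
      then show ?thesis by simp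
    qed simp
  qed
  also have "\<dots> = (\<integral>\<^sup>+t. ?a t \<partial>lborel) + ennreal \<epsilon> * (\<integral>\<^sup>+t. ?b t \<partial>lborel)"
    by (subst nn_integral_add) (auto simp: nn_integral_cmult)
  also have "(\<integral>\<^sup>+t. ?a t \<partial>lborel) = first_error \<omega>"
    using S_bounds by (intro nn_integral_cong) (auto simp: indicator_def clip_id Qe_first)
  also have "(\<integral>\<^sup>+t. ?b t \<partial>lborel) = energy {S..<T} U \<omega>"
    using S_bounds by (intro nn_integral_cong) (auto simp: indicator_def clip_id)
  finally show ?thesis .
qed

text \<open>In the second phase \<open>\<Xi> - Qe\<close> is \<open>(T - t) * U\<close> with
  \<open>(T - t)^2 \<le> \<epsilon>\<close>, so the distance to the target is again charged to the
  energy of the rate; what remains is the distance from \<open>Q0\<close> to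
  \<open>\<Xi>\<close>.\<close>

lemma tracking_error_split:
  "(\<integral>\<^sup>+t\<in>{0..T}. ennreal ((Qe t \<omega> - Q0 t \<omega>)\<^sup>2) \<partial>lborel) \<le>
    first_error \<omega>
    + (2 * ennreal \<epsilon> * energy {S..<T} U \<omega>
    + 2 * target_distance \<omega>)" if \<omega>: "\<omega> \<in> space P"
proof -
  note [measurable] = prog_measurable_path[OF prog_U \<omega>] prog_measurable_path[OF prog_Qe \<omega>] prog_measurable_path[OF prog_Q0 \<omega>]
    prog_measurable_path[OF prog_Xi \<omega>]
  let ?a = "\<lambda>t. ennreal ((Qe (clip t) \<omega> - Q0 (clip t) \<omega>)\<^sup>2) * indicator {0..S} t"
  let ?b = "\<lambda>t. ennreal ((U (clip t) \<omega>)\<^sup>2) * indicator {S..<T} t"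
  let ?c = "\<lambda>t. ennreal ((Q0 (clip t) \<omega> - \<Xi> (clip t) \<omega>)\<^sup>2) * indicator {S..<T} t"
  have "(\<integral>\<^sup>+t\<in>{0..T}. ennreal ((Qe t \<omega> - Q0 t \<omega>)\<^sup>2) \<partial>lborel) \<le> (\<integral>\<^sup>+t. ?a t + (2 * ennreal \<epsilon> * ?b t + 2 * ?c t) \<partial>lborel)"
  proof (rule nn_integral_mono_AE, use AE_lborel_singleton[of T] in eventually_elim)
    fix t assume "t \<noteq> T"
    then consider "t \<notin> {0..T}" | "0 \<le> t" "t < S" | "S \<le> t" "t < T" by fastforce
    then show "ennreal ((Qe t \<omega> - Q0 t \<omega>)\<^sup>2) * indicator {0..T} t \<le> ?a t + (2 * ennreal \<epsilon> * ?b t + 2 * ?c t)"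
    proof cases
      case 2
      then show ?thesis using S_bounds by simp
    next
      case 3
      then have c: "clip t = t" using S_bounds by auto
      have "\<Xi> t \<omega> - Qe t \<omega> = (T - t) * U t \<omega>" using 3 by (simp add: U_second)
      then have "Qe t \<omega> - Q0 t \<omega> = - ((T - t) * U t \<omega>) - (Q0 t \<omega> - \<Xi> t \<omega>)" by simp
      then have split: "ennreal ((Qe t \<omega> - Q0 t \<omega>)\<^sup>2) \<le> 2 * ennreal ((- ((T - t) * U t \<omega>))\<^sup>2) + 2 * ennreal ((Q0 t \<omega> - \<Xi> t \<omega>)\<^sup>2)"
        by (simp only: ennreal_square_diff_le)
      have "(T - t)\<^sup>2 \<le> \<delta>\<^sup>2" using 3 by (intro power_mono) (auto simp: S_def)
      then have "(T - t)\<^sup>2 \<le> \<epsilon>" by (simp add: \<delta>_square)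
      then have "(- ((T - t) * U t \<omega>))\<^sup>2 \<le> \<epsilon> * (U t \<omega>)\<^sup>2" by (simp add: power_mult_distrib mult_right_mono)
      then have "ennreal ((- ((T - t) * U t \<omega>))\<^sup>2) \<le> ennreal (\<epsilon> * (U t \<omega>)\<^sup>2)" by (rule ennreal_leI)
      then have "ennreal ((- ((T - t) * U t \<omega>))\<^sup>2) \<le> ennreal \<epsilon> * ennreal ((U t \<omega>)\<^sup>2)" using eps_pos by (simp add: ennreal_mult)
      from order_trans[OF split add_right_mono[OF mult_left_mono[OF this]]]
      have "ennreal ((Qe t \<omega> - Q0 t \<omega>)\<^sup>2) \<le> 2 * (ennreal \<epsilon> * ennreal ((U t \<omega>)\<^sup>2)) + 2 * ennreal ((Q0 t \<omega> - \<Xi> t \<omega>)\<^sup>2)"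
        by simp
      also have "\<dots> \<le> ?a t + (2 * ennreal \<epsilon> * ?b t + 2 * ?c t)"
        unfolding c using 3 by (simp add: mult.assoc)
      finally show ?thesis using 3 S_bounds by simp
    qed simp
  qed
  also have "\<dots> = (\<integral>\<^sup>+t. ?a t \<partial>lborel) + (2 * ennreal \<epsilon> * (\<integral>\<^sup>+t. ?b t \<partial>lborel) + 2 * (\<integral>\<^sup>+t. ?c t \<partial>lborel))"
    by (simp add: nn_integral_add nn_integral_cmult)
  also have "(\<integral>\<^sup>+t. ?a t \<partial>lborel) = first_error \<omega>"
    using S_bounds by (intro nn_integral_cong) (auto simp: indicator_def clip_id Qe_first)
  also have "(\<integral>\<^sup>+t. ?b t \<partial>lborel) = energy {S..<T} U \<omega>"
    using S_bounds by (intro nn_integral_cong) (auto simp: indicator_def clip_id)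
  also have "(\<integral>\<^sup>+t. ?c t \<partial>lborel) = target_distance \<omega>"
    using S_bounds by (intro nn_integral_cong) (auto simp: indicator_def clip_id)
  finally show ?thesis .
qed

text \<open>Before \<open>T\<close> the integral identity is pathwise. At \<open>T\<close> both
  sides are left limits: the integral of the rate is continuous because the energy is finite, and
  \<open>Qe\<close> tends to \<open>\<Xi> T\<close> because \<open>\<Xi>\<close> almost surely has
  no jump there. Hence the energy bound comes before the identity.\<close>

lemma Qe_trading_rate:
  assumes Lam: "Lambda_target P T \<Xi> < \<infinity>"
    and c: "\<And>r. 0 \<le> r \<Longrightarrow> r < T \<Longrightarrow> second_moment (Q0 r) \<le> c" and fin: "c < \<infinity>"
  shows "trading_rate P F T Qe U"
proof -
  have "ennreal \<epsilon> * (\<integral>\<^sup>+\<omega>. energy {0..T} U \<omega> \<partial>P)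
     = (\<integral>\<^sup>+\<omega>. ennreal \<epsilon> * energy {0..T} U \<omega> \<partial>P)"
    by (intro nn_integral_cmult[symmetric] prog_measurable_square_energy prog_U)
  also have "\<dots> \<le> (\<integral>\<^sup>+\<omega>. first_error \<omega>
    + ennreal \<epsilon> * energy {S..<T} U \<omega> \<partial>P)"
    by (intro nn_integral_mono rate_energy_split)
  also have "\<dots> = (\<integral>\<^sup>+\<omega>. first_error \<omega> \<partial>P)
    + ennreal \<epsilon> * (\<integral>\<^sup>+\<omega>. energy {S..<T} U \<omega> \<partial>P)"
    using first_phase_error_measurable U_square_measurable by (simp add: nn_integral_add nn_integral_cmult)
  also have "\<dots> < \<infinity>"
  proof -
    have "ennreal (1 / \<delta>) * (2 * ennreal (\<phi> T) + 2 * c) + Lambda_target P T \<Xi> < \<infinity>"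
      using Lam fin by (simp add: ennreal_mult_less_top)
    with second_phase_rate[OF c] have "(\<integral>\<^sup>+\<omega>. energy {S..<T} U \<omega> \<partial>P) < \<infinity>"
      by (rule le_less_trans)
    then show ?thesis using first_phase_error_finite[OF c fin] by (simp add: ennreal_mult_less_top)
  qed
  finally have energy: "(\<integral>\<^sup>+\<omega>. energy {0..T} U \<omega> \<partial>P) < \<infinity>"
    using eps_pos by (auto simp: ennreal_mult_less_top)
  have "AE \<omega> in P. energy {0..T} U \<omega> \<noteq> \<infinity>"
    using energy by (intro nn_integral_PInf_AE prog_measurable_square_energy[OF prog_U]) auto
  then have "AE \<omega> in P. \<forall>t\<in>{0..T}. Qe t \<omega> = (LINT s:{0..t}|lborel. U s \<omega>)"
    using Xi_no_jump_T[OF Lam] AE_space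
  proof eventually_elim
    case (elim \<omega>)
    have i: "set_integrable lborel {0..T} (\<lambda>t. U t \<omega>)"
      using elim(1,3) by (intro square_integrable_imp_set_integrable prog_measurable_path_indicator[OF prog_U]) (auto simp: top.not_eq_extremum)
    have Q0: "Qe 0 \<omega> = 0"
      using S_bounds by (simp add: Qe_first Qbar_def set_integral_point_zero)
    have before: "Qe t \<omega> = (LINT s:{0..t}|lborel. U s \<omega>)" if t: "0 \<le> t" "t < T" for t
    proof -
      \<comment> \<open>\<open>Qe_primitive\<close> covers both phases and so has to reach
        \<open>S\<close>, even when \<open>t\<close> lies in the first one.\<close>
      have "primitive_on 0 (max t S) (\<lambda>t. U t \<omega>) (\<lambda>t. Qe t \<omega>)"
        using t S_bounds by (intro Qe_primitive[OF elim(3)]) auto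
      from primitive_on_eq[OF this, of t] t Q0 show ?thesis by simp
    qed
    have "continuous_on {0..T} (\<lambda>t. 0 + (LINT s:{0..t}|lborel. U s \<omega>))"
      by (rule primitive_on_continuous[OF primitive_on_indefinite_integral[OF i]])
    then have "((\<lambda>t. 0 + (LINT s:{0..t}|lborel. U s \<omega>)) \<longlongrightarrow> 0 + (LINT s:{0..T}|lborel. U s \<omega>)) (at T within {0..T})"
      using horizon_pos by (auto simp: continuous_on_def)
    then have "((\<lambda>t. LINT s:{0..t}|lborel. U s \<omega>) \<longlongrightarrow> (LINT s:{0..T}|lborel. U s \<omega>)) (at_left T)"
      using horizon_pos by (simp add: at_within_Icc_at_left)
    moreover have "eventually (\<lambda>t. (LINT s:{0..t}|lborel. U s \<omega>) = Qe t \<omega>) (at_left T)"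
      unfolding eventually_at_left_field using horizon_pos before by (intro exI[of _ 0]) auto
    ultimately have "((\<lambda>t. Qe t \<omega>) \<longlongrightarrow> (LINT s:{0..T}|lborel. U s \<omega>)) (at_left T)"
      by (rule Lim_transform_eventually)
    from tendsto_unique[OF _ this Qe_left_limit[OF elim(3,2)]]
    have "(LINT s:{0..T}|lborel. U s \<omega>) = \<Xi> T \<omega>" by simp
    then have "Qe T \<omega> = (LINT s:{0..T}|lborel. U s \<omega>)" by (simp add: Qe_T)
    then show ?case using before by (metis atLeastAtMost_iff order_le_less)
  qed
  then show ?thesis using energy prog_U by (simp add: trading_rate_def)
qed

end


section \<open>The cost bound\<close>

text \<open>The bookkeeping of the constants. The second-phase energy occurs three times, twice from
  the tracking error and once from the rate, which makes 12 K, 18 p and 3 L; the distance from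
  \<open>Q0\<close> to the target adds 2 K, and the first-phase error occurs twice. The last line is
  the slack up to the coefficients 16, 20 and 4. It is written as a sum because
  \<open>ennreal\<close> has no additive inverses.\<close>

lemma semiring_cost_identity:
  fixes TR C K p d e L :: "'a :: comm_semiring_1"
  shows "2 * (C + 2 * TR + 8 * K + 10 * p) * d + 4 * L * e =
    (((2 * d * TR + d * C) + (2 * (d * (2 * p + 2 * (2 * K + 2 * p)) + e * L) + 2 * (K * d)))
    + ((2 * d * TR + d * C) + (d * (2 * p + 2 * (2 * K + 2 * p)) + e * L)))
    + (2 * (K * d) + 2 * (p * d) + L * e)"
  by (simp only: numeral_Bit0 numeral_Bit1 numeral_One distrib_left distrib_right mult_1_left mult_1_right mult_ac add_ac)

context relaxation
begin

abbreviation "K0 \<equiv> K0_const P T \<Xi> Q0"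

text \<open>\<open>K0\<close> controls the distance to \<open>\<Xi>\<close>, whose second moment is
  largest at \<open>T\<close>.\<close>

lemma Q0_second_moment_le: assumes r: "0 \<le> r" "r < T"
  shows "second_moment (Q0 r) \<le> 2 * K0 + 2 * ennreal (\<phi> T)"
proof -
  have r': "r \<in> {0..T}" using r by auto
  note [measurable] = Q0_P[OF r'] Xi_P[OF r']
  have "second_moment (Q0 r) \<le> (\<integral>\<^sup>+\<omega>. 2 * ennreal ((Q0 r \<omega> - \<Xi> r \<omega>)\<^sup>2) + 2 * ennreal ((\<Xi> r \<omega>)\<^sup>2) \<partial>P)"
  proof (rule nn_integral_mono)
    fix \<omega>
    show "ennreal ((Q0 r \<omega>)\<^sup>2) \<le> 2 * ennreal ((Q0 r \<omega> - \<Xi> r \<omega>)\<^sup>2) + 2 * ennreal ((\<Xi> r \<omega>)\<^sup>2)"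
      using ennreal_square_diff_le[of "Q0 r \<omega> - \<Xi> r \<omega>" "- \<Xi> r \<omega>"] by simp
  qed
  also have "\<dots> = 2 * (\<integral>\<^sup>+\<omega>. ennreal ((Q0 r \<omega> - \<Xi> r \<omega>)\<^sup>2) \<partial>P) + 2 * second_moment (\<Xi> r)"
    by (simp add: nn_integral_add nn_integral_cmult)
  also have "\<dots> \<le> 2 * K0 + 2 * ennreal (\<phi> T)"
  proof (intro add_mono mult_left_mono)
    show "(\<integral>\<^sup>+\<omega>. ennreal ((Q0 r \<omega> - \<Xi> r \<omega>)\<^sup>2) \<partial>P) \<le> K0"
      unfolding K0_const_def by (rule SUP_upper) (use r in auto)
    show "second_moment (\<Xi> r) \<le> ennreal (\<phi> T)"
      using nn_Xi_square[OF r'] \<phi>_mono[of r T] r by (simp add: ennreal_leI)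
  qed auto
  finally show ?thesis .
qed

lemma target_distance_measurable:
  "(\<lambda>\<omega>. target_distance \<omega>) \<in> borel_measurable P"
  using S_bounds by (intro Fubini_time(2)) auto

lemma target_distance_le:
  "(\<integral>\<^sup>+\<omega>. target_distance \<omega> \<partial>P) \<le> K0 * ennreal \<delta>"
proof -
  have "(\<integral>\<^sup>+\<omega>. target_distance \<omega> \<partial>P)
      = (\<integral>\<^sup>+t\<in>{S..<T}. (\<integral>\<^sup>+\<omega>. ennreal ((Q0 t \<omega> - \<Xi> t \<omega>)\<^sup>2) \<partial>P) \<partial>lborel)"
    using S_bounds by (intro Fubini_time(1)) auto
  also have "\<dots> \<le> (\<integral>\<^sup>+t\<in>{S..<T}. K0 \<partial>lborel)"
  proof (rule nn_integral_mono)
    fix t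
    show "(\<integral>\<^sup>+\<omega>. ennreal ((Q0 t \<omega> - \<Xi> t \<omega>)\<^sup>2) \<partial>P) * indicator {S..<T} t \<le> K0 * indicator {S..<T} t"
    proof (cases "t \<in> {S..<T}")
      case True
      then have "(\<integral>\<^sup>+\<omega>. ennreal ((Q0 t \<omega> - \<Xi> t \<omega>)\<^sup>2) \<partial>P) \<le> K0"
        unfolding K0_const_def using S_bounds by (intro SUP_upper) auto
      then show ?thesis using True by simp
    qed simp
  qed
  also have "\<dots> = K0 * ennreal \<delta>"
    using S_bounds by (subst nn_integral_cmult_indicator) auto
  finally show ?thesis .
qed

text \<open>Any rate \<open>u\<close> agrees with \<open>U\<close> almost everywhere, so its energy
  may be replaced by that of \<open>U\<close>. \<open>C\<close> is kept abstract here; it stands for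
  the bound on the initial jump.\<close>

lemma total_cost_le:
  assumes u: "trading_rate P F T Qe u" and U: "trading_rate P F T Qe U"
    and C: "second_moment (Q0 0) \<le> C"
  shows "(\<integral>\<^sup>+\<omega>. ((\<integral>\<^sup>+t\<in>{0..T}. ennreal ((Qe t \<omega> - Q0 t \<omega>)\<^sup>2) \<partial>lborel)
            + ennreal \<epsilon> * energy {0..T} u \<omega>) \<partial>P)
    \<le> 2 * (C + 2 * tr_seminorm_sq P T Q0 + 8 * K0 + 10 * ennreal (\<phi> T)) * ennreal \<delta>
      + 4 * Lambda_target P T \<Xi> * ennreal \<epsilon>"
proof -
  define a where "a \<omega> = first_error \<omega>" for \<omega>
  define b where "b \<omega> = energy {S..<T} U \<omega>" for \<omega>
  define c where "c \<omega> = target_distance \<omega>" for \<omega>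
  define TR where "TR = tr_seminorm_sq P T Q0"
  define L where "L = Lambda_target P T \<Xi>"
  define p where "p = ennreal (\<phi> T)"
  define d where "d = ennreal \<delta>"
  define e where "e = ennreal \<epsilon>"
  have [measurable]: "a \<in> borel_measurable P" "b \<in> borel_measurable P" "c \<in> borel_measurable P"
    unfolding a_def b_def c_def
    by (rule first_phase_error_measurable U_square_measurable target_distance_measurable)+
  have "(\<integral>\<^sup>+\<omega>. ((\<integral>\<^sup>+t\<in>{0..T}. ennreal ((Qe t \<omega> - Q0 t \<omega>)\<^sup>2) \<partial>lborel)
            + ennreal \<epsilon> * energy {0..T} u \<omega>) \<partial>P)
     \<le> (\<integral>\<^sup>+\<omega>. (a \<omega> + (2 * e * b \<omega> + 2 * c \<omega>)) + (a \<omega> + e * b \<omega>) \<partial>P)"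
  proof (rule nn_integral_mono_AE, use trading_rate_unique[OF u U] AE_space in eventually_elim)
    fix \<omega> assume eq: "AE t in lborel. t \<in> {0..T} \<longrightarrow> u t \<omega> = U t \<omega>" and \<omega>: "\<omega> \<in> space P"
    have "energy {0..T} u \<omega> = energy {0..T} U \<omega>"
      by (rule nn_integral_cong_AE, use eq in eventually_elim) (auto simp: indicator_def)
    then show "(\<integral>\<^sup>+t\<in>{0..T}. ennreal ((Qe t \<omega> - Q0 t \<omega>)\<^sup>2) \<partial>lborel)
            + ennreal \<epsilon> * energy {0..T} u \<omega>
        \<le> (a \<omega> + (2 * e * b \<omega> + 2 * c \<omega>)) + (a \<omega> + e * b \<omega>)"
      unfolding a_def b_def c_def e_def
      using add_mono[OF tracking_error_split[OF \<omega>] rate_energy_split[OF \<omega>]] by simp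
  qed
  also have "\<dots> = ((\<integral>\<^sup>+\<omega>. a \<omega> \<partial>P) + (2 * (e * (\<integral>\<^sup>+\<omega>. b \<omega> \<partial>P)) + 2 * (\<integral>\<^sup>+\<omega>. c \<omega> \<partial>P))) + ((\<integral>\<^sup>+\<omega>. a \<omega> \<partial>P) + e * (\<integral>\<^sup>+\<omega>. b \<omega> \<partial>P))"
    by (simp add: nn_integral_add nn_integral_cmult mult.assoc)
  also have "\<dots> \<le> ((2 * d * TR + d * C) + (2 * (d * (2 * p + 2 * (2 * K0 + 2 * p)) + e * L) + 2 * (K0 * d)))
    + ((2 * d * TR + d * C) + (d * (2 * p + 2 * (2 * K0 + 2 * p)) + e * L))"
  proof -
    have A: "(\<integral>\<^sup>+\<omega>. a \<omega> \<partial>P) \<le> 2 * d * TR + d * C"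
      unfolding a_def d_def TR_def
      by (rule order_trans[OF tracking_error_first_phase add_left_mono[OF mult_left_mono[OF C]]]) simp
    have "(\<integral>\<^sup>+\<omega>. b \<omega> \<partial>P) \<le> ennreal (1 / \<delta>) * (2 * p + 2 * (2 * K0 + 2 * p)) + L"
      unfolding b_def p_def L_def by (rule second_phase_rate[OF Q0_second_moment_le])
    then have "e * (\<integral>\<^sup>+\<omega>. b \<omega> \<partial>P) \<le> e * (ennreal (1 / \<delta>) * (2 * p + 2 * (2 * K0 + 2 * p)) + L)"
      by (rule mult_left_mono) simp
    also have "\<dots> = (e * ennreal (1 / \<delta>)) * (2 * p + 2 * (2 * K0 + 2 * p)) + e * L"
      by (simp only: distrib_left mult.assoc)
    \<comment> \<open>The factor \<open>1 / \<delta>\<close> from the initial gap meets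
      \<open>\<epsilon>\<close>, which leaves the order \<open>\<delta>\<close>.\<close>
    also have "e * ennreal (1 / \<delta>) = d"
    proof -
      have "\<epsilon> * (1 / \<delta>) = \<delta>" using \<delta>_pos \<delta>_square by (simp add: power2_eq_square field_simps)
      then show ?thesis using eps_pos \<delta>_pos unfolding e_def d_def by (simp add: ennreal_mult[symmetric])
    qed
    finally have B: "e * (\<integral>\<^sup>+\<omega>. b \<omega> \<partial>P) \<le> d * (2 * p + 2 * (2 * K0 + 2 * p)) + e * L" .
    have Cc: "(\<integral>\<^sup>+\<omega>. c \<omega> \<partial>P) \<le> K0 * d" unfolding c_def d_def by (rule target_distance_le)
    show ?thesis by (intro add_mono mult_left_mono A B Cc) auto
  qed
  also have "\<dots> \<le> 2 * (C + 2 * TR + 8 * K0 + 10 * p) * d + 4 * L * e"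
    unfolding semiring_cost_identity by (rule add_increasing2) auto
  finally show ?thesis unfolding TR_def L_def p_def d_def e_def .
qed

text \<open>\<open>\<epsilon> \<le> T^2 / 4\<close> means \<open>\<delta> \<le> T / 2\<close>, hence
  \<open>4 * \<epsilon> \<le> 2 * T * \<delta>\<close>; this is the source of the factor
  \<open>2 * T\<close> in \<open>Ctr\<close>.\<close>

lemma Lambda_remainder_le:
  "4 * Lambda_target P T \<Xi> * ennreal \<epsilon> \<le> 2 * ennreal T * Lambda_target P T \<Xi> * ennreal \<delta>"
proof -
  have "4 * ennreal \<epsilon> = ennreal (4 * \<epsilon>)" using eps_pos by (subst ennreal_mult) auto
  also have "\<dots> \<le> ennreal (2 * T * \<delta>)"
  proof (rule ennreal_leI)
    have "\<delta> * \<delta> \<le> T / 2 * \<delta>" using \<delta>_le \<delta>_pos by (intro mult_right_mono) auto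
    then show "4 * \<epsilon> \<le> 2 * T * \<delta>" using \<delta>_square by (simp add: power2_eq_square)
  qed
  also have "\<dots> = 2 * ennreal T * ennreal \<delta>" using horizon_pos \<delta>_pos by (simp add: ennreal_mult)
  finally have "Lambda_target P T \<Xi> * (4 * ennreal \<epsilon>) \<le> Lambda_target P T \<Xi> * (2 * ennreal T * ennreal \<delta>)"
    by (rule mult_left_mono) simp
  then show ?thesis by (simp add: mult_ac)
qed

end

theorem lemma5p5:
  fixes P :: "'a measure" and F :: "real \<Rightarrow> 'a measure" and T y \<epsilon> :: real
    and \<beta> lam dlam :: "real \<Rightarrow> real" and \<Xi> Q0 I M :: "real \<Rightarrow> 'a \<Rightarrow> real"
  assumes space: "usual_filtered_prob_space P F T"
    and coeff: "coefficients T \<beta> lam dlam"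
    and target: "target_process P F T \<Xi>"
    and Lambda_finite: "Lambda_target P T \<Xi> < \<infinity>"
    and minimizer: "is_arg_min (execution_cost P F T \<beta> lam y) (\<lambda>Q. Q \<in> strategies P F T \<Xi>) Q0"
    and I: "is_stoch_integral P F T (\<lambda>s _. opt_integrand T \<beta> lam dlam s) \<Xi> I"
    and M: "M = opt_martingale T \<beta> lam dlam y \<Xi> I"
    and representation: "optimal_representation P T \<beta> lam dlam y \<Xi> M Q0"
    and eps: "0 < \<epsilon>" "\<epsilon> \<le> T\<^sup>2 / 4"
  shows "Qeps T \<Xi> Q0 \<epsilon> \<in> ac_strategies P F T \<Xi> \<and>
    (\<forall>u. trading_rate P F T (Qeps T \<Xi> Q0 \<epsilon>) u \<longrightarrow>
       (AE (\<omega>, t) in P \<Otimes>\<^sub>M lborel. t \<in> {0..<T} \<longrightarrow>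
          u t \<omega> = feedback_rate T \<Xi> Q0 \<epsilon> (Qeps T \<Xi> Q0 \<epsilon>) t \<omega>) \<and>
       (\<integral>\<^sup>+\<omega>. ((\<integral>\<^sup>+t\<in>{0..T}. ennreal ((Qeps T \<Xi> Q0 \<epsilon> t \<omega> - Q0 t \<omega>)\<^sup>2) \<partial>lborel)
            + ennreal \<epsilon> * (\<integral>\<^sup>+t\<in>{0..T}. ennreal ((u t \<omega>)\<^sup>2) \<partial>lborel)) \<partial>P)
         \<le> Ctr_tilde P T \<beta> lam dlam y \<Xi> M Q0 * ennreal (sqrt \<epsilon>)
           + 4 * Lambda_target P T \<Xi> * ennreal \<epsilon> \<and>
       Ctr_tilde P T \<beta> lam dlam y \<Xi> M Q0 * ennreal (sqrt \<epsilon>)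
           + 4 * Lambda_target P T \<Xi> * ennreal \<epsilon>
         \<le> Ctr P T \<beta> lam dlam y \<Xi> M Q0 * ennreal (sqrt \<epsilon>))"
proof -
  have strategy: "Q0 \<in> strategies P F T \<Xi>" using minimizer by (simp add: is_arg_min_def)
  interpret usual_filtered_prob_space P F T by (rule space)
  interpret relaxation P F T \<Xi> Q0 \<epsilon>
    using target eps strategy by unfold_locales (auto simp: strategies_def semimartingale_def)
  \<comment> \<open>The maximal second moment, finite by membership in \<open>strategies\<close>,
    bounds all second moments of \<open>Q0\<close> before \<open>T\<close> at once.\<close>
  define c where "c = (\<integral>\<^sup>+\<omega>. (SUP t\<in>{0..T}. ennreal ((Q0 t \<omega>)\<^sup>2)) \<partial>P)"
  have "(\<integral>\<^sup>+\<omega>. ennreal ((Q0 r \<omega>)\<^sup>2) \<partial>P) \<le> c" if "0 \<le> r" "r < T" for r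
    unfolding c_def using that by (intro nn_integral_mono SUP_upper) auto
  moreover have "c < \<infinity>" using strategy by (simp add: strategies_def c_def)
  ultimately have U: "trading_rate P F T Qe U" by (rule Qe_trading_rate[OF Lambda_finite])
  have Ctr_tilde: "Ctr_tilde P T \<beta> lam dlam y \<Xi> M Q0 =
      2 * (C0_const P T \<beta> lam dlam y M + 2 * tr_seminorm_sq P T Q0 + 8 * K0 + 10 * ennreal (\<phi> T))"
    by (simp add: Ctr_tilde_def nn_Xi_square[OF T_in])
  have "Qe \<in> ac_strategies P F T \<Xi>"
    by (rule trading_rate_imp_ac_strategy[OF Qe_cadlag_adapted U]) (simp add: Qe_T)
  moreover have "AE (\<omega>, t) in P \<Otimes>\<^sub>M lborel. t \<in> {0..<T} \<longrightarrow> u t \<omega> = U t \<omega>"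
    if "trading_rate P F T Qe u" for u
    using trading_rate_unique_joint[OF that U] by eventually_elim auto
  moreover have "(\<integral>\<^sup>+\<omega>. ((\<integral>\<^sup>+t\<in>{0..T}. ennreal ((Qe t \<omega> - Q0 t \<omega>)\<^sup>2) \<partial>lborel)
            + ennreal \<epsilon> * (\<integral>\<^sup>+t\<in>{0..T}. ennreal ((u t \<omega>)\<^sup>2) \<partial>lborel)) \<partial>P)
         \<le> Ctr_tilde P T \<beta> lam dlam y \<Xi> M Q0 * ennreal (sqrt \<epsilon>) + 4 * Lambda_target P T \<Xi> * ennreal \<epsilon>"
    if "trading_rate P F T Qe u" for u
    using total_cost_le[OF that U initial_value_le_C0[OF coeff I M representation]]
    unfolding Ctr_tilde \<delta>_def .
  moreover have "Ctr_tilde P T \<beta> lam dlam y \<Xi> M Q0 * ennreal (sqrt \<epsilon>) + 4 * Lambda_target P T \<Xi> * ennreal \<epsilon>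
         \<le> Ctr P T \<beta> lam dlam y \<Xi> M Q0 * ennreal (sqrt \<epsilon>)"
    unfolding Ctr_def distrib_right using Lambda_remainder_le unfolding \<delta>_def by (rule add_left_mono)
  ultimately show ?thesis by blast
qed

end
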